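(* Let $\mathcal{V}$ be any non-distributive lattice variety and let $X$ be a set with $|X|\geq\aleph_2$. Let $F_{\mathcal{V}}(X)$ be the free $\{0,1\}$-lattice in $\mathcal{V}$ on $X$. Then there exists no (von Neumann) regular ring $R$ such that $V(R)\cong\operatorname{Dim}(F_{\mathcal{V}}(X))$.
   Context: A lattice variety is non-distributive if it contains at least one non-distributive lattice. The free $\{0,1\}$-lattice in $\mathcal{V}$ on $X$ is the free object on $X$ among bounded lattices belonging to $\mathcal{V}$ (with $0$, $1$ as constants and $\{0,1\}$-preserving lattice homomorphisms). Rings are associative and unital, not necessarily commutative. $V(R)$ is the commutative monoid of isomorphism classes $[A]$ of finitely generated projective right $R$-modules, with $[A]+[B]=[A\oplus B]$. For a lattice $L$, the dimension monoid $\operatorname{Dim}L$ is the commutative monoid defined by generators $\Delta(a,b)$ (for $a\leq b$ in $L$) and the relations: (D0) $\Delta(a,a)=0$; (D1) $\Delta(a,c)=\Delta(a,b)+\Delta(b,c)$ for $a\leq b\leq c$; (D2) $\Delta(a,a\vee b)=\Delta(a\wedge b,b)$ for all $a,b\in L$. Isomorphisms are monoid isomorphisms. *)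

theory Defs
  imports "HOL-Algebra.Lattice" "HOL-Algebra.Module" "HOL-Library.Multiset"
begin

unbundle cardinal_syntax

section \<open>Lattice varieties, and free bounded lattices\<close>

datatype 'v lattice_term =
    Var 'v
  | Join "'v lattice_term" "'v lattice_term"
  | Meet "'v lattice_term" "'v lattice_term"

primrec lattice_eval :: "'a gorder \<Rightarrow> ('v \<Rightarrow> 'a) \<Rightarrow> 'v lattice_term \<Rightarrow> 'a" where
  "lattice_eval L \<rho> (Var v) = \<rho> v"
| "lattice_eval L \<rho> (Join s t) = lattice_eval L \<rho> s \<squnion>\<^bsub>L\<^esub> lattice_eval L \<rho> t"
| "lattice_eval L \<rho> (Meet s t) = lattice_eval L \<rho> s \<sqinter>\<^bsub>L\<^esub> lattice_eval L \<rho> t"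

type_synonym lattice_identity = "nat lattice_term \<times> nat lattice_term"

text \<open>
  A lattice variety is an equational class of lattices, so it is represented by a set \<open>E\<close> of
  lattice identities (which may be arbitrary).  The definition is polymorphic in the type of
  the elements: \<open>lattice_variety E\<close> at type \<open>'a\<close> collects the members of the variety whose
  elements are taken from \<open>'a\<close>.
\<close>

definition lattice_variety :: "lattice_identity set \<Rightarrow> 'a gorder set" where
  "lattice_variety E =
     {L. lattice L \<and>
         (\<forall>(s, t)\<in>E. \<forall>\<rho>\<in>UNIV \<rightarrow> carrier L. lattice_eval L \<rho> s = lattice_eval L \<rho> t)}"

definition distributive_lattice :: "'a gorder \<Rightarrow> bool" where
  "distributive_lattice L \<longleftrightarrow> lattice L \<and>
     (\<forall>x\<in>carrier L. \<forall>y\<in>carrier L. \<forall>z\<in>carrier L.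
        x \<sqinter>\<^bsub>L\<^esub> (y \<squnion>\<^bsub>L\<^esub> z) = (x \<sqinter>\<^bsub>L\<^esub> y) \<squnion>\<^bsub>L\<^esub> (x \<sqinter>\<^bsub>L\<^esub> z))"

definition bounded_lattice_hom :: "'a gorder \<Rightarrow> 'b gorder \<Rightarrow> ('a \<Rightarrow> 'b) set" where
  "bounded_lattice_hom L M =
     {h \<in> carrier L \<rightarrow> carrier M.
        join_pres L M h \<and> meet_pres L M h \<and> h \<bottom>\<^bsub>L\<^esub> = \<bottom>\<^bsub>M\<^esub> \<and> h \<top>\<^bsub>L\<^esub> = \<top>\<^bsub>M\<^esub>}"

text \<open>
  \<open>F\<close>, together with \<open>\<iota> : X \<rightarrow> F\<close>, is free on \<open>X\<close> among the bounded lattices of the variety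
  given by \<open>E\<close>, tested against the bounded lattices with elements in \<open>'m\<close>.
  (Homomorphisms are made unique as HOL functions by the extensionality condition.)
\<close>

definition free_bounded_lattice_wrt ::
    "'m itself \<Rightarrow> lattice_identity set \<Rightarrow> 'x set \<Rightarrow> 'f gorder \<Rightarrow> ('x \<Rightarrow> 'f) \<Rightarrow> bool" where
  "free_bounded_lattice_wrt _ E X F \<iota> \<longleftrightarrow>
     bounded_lattice F \<and> F \<in> lattice_variety E \<and> \<iota> \<in> X \<rightarrow> carrier F \<and>
     (\<forall>M::'m gorder. bounded_lattice M \<and> M \<in> lattice_variety E \<longrightarrow>
        (\<forall>f\<in>X \<rightarrow> carrier M.
           \<exists>!h. h \<in> bounded_lattice_hom F M \<inter> extensional (carrier F) \<and>
                (\<forall>x\<in>X. h (\<iota> x) = f x)))"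

text \<open>
  HOL cannot quantify over all types, so the universal property is tested in two types: that of
  \<open>F\<close> itself, and one that is large enough to contain a free object, namely sets of lattice
  terms over \<open>X\<close> and two further symbols.  Nothing is lost: \<open>free_bounded_lattice_any\<close> below
  derives the universal property with respect to every type, and
  \<open>free_bounded_lattice_exists\<close> shows that free objects exist.
\<close>

definition free_bounded_lattice ::
    "lattice_identity set \<Rightarrow> 'x set \<Rightarrow> 'f gorder \<Rightarrow> ('x \<Rightarrow> 'f) \<Rightarrow> bool" where
  "free_bounded_lattice E X F \<iota> \<longleftrightarrow>
     free_bounded_lattice_wrt TYPE('f) E X F \<iota> \<and>
     free_bounded_lattice_wrt TYPE(('x + bool) lattice_term set) E X F \<iota>"


section \<open>The dimension monoid of a lattice\<close>

text \<open>
  Commutative monoids are monoid records of the algebra library, whose multiplication plays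
  the role of the addition.  Elements of the free commutative monoid on the symbols
  \<open>\<Delta>(a, b)\<close> with \<open>a \<le> b\<close> are multisets of such pairs \<open>(a, b)\<close>.
\<close>

definition dim_generators :: "'a gorder \<Rightarrow> ('a \<times> 'a) set" where
  "dim_generators L = {(a, b). a \<in> carrier L \<and> b \<in> carrier L \<and> a \<sqsubseteq>\<^bsub>L\<^esub> b}"

inductive dim_cong :: "'a gorder \<Rightarrow> ('a \<times> 'a) multiset \<Rightarrow> ('a \<times> 'a) multiset \<Rightarrow> bool"
  for L where
  dim_refl: "set_mset m \<subseteq> dim_generators L \<Longrightarrow> dim_cong L m m"
| dim_sym: "dim_cong L m n \<Longrightarrow> dim_cong L n m"
| dim_trans: "dim_cong L m n \<Longrightarrow> dim_cong L n p \<Longrightarrow> dim_cong L m p"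
| dim_add: "dim_cong L m n \<Longrightarrow> dim_cong L p q \<Longrightarrow> dim_cong L (m + p) (n + q)"
| D0: "a \<in> carrier L \<Longrightarrow> dim_cong L {#(a, a)#} {#}"
| D1: "a \<in> carrier L \<Longrightarrow> b \<in> carrier L \<Longrightarrow> c \<in> carrier L \<Longrightarrow> a \<sqsubseteq>\<^bsub>L\<^esub> b \<Longrightarrow> b \<sqsubseteq>\<^bsub>L\<^esub> c \<Longrightarrow>
       dim_cong L {#(a, c)#} ({#(a, b)#} + {#(b, c)#})"
| D2: "a \<in> carrier L \<Longrightarrow> b \<in> carrier L \<Longrightarrow>
       dim_cong L {#(a, a \<squnion>\<^bsub>L\<^esub> b)#} {#(a \<sqinter>\<^bsub>L\<^esub> b, b)#}"

definition dim_class :: "'a gorder \<Rightarrow> ('a \<times> 'a) multiset \<Rightarrow> ('a \<times> 'a) multiset set" where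
  "dim_class L m = {n. dim_cong L m n}"

definition dimension_monoid :: "'a gorder \<Rightarrow> ('a \<times> 'a) multiset set monoid" where
  "dimension_monoid L =
     \<lparr>carrier = {dim_class L m |m. set_mset m \<subseteq> dim_generators L},
      monoid.mult = (\<lambda>\<alpha> \<beta>. \<Union>m\<in>\<alpha>. \<Union>n\<in>\<beta>. dim_class L (m + n)),
      one = dim_class L {#}\<rparr>"


section \<open>Regular rings and the monoid \<open>V(R)\<close>\<close>

definition regular_ring :: "'r ring \<Rightarrow> bool" where
  "regular_ring R \<longleftrightarrow> ring R \<and>
     (\<forall>x\<in>carrier R. \<exists>y\<in>carrier R. x \<otimes>\<^bsub>R\<^esub> y \<otimes>\<^bsub>R\<^esub> x = x)"

text \<open>
  The library's modules are modules over commutative rings.  Right modules reuse its module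
  record (the ring multiplication and unit of the record are irrelevant); \<open>a \<odot> x\<close> stands for
  the right action \<open>x \<cdot> a\<close>, hence the order of the factors in \<open>smult_assoc\<close>.
\<close>

locale right_module = R?: ring R + M?: abelian_group M for R (structure) and M (structure) +
  assumes smult_closed [simp, intro]:
      "\<lbrakk>a \<in> carrier R; x \<in> carrier M\<rbrakk> \<Longrightarrow> a \<odot>\<^bsub>M\<^esub> x \<in> carrier M"
    and smult_add_scalar:
      "\<lbrakk>a \<in> carrier R; b \<in> carrier R; x \<in> carrier M\<rbrakk> \<Longrightarrow>
       (a \<oplus>\<^bsub>R\<^esub> b) \<odot>\<^bsub>M\<^esub> x = a \<odot>\<^bsub>M\<^esub> x \<oplus>\<^bsub>M\<^esub> b \<odot>\<^bsub>M\<^esub> x"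
    and smult_add:
      "\<lbrakk>a \<in> carrier R; x \<in> carrier M; y \<in> carrier M\<rbrakk> \<Longrightarrow>
       a \<odot>\<^bsub>M\<^esub> (x \<oplus>\<^bsub>M\<^esub> y) = a \<odot>\<^bsub>M\<^esub> x \<oplus>\<^bsub>M\<^esub> a \<odot>\<^bsub>M\<^esub> y"
    and smult_assoc:
      "\<lbrakk>a \<in> carrier R; b \<in> carrier R; x \<in> carrier M\<rbrakk> \<Longrightarrow>
       (a \<otimes>\<^bsub>R\<^esub> b) \<odot>\<^bsub>M\<^esub> x = b \<odot>\<^bsub>M\<^esub> (a \<odot>\<^bsub>M\<^esub> x)"
    and smult_unit [simp]: "x \<in> carrier M \<Longrightarrow> \<one>\<^bsub>R\<^esub> \<odot>\<^bsub>M\<^esub> x = x"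

definition right_module_hom ::
    "'r ring \<Rightarrow> ('r, 'm) module \<Rightarrow> ('r, 'n) module \<Rightarrow> ('m \<Rightarrow> 'n) set" where
  "right_module_hom R M N =
     {h \<in> carrier M \<rightarrow> carrier N.
        (\<forall>x\<in>carrier M. \<forall>y\<in>carrier M. h (x \<oplus>\<^bsub>M\<^esub> y) = h x \<oplus>\<^bsub>N\<^esub> h y) \<and>
        (\<forall>a\<in>carrier R. \<forall>x\<in>carrier M. h (a \<odot>\<^bsub>M\<^esub> x) = a \<odot>\<^bsub>N\<^esub> h x)}"

definition right_module_iso :: "'r ring \<Rightarrow> ('r, 'm) module \<Rightarrow> ('r, 'n) module \<Rightarrow> bool" where
  "right_module_iso R M N \<longleftrightarrow>
     (\<exists>h\<in>right_module_hom R M N. bij_betw h (carrier M) (carrier N))"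

definition direct_sum :: "('r, 'm) module \<Rightarrow> ('r, 'n) module \<Rightarrow> ('r, 'm \<times> 'n) module" where
  "direct_sum M N =
     \<lparr>carrier = carrier M \<times> carrier N,
      monoid.mult = undefined,
      one = undefined,
      zero = (\<zero>\<^bsub>M\<^esub>, \<zero>\<^bsub>N\<^esub>),
      add = (\<lambda>(x, y) (x', y'). (x \<oplus>\<^bsub>M\<^esub> x', y \<oplus>\<^bsub>N\<^esub> y')),
      smult = (\<lambda>a (x, y). (a \<odot>\<^bsub>M\<^esub> x, a \<odot>\<^bsub>N\<^esub> y))\<rparr>"

definition finitely_generated :: "'r ring \<Rightarrow> ('r, 'm) module \<Rightarrow> bool" where
  "finitely_generated R M \<longleftrightarrow>
     (\<exists>S. finite S \<and> S \<subseteq> carrier M \<and> (\<forall>H. submodule H R M \<and> S \<subseteq> H \<longrightarrow> H = carrier M))"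

definition projective_wrt :: "'u itself \<Rightarrow> 'r ring \<Rightarrow> ('r, 'p) module \<Rightarrow> bool" where
  "projective_wrt _ R P \<longleftrightarrow>
     (\<forall>(M::('r, 'u) module) (N::('r, 'u) module) g f.
        right_module R M \<and> right_module R N \<and>
        g \<in> right_module_hom R M N \<and> g ` carrier M = carrier N \<and> f \<in> right_module_hom R P N \<longrightarrow>
        (\<exists>h\<in>right_module_hom R P M. \<forall>x\<in>carrier P. g (h x) = f x))"

text \<open>
  The modules with elements in \<open>nat \<Rightarrow> 'r\<close> include copies of all finitely generated right
  modules over a ring with elements in \<open>'r\<close>.  They are therefore used both for testing
  projectivity (\<open>fg_projective_any\<close> below: the lifting property then holds with respect to
  every type) and for forming isomorphism classes (\<open>proj_class_in_carrier\<close> below: every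
  finitely generated projective right module, of whatever type, has its isomorphism class in
  \<open>V(R)\<close>).
\<close>

definition fg_projective :: "'r ring \<Rightarrow> ('r, 'p) module \<Rightarrow> bool" where
  "fg_projective R P \<longleftrightarrow>
     right_module R P \<and> finitely_generated R P \<and> projective_wrt TYPE(nat \<Rightarrow> 'r) R P"

definition proj_class :: "'r ring \<Rightarrow> ('r, 'p) module \<Rightarrow> ('r, nat \<Rightarrow> 'r) module set" where
  "proj_class R A = {B. fg_projective R B \<and> right_module_iso R A B}"

definition V_monoid :: "'r ring \<Rightarrow> ('r, nat \<Rightarrow> 'r) module set monoid" where
  "V_monoid R =
     \<lparr>carrier = {proj_class R A |A::('r, nat \<Rightarrow> 'r) module. fg_projective R A},
      monoid.mult = (\<lambda>\<alpha> \<beta>. \<Union>A\<in>\<alpha>. \<Union>B\<in>\<beta>. proj_class R (direct_sum A B)),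
      one = {Z. fg_projective R Z \<and> carrier Z = {\<zero>\<^bsub>Z\<^esub>}}\<rparr>"

section \<open>Consistency of the definitions: dimension monoids\<close>

lemma dim_cong_generators:
  assumes "lattice L" "dim_cong L m n"
  shows "set_mset m \<subseteq> dim_generators L \<and> set_mset n \<subseteq> dim_generators L"
  using assms(2)
proof induction
  case (D1 a b c)
  interpret lattice L by fact
  show ?case using D1 by (auto simp: dim_generators_def intro: le_trans)
next
  case (D2 a b)
  interpret lattice L by fact
  show ?case using D2 by (auto simp: dim_generators_def join_left meet_right)
next
  case (D0 a)
  interpret lattice L by fact
  show ?case using D0 by (auto simp: dim_generators_def)
qed auto

lemma dim_class_eq_iff:
  assumes "set_mset m \<subseteq> dim_generators L"
  shows "dim_class L m = dim_class L n \<longleftrightarrow> dim_cong L m n"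
proof
  assume "dim_class L m = dim_class L n"
  then have "m \<in> dim_class L n"
    using dim_refl[OF assms] by (auto simp: dim_class_def)
  then show "dim_cong L m n"
    by (auto simp: dim_class_def intro: dim_sym)
next
  assume "dim_cong L m n"
  then show "dim_class L m = dim_class L n"
    by (auto simp: dim_class_def intro: dim_sym dim_trans)
qed

lemma dim_class_mult:
  assumes "set_mset m \<subseteq> dim_generators L" "set_mset n \<subseteq> dim_generators L"
  shows "dim_class L m \<otimes>\<^bsub>dimension_monoid L\<^esub> dim_class L n = dim_class L (m + n)"
proof
  show "dim_class L m \<otimes>\<^bsub>dimension_monoid L\<^esub> dim_class L n \<subseteq> dim_class L (m + n)"
    by (auto simp: dimension_monoid_def dim_class_def intro: dim_trans dim_add)
  show "dim_class L (m + n) \<subseteq> dim_class L m \<otimes>\<^bsub>dimension_monoid L\<^esub> dim_class L n"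
    using dim_refl[OF assms(1)] dim_refl[OF assms(2)]
    by (auto simp: dimension_monoid_def dim_class_def)
qed

theorem dimension_monoid_comm_monoid: "comm_monoid (dimension_monoid L)"
proof (rule comm_monoidI)
  let ?D = "dimension_monoid L"
  have car: "\<alpha> \<in> carrier ?D \<longleftrightarrow> (\<exists>m. \<alpha> = dim_class L m \<and> set_mset m \<subseteq> dim_generators L)" for \<alpha>
    by (auto simp: dimension_monoid_def)
  have one: "\<one>\<^bsub>?D\<^esub> = dim_class L {#}"
    by (simp add: dimension_monoid_def)
  show "\<one>\<^bsub>?D\<^esub> \<in> carrier ?D"
    unfolding car one by (intro exI[of _ "{#}"]) simp
  fix \<alpha> \<beta> \<gamma> assume "\<alpha> \<in> carrier ?D" "\<beta> \<in> carrier ?D" "\<gamma> \<in> carrier ?D"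
  then obtain k m n where "\<alpha> = dim_class L k" "\<beta> = dim_class L m" "\<gamma> = dim_class L n"
    and *: "set_mset k \<subseteq> dim_generators L" "set_mset m \<subseteq> dim_generators L"
      "set_mset n \<subseteq> dim_generators L"
    unfolding car by blast
  moreover from * have **:
    "set_mset (k + m) \<subseteq> dim_generators L" "set_mset (m + n) \<subseteq> dim_generators L"
    by auto
  ultimately show "\<alpha> \<otimes>\<^bsub>?D\<^esub> \<beta> \<in> carrier ?D" "\<alpha> \<otimes>\<^bsub>?D\<^esub> \<beta> \<otimes>\<^bsub>?D\<^esub> \<gamma> = \<alpha> \<otimes>\<^bsub>?D\<^esub> (\<beta> \<otimes>\<^bsub>?D\<^esub> \<gamma>)"
    "\<alpha> \<otimes>\<^bsub>?D\<^esub> \<beta> = \<beta> \<otimes>\<^bsub>?D\<^esub> \<alpha>"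
    unfolding car using *
    by (simp_all add: dim_class_mult del: set_mset_union) (blast, simp_all add: ac_simps)
next
  let ?D = "dimension_monoid L"
  fix \<alpha> assume "\<alpha> \<in> carrier ?D"
  then obtain m where "\<alpha> = dim_class L m" "set_mset m \<subseteq> dim_generators L"
    by (auto simp: dimension_monoid_def)
  moreover have "\<one>\<^bsub>?D\<^esub> = dim_class L {#}"
    by (simp add: dimension_monoid_def)
  ultimately show "\<one>\<^bsub>?D\<^esub> \<otimes>\<^bsub>?D\<^esub> \<alpha> = \<alpha>"
    using dim_class_mult[of "{#}" L m] by simp
qed

section \<open>Consistency of the definitions: projective modules\<close>

context right_module
begin

lemma smult_zero [simp]:
  assumes "a \<in> carrier R"
  shows "a \<odot>\<^bsub>M\<^esub> \<zero>\<^bsub>M\<^esub> = \<zero>\<^bsub>M\<^esub>"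
proof -
  have "a \<odot>\<^bsub>M\<^esub> \<zero>\<^bsub>M\<^esub> \<oplus>\<^bsub>M\<^esub> a \<odot>\<^bsub>M\<^esub> \<zero>\<^bsub>M\<^esub> = a \<odot>\<^bsub>M\<^esub> (\<zero>\<^bsub>M\<^esub> \<oplus>\<^bsub>M\<^esub> \<zero>\<^bsub>M\<^esub>)"
    using assms by (intro smult_add[symmetric]) auto
  then show ?thesis
    using assms by simp
qed

lemma zero_smult [simp]:
  assumes "x \<in> carrier M"
  shows "\<zero>\<^bsub>R\<^esub> \<odot>\<^bsub>M\<^esub> x = \<zero>\<^bsub>M\<^esub>"
proof -
  have "\<zero>\<^bsub>R\<^esub> \<odot>\<^bsub>M\<^esub> x \<oplus>\<^bsub>M\<^esub> \<zero>\<^bsub>R\<^esub> \<odot>\<^bsub>M\<^esub> x = (\<zero>\<^bsub>R\<^esub> \<oplus>\<^bsub>R\<^esub> \<zero>\<^bsub>R\<^esub>) \<odot>\<^bsub>M\<^esub> x"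
    using assms by (intro smult_add_scalar[symmetric]) auto
  then show ?thesis
    using assms by simp
qed

lemma uminus_smult:
  assumes "x \<in> carrier M"
  shows "(\<ominus>\<^bsub>R\<^esub> \<one>\<^bsub>R\<^esub>) \<odot>\<^bsub>M\<^esub> x = \<ominus>\<^bsub>M\<^esub> x"
proof -
  have "(\<ominus>\<^bsub>R\<^esub> \<one>\<^bsub>R\<^esub>) \<odot>\<^bsub>M\<^esub> x \<oplus>\<^bsub>M\<^esub> \<one>\<^bsub>R\<^esub> \<odot>\<^bsub>M\<^esub> x = (\<ominus>\<^bsub>R\<^esub> \<one>\<^bsub>R\<^esub> \<oplus>\<^bsub>R\<^esub> \<one>\<^bsub>R\<^esub>) \<odot>\<^bsub>M\<^esub> x"
    using assms by (intro smult_add_scalar[symmetric]) auto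
  then have "(\<ominus>\<^bsub>R\<^esub> \<one>\<^bsub>R\<^esub>) \<odot>\<^bsub>M\<^esub> x \<oplus>\<^bsub>M\<^esub> x = \<zero>\<^bsub>M\<^esub>"
    using assms by (simp add: R.l_neg)
  then show ?thesis
    using assms by (metis M.minus_equality R.a_inv_closed R.one_closed smult_closed)
qed

lemma smult_finsum:
  assumes "a \<in> carrier R" "f \<in> A \<rightarrow> carrier M" "finite A"
  shows "a \<odot>\<^bsub>M\<^esub> (\<Oplus>\<^bsub>M\<^esub>i\<in>A. f i) = (\<Oplus>\<^bsub>M\<^esub>i\<in>A. a \<odot>\<^bsub>M\<^esub> f i)"
  using assms(3,2)
  by (induction A rule: finite_induct) (use assms(1) in \<open>simp_all add: smult_add Pi_def\<close>)

lemma right_submoduleI: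
  assumes "H \<subseteq> carrier M" "\<zero>\<^bsub>M\<^esub> \<in> H" "\<And>x y. \<lbrakk>x \<in> H; y \<in> H\<rbrakk> \<Longrightarrow> x \<oplus>\<^bsub>M\<^esub> y \<in> H"
    "\<And>a x. \<lbrakk>a \<in> carrier R; x \<in> H\<rbrakk> \<Longrightarrow> a \<odot>\<^bsub>M\<^esub> x \<in> H"
  shows "submodule H R M"
proof (intro submodule.intro subgroup.intro submodule_axioms.intro)
  fix x assume x: "x \<in> H"
  then have "(\<ominus>\<^bsub>R\<^esub> \<one>\<^bsub>R\<^esub>) \<odot>\<^bsub>M\<^esub> x \<in> H"
    by (intro assms(4)) auto
  then show "inv\<^bsub>add_monoid M\<^esub> x \<in> H"
    using x assms(1) uminus_smult by (auto simp: a_inv_def)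
qed (use assms in auto)

end

lemma right_submodule_simps:
  assumes "submodule H R M"
  shows "H \<subseteq> carrier M" "\<zero>\<^bsub>M\<^esub> \<in> H" "\<And>x y. \<lbrakk>x \<in> H; y \<in> H\<rbrakk> \<Longrightarrow> x \<oplus>\<^bsub>M\<^esub> y \<in> H"
    "\<And>a x. \<lbrakk>a \<in> carrier R; x \<in> H\<rbrakk> \<Longrightarrow> a \<odot>\<^bsub>M\<^esub> x \<in> H"
proof -
  interpret submodule H R M by fact
  show "H \<subseteq> carrier M" "\<zero>\<^bsub>M\<^esub> \<in> H" "\<And>x y. \<lbrakk>x \<in> H; y \<in> H\<rbrakk> \<Longrightarrow> x \<oplus>\<^bsub>M\<^esub> y \<in> H"
    "\<And>a x. \<lbrakk>a \<in> carrier R; x \<in> H\<rbrakk> \<Longrightarrow> a \<odot>\<^bsub>M\<^esub> x \<in> H"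
    using subset one_closed m_closed by auto
qed

lemma right_module_homD:
  assumes "h \<in> right_module_hom R M N"
  shows "x \<in> carrier M \<Longrightarrow> h x \<in> carrier N"
    "\<lbrakk>x \<in> carrier M; y \<in> carrier M\<rbrakk> \<Longrightarrow> h (x \<oplus>\<^bsub>M\<^esub> y) = h x \<oplus>\<^bsub>N\<^esub> h y"
    "\<lbrakk>a \<in> carrier R; x \<in> carrier M\<rbrakk> \<Longrightarrow> h (a \<odot>\<^bsub>M\<^esub> x) = a \<odot>\<^bsub>N\<^esub> h x"
  using assms by (auto simp: right_module_hom_def)

lemma right_module_homI:
  assumes "\<And>x. x \<in> carrier M \<Longrightarrow> h x \<in> carrier N"
    "\<And>x y. \<lbrakk>x \<in> carrier M; y \<in> carrier M\<rbrakk> \<Longrightarrow> h (x \<oplus>\<^bsub>M\<^esub> y) = h x \<oplus>\<^bsub>N\<^esub> h y"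
    "\<And>a x. \<lbrakk>a \<in> carrier R; x \<in> carrier M\<rbrakk> \<Longrightarrow> h (a \<odot>\<^bsub>M\<^esub> x) = a \<odot>\<^bsub>N\<^esub> h x"
  shows "h \<in> right_module_hom R M N"
  using assms by (auto simp: right_module_hom_def)

lemma right_module_hom_comp:
  assumes "g \<in> right_module_hom R M N" "h \<in> right_module_hom R N K"
  shows "(\<lambda>x. h (g x)) \<in> right_module_hom R M K"
  using assms by (auto simp: right_module_hom_def Pi_iff)

lemma right_module_hom_zero:
  assumes "right_module R M" "right_module R N" "h \<in> right_module_hom R M N"
  shows "h \<zero>\<^bsub>M\<^esub> = \<zero>\<^bsub>N\<^esub>"
proof -
  interpret M: right_module R M by fact
  interpret N: right_module R N by fact
  have "h (\<zero>\<^bsub>R\<^esub> \<odot>\<^bsub>M\<^esub> \<zero>\<^bsub>M\<^esub>) = \<zero>\<^bsub>R\<^esub> \<odot>\<^bsub>N\<^esub> h \<zero>\<^bsub>M\<^esub>"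
    by (intro right_module_homD[OF assms(3)]) auto
  then show ?thesis
    using right_module_homD(1)[OF assms(3), of "\<zero>\<^bsub>M\<^esub>"] by simp
qed

lemma right_module_hom_finsum:
  assumes "right_module R M" "right_module R N" "h \<in> right_module_hom R M N"
    and "finite A" "f \<in> A \<rightarrow> carrier M"
  shows "h (\<Oplus>\<^bsub>M\<^esub>i\<in>A. f i) = (\<Oplus>\<^bsub>N\<^esub>i\<in>A. h (f i))"
proof -
  interpret M: right_module R M by fact
  interpret N: right_module R N by fact
  show ?thesis
    using assms(4,5)
    by (induction A rule: finite_induct)
      (simp_all add: right_module_hom_zero[OF assms(1-3)] right_module_homD[OF assms(3)] Pi_def)
qed

lemma right_module_hom_image_submodule:
  assumes "right_module R M" "right_module R N" "h \<in> right_module_hom R M N"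
  shows "submodule (h ` carrier M) R N"
proof -
  interpret M: right_module R M by fact
  interpret N: right_module R N by fact
  note hD = right_module_homD[OF assms(3)]
  show ?thesis
  proof (rule N.right_submoduleI)
    show "\<zero>\<^bsub>N\<^esub> \<in> h ` carrier M"
      using imageI[OF M.zero_closed, of h] by (simp only: right_module_hom_zero[OF assms])
    show "h ` carrier M \<subseteq> carrier N"
      using hD(1) by blast
  next
    fix x y assume "x \<in> h ` carrier M" "y \<in> h ` carrier M"
    then obtain x' y' where "x = h x'" "y = h y'" and *: "x' \<in> carrier M" "y' \<in> carrier M"
      by blast
    then have "x \<oplus>\<^bsub>N\<^esub> y = h (x' \<oplus>\<^bsub>M\<^esub> y')"
      by (simp only: hD(2))
    then show "x \<oplus>\<^bsub>N\<^esub> y \<in> h ` carrier M"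
      using * by blast
  next
    fix x a assume "x \<in> h ` carrier M" and a: "a \<in> carrier R"
    then obtain x' where "x = h x'" and *: "x' \<in> carrier M"
      by blast
    then have "a \<odot>\<^bsub>N\<^esub> x = h (a \<odot>\<^bsub>M\<^esub> x')"
      using a by (simp only: hD(3))
    then show "a \<odot>\<^bsub>N\<^esub> x \<in> h ` carrier M"
      using * a by blast
  qed
qed

lemma right_module_hom_vimage_submodule:
  assumes "right_module R M" "right_module R N" "h \<in> right_module_hom R M N" "submodule H R N"
  shows "submodule {x \<in> carrier M. h x \<in> H} R M"
proof -
  interpret M: right_module R M by fact
  interpret N: right_module R N by fact
  note hD = right_module_homD[OF assms(3)] and H = right_submodule_simps[OF assms(4)]
  show ?thesis
    by (rule M.right_submoduleI) (simp_all add: hD H subset_iff right_module_hom_zero[OF assms(1-3)])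
qed

lemma finitely_generatedE:
  assumes "finitely_generated R M"
  obtains S where "finite S" "S \<subseteq> carrier M"
    "\<forall>H. submodule H R M \<longrightarrow> S \<subseteq> H \<longrightarrow> H = carrier M"
  using assms that unfolding finitely_generated_def by metis

lemma finitely_generatedI:
  assumes "finite S" "S \<subseteq> carrier M"
    "\<And>H. submodule H R M \<Longrightarrow> S \<subseteq> H \<Longrightarrow> H = carrier M"
  shows "finitely_generated R M"
  using assms unfolding finitely_generated_def by metis

lemma finitely_generated_image:
  assumes "right_module R M" "right_module R N" "h \<in> right_module_hom R M N"
    and "h ` carrier M = carrier N" "finitely_generated R M"
  shows "finitely_generated R N"
proof -
  obtain S where S: "finite S" "S \<subseteq> carrier M"
    "\<forall>H. submodule H R M \<longrightarrow> S \<subseteq> H \<longrightarrow> H = carrier M"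
    using assms(5) by (rule finitely_generatedE)
  show ?thesis
  proof (rule finitely_generatedI)
    show "finite (h ` S)" "h ` S \<subseteq> carrier N"
      using S(1,2) assms(4) by auto
    fix H assume H: "submodule H R N" "h ` S \<subseteq> H"
    have "{x \<in> carrier M. h x \<in> H} = carrier M"
      using right_module_hom_vimage_submodule[OF assms(1-3) H(1)] S(2) H(2)
      by (intro S(3)[rule_format]) auto
    then have "carrier N \<subseteq> H"
      unfolding assms(4)[symmetric] by blast
    then show "H = carrier N"
      using right_submodule_simps(1)[OF H(1)] by blast
  qed
qed

subsection \<open>Free modules and linear combinations\<close>

definition free_module :: "'r ring \<Rightarrow> nat \<Rightarrow> ('r, nat \<Rightarrow> 'r) module" where
  "free_module R n =
     \<lparr>carrier = {..<n} \<rightarrow>\<^sub>E carrier R,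
      monoid.mult = undefined,
      one = undefined,
      zero = (\<lambda>i\<in>{..<n}. \<zero>\<^bsub>R\<^esub>),
      add = (\<lambda>x y. \<lambda>i\<in>{..<n}. x i \<oplus>\<^bsub>R\<^esub> y i),
      smult = (\<lambda>a x. \<lambda>i\<in>{..<n}. x i \<otimes>\<^bsub>R\<^esub> a)\<rparr>"

definition linear_combination :: "('r, 'm) module \<Rightarrow> nat \<Rightarrow> (nat \<Rightarrow> 'm) \<Rightarrow> (nat \<Rightarrow> 'r) \<Rightarrow> 'm" where
  "linear_combination M n m c = (\<Oplus>\<^bsub>M\<^esub>i\<in>{..<n}. c i \<odot>\<^bsub>M\<^esub> m i)"

lemma right_module_free_module:
  assumes "ring R"
  shows "right_module R (free_module R n)"
proof -
  interpret R: ring R by fact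
  have "abelian_group (free_module R n)"
  proof (rule abelian_groupI)
    fix x assume x: "x \<in> carrier (free_module R n)"
    show "\<exists>y\<in>carrier (free_module R n). y \<oplus>\<^bsub>free_module R n\<^esub> x = \<zero>\<^bsub>free_module R n\<^esub>"
      using x
      by (intro bexI[of _ "\<lambda>i\<in>{..<n}. \<ominus>\<^bsub>R\<^esub> x i"])
        (auto simp: free_module_def PiE_iff R.l_neg intro!: restrict_ext)
  qed (auto simp: free_module_def PiE_iff R.a_ac fun_eq_iff restrict_def extensional_def)
  then show ?thesis
    by (intro right_module.intro assms right_module_axioms.intro)
      (auto simp: free_module_def PiE_iff R.r_distr R.l_distr R.m_assoc fun_eq_iff restrict_def
        extensional_def)
qed

lemma linear_combination_hom:
  assumes "right_module R M" "m \<in> {..<n} \<rightarrow> carrier M"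
  shows "linear_combination M n m \<in> right_module_hom R (free_module R n) M"
proof -
  interpret M: right_module R M by fact
  have [simp]: "(\<lambda>i. c i \<odot>\<^bsub>M\<^esub> m i) \<in> {..<n} \<rightarrow> carrier M" if "c \<in> {..<n} \<rightarrow>\<^sub>E carrier R" for c
    using that assms(2) by auto
  show ?thesis
  proof (rule right_module_homI; unfold linear_combination_def)
    fix x assume x: "x \<in> carrier (free_module R n)"
    then show "(\<Oplus>\<^bsub>M\<^esub>i\<in>{..<n}. x i \<odot>\<^bsub>M\<^esub> m i) \<in> carrier M"
      by (intro M.finsum_closed) (simp add: free_module_def)
    {
      fix y assume y: "y \<in> carrier (free_module R n)"
      have "(\<Oplus>\<^bsub>M\<^esub>i\<in>{..<n}. (x \<oplus>\<^bsub>free_module R n\<^esub> y) i \<odot>\<^bsub>M\<^esub> m i) =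
            (\<Oplus>\<^bsub>M\<^esub>i\<in>{..<n}. x i \<odot>\<^bsub>M\<^esub> m i \<oplus>\<^bsub>M\<^esub> y i \<odot>\<^bsub>M\<^esub> m i)"
        using x y assms(2)
        by (intro M.finsum_cong') (auto simp: free_module_def PiE_iff Pi_iff M.smult_add_scalar)
      then show "(\<Oplus>\<^bsub>M\<^esub>i\<in>{..<n}. (x \<oplus>\<^bsub>free_module R n\<^esub> y) i \<odot>\<^bsub>M\<^esub> m i) =
            (\<Oplus>\<^bsub>M\<^esub>i\<in>{..<n}. x i \<odot>\<^bsub>M\<^esub> m i) \<oplus>\<^bsub>M\<^esub> (\<Oplus>\<^bsub>M\<^esub>i\<in>{..<n}. y i \<odot>\<^bsub>M\<^esub> m i)"
        using x y by (simp add: free_module_def)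
    }
    {
      fix a assume a: "a \<in> carrier R"
      have "(\<Oplus>\<^bsub>M\<^esub>i\<in>{..<n}. (a \<odot>\<^bsub>free_module R n\<^esub> x) i \<odot>\<^bsub>M\<^esub> m i) =
            (\<Oplus>\<^bsub>M\<^esub>i\<in>{..<n}. a \<odot>\<^bsub>M\<^esub> (x i \<odot>\<^bsub>M\<^esub> m i))"
        using x a assms(2)
        by (intro M.finsum_cong') (auto simp: free_module_def PiE_iff Pi_iff M.smult_assoc)
      then show "(\<Oplus>\<^bsub>M\<^esub>i\<in>{..<n}. (a \<odot>\<^bsub>free_module R n\<^esub> x) i \<odot>\<^bsub>M\<^esub> m i) =
            a \<odot>\<^bsub>M\<^esub> (\<Oplus>\<^bsub>M\<^esub>i\<in>{..<n}. x i \<odot>\<^bsub>M\<^esub> m i)"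
        using x a by (simp add: free_module_def M.smult_finsum)
    }
  qed
qed

definition unit_vector :: "'r ring \<Rightarrow> nat \<Rightarrow> nat \<Rightarrow> nat \<Rightarrow> 'r" where
  "unit_vector R n i = (\<lambda>j\<in>{..<n}. if i = j then \<one>\<^bsub>R\<^esub> else \<zero>\<^bsub>R\<^esub>)"

lemma unit_vector_closed:
  assumes "ring R"
  shows "unit_vector R n i \<in> carrier (free_module R n)"
proof -
  interpret ring R by fact
  show ?thesis by (auto simp: unit_vector_def free_module_def)
qed

lemma linear_combination_unit_vector:
  assumes "right_module R M" "m \<in> {..<n} \<rightarrow> carrier M" "i < n"
  shows "linear_combination M n m (unit_vector R n i) = m i"
proof -
  interpret M: right_module R M by fact
  have "linear_combination M n m (unit_vector R n i) =
        (\<Oplus>\<^bsub>M\<^esub>j\<in>{..<n}. if i = j then m j else \<zero>\<^bsub>M\<^esub>)"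
    unfolding linear_combination_def using assms(2)
    by (intro M.finsum_cong') (auto simp: unit_vector_def Pi_iff)
  also have "\<dots> = m i"
    using assms by (intro M.add.finprod_singleton) auto
  finally show ?thesis .
qed

lemma free_module_expansion:
  assumes "ring R" "c \<in> carrier (free_module R n)"
  shows "linear_combination (free_module R n) n (unit_vector R n) c = c"
proof -
  interpret R: ring R by fact
  interpret F: right_module R "free_module R n" by (rule right_module_free_module) fact
  have "(\<Oplus>\<^bsub>free_module R n\<^esub>i\<in>{..<k}. c i \<odot>\<^bsub>free_module R n\<^esub> unit_vector R n i) =
        (\<lambda>j\<in>{..<n}. if j < k then c j else \<zero>\<^bsub>R\<^esub>)" if "k \<le> n" for k
    using that
  proof (induction k)
    case 0
    have "(\<lambda>j\<in>{..<n}. if j < 0 then c j else \<zero>\<^bsub>R\<^esub>) = \<zero>\<^bsub>free_module R n\<^esub>"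
      by (simp add: free_module_def)
    then show ?case by simp
  next
    case (Suc k)
    have "(\<Oplus>\<^bsub>free_module R n\<^esub>i\<in>{..<Suc k}. c i \<odot>\<^bsub>free_module R n\<^esub> unit_vector R n i) =
          c k \<odot>\<^bsub>free_module R n\<^esub> unit_vector R n k \<oplus>\<^bsub>free_module R n\<^esub>
          (\<Oplus>\<^bsub>free_module R n\<^esub>i\<in>{..<k}. c i \<odot>\<^bsub>free_module R n\<^esub> unit_vector R n i)"
      using Suc.prems assms(2) unit_vector_closed[OF assms(1), of n]
      by (subst lessThan_Suc, subst F.finsum_insert)
        (auto intro!: F.smult_closed simp: free_module_def PiE_iff)
    also have "\<dots> = c k \<odot>\<^bsub>free_module R n\<^esub> unit_vector R n k \<oplus>\<^bsub>free_module R n\<^esub>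
          (\<lambda>j\<in>{..<n}. if j < k then c j else \<zero>\<^bsub>R\<^esub>)"
      using Suc.IH[OF Suc_leD[OF Suc.prems]] by (simp only:)
    also have "\<dots> = (\<lambda>j\<in>{..<n}. if j < Suc k then c j else \<zero>\<^bsub>R\<^esub>)"
      using assms(2) Suc.prems
      by (auto simp: free_module_def PiE_iff unit_vector_def fun_eq_iff less_Suc_eq restrict_def)
    finally show ?case .
  qed
  from this[of n] assms(2) show ?thesis
    by (auto simp: linear_combination_def free_module_def PiE_iff fun_eq_iff restrict_def
        extensional_def)
qed

lemma right_module_hom_linear_combination:
  assumes "right_module R M" "right_module R N" "h \<in> right_module_hom R M N"
    and "m \<in> {..<n} \<rightarrow> carrier M" "c \<in> carrier (free_module R n)"
  shows "h (linear_combination M n m c) = linear_combination N n (\<lambda>i. h (m i)) c"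
proof -
  interpret M: right_module R M by fact
  interpret N: right_module R N by fact
  have "(\<lambda>i. c i \<odot>\<^bsub>M\<^esub> m i) \<in> {..<n} \<rightarrow> carrier M"
    using assms(4,5) by (auto simp: free_module_def)
  then have "h (linear_combination M n m c) = (\<Oplus>\<^bsub>N\<^esub>i\<in>{..<n}. h (c i \<odot>\<^bsub>M\<^esub> m i))"
    unfolding linear_combination_def
    by (intro right_module_hom_finsum[OF assms(1-3)]) auto
  also have "\<dots> = linear_combination N n (\<lambda>i. h (m i)) c"
    unfolding linear_combination_def using assms(4,5)
    by (intro N.finsum_cong') (auto simp: free_module_def right_module_homD[OF assms(3)] Pi_iff PiE_iff)
  finally show ?thesis .
qed

lemma finitely_generated_imp_linear_combinations:
  assumes "right_module R M" "finitely_generated R M"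
  obtains n m where "m \<in> {..<n} \<rightarrow> carrier M"
    "linear_combination M n m ` carrier (free_module R n) = carrier M"
proof -
  interpret M: right_module R M by fact
  obtain S where S: "finite S" "S \<subseteq> carrier M"
    "\<forall>H. submodule H R M \<longrightarrow> S \<subseteq> H \<longrightarrow> H = carrier M"
    using assms(2) by (rule finitely_generatedE)
  obtain n and m :: "nat \<Rightarrow> _" where nm: "S = m ` {..<n}"
    using S(1) finite_imp_nat_seg_image_inj_on[of S] by (auto simp: lessThan_def)
  let ?l = "linear_combination M n m"
  have m: "m \<in> {..<n} \<rightarrow> carrier M"
    using S(2) nm by auto
  have "?l ` carrier (free_module R n) = carrier M"
  proof (rule S(3)[rule_format])
    show "submodule (?l ` carrier (free_module R n)) R M"
      by (intro right_module_hom_image_submodule linear_combination_hom assms m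
          right_module_free_module M.R.ring_axioms)
    have "m i \<in> ?l ` carrier (free_module R n)" if "i < n" for i
      using linear_combination_unit_vector[OF assms(1) m that]
        unit_vector_closed[OF M.R.ring_axioms] by (metis imageI)
    then show "S \<subseteq> ?l ` carrier (free_module R n)"
      unfolding nm by auto
  qed
  with m show thesis by (rule that)
qed

lemma finitely_generated_free_module:
  assumes "ring R"
  shows "finitely_generated R (free_module R n)"
proof -
  interpret R: ring R by fact
  have F: "right_module R (free_module R n)"
    by (rule right_module_free_module) fact
  interpret F: right_module R "free_module R n" by fact
  show ?thesis
  proof (rule finitely_generatedI[OF _ _ equalityI])
    show "finite (unit_vector R n ` {..<n})" "unit_vector R n ` {..<n} \<subseteq> carrier (free_module R n)"
      using unit_vector_closed[OF assms] by auto
    fix H assume H: "submodule H R (free_module R n)" "unit_vector R n ` {..<n} \<subseteq> H"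
    note Hs = right_submodule_simps[OF H(1)]
    show "H \<subseteq> carrier (free_module R n)" by (rule Hs)
    have fs: "(\<Oplus>\<^bsub>free_module R n\<^esub>i\<in>A. f i) \<in> H" if "finite A" "f \<in> A \<rightarrow> H" for A and f :: "nat \<Rightarrow> _"
      using that
    proof (induction A rule: finite_induct)
      case (insert a A)
      moreover from insert have "f \<in> A \<rightarrow> carrier (free_module R n)" "f a \<in> carrier (free_module R n)"
        using Hs(1) by auto
      ultimately show ?case using Hs by simp
    qed (use Hs in simp)
    show "carrier (free_module R n) \<subseteq> H"
    proof
      fix c assume c: "c \<in> carrier (free_module R n)"
      have "linear_combination (free_module R n) n (unit_vector R n) c \<in> H"
        unfolding linear_combination_def
        using c H(2)
        by (intro fs) (auto intro!: Hs(4) simp: free_module_def[of R n, THEN arg_cong[of _ _ carrier]])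
      then show "c \<in> H"
        using free_module_expansion[OF assms c] by simp
    qed
  qed
qed

subsection \<open>Isomorphisms and copies\<close>

lemma right_module_hom_inv:
  assumes "right_module R M" "h \<in> right_module_hom R M N" "bij_betw h (carrier M) (carrier N)"
  shows "inv_into (carrier M) h \<in> right_module_hom R N M"
proof -
  interpret M: right_module R M by fact
  note hD = right_module_homD[OF assms(2)]
  have surj: "\<exists>x'\<in>carrier M. x = h x'" if "x \<in> carrier N" for x
    using that assms(3) by (auto simp: bij_betw_def)
  have [simp]: "inv_into (carrier M) h (h x) = x" if "x \<in> carrier M" for x
    using that assms(3) by (auto simp: bij_betw_def)
  show ?thesis
  proof (rule right_module_homI)
    show "inv_into (carrier M) h x \<in> carrier M" if "x \<in> carrier N" for x
      using surj[OF that] by auto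
    show "inv_into (carrier M) h (x \<oplus>\<^bsub>N\<^esub> y) = inv_into (carrier M) h x \<oplus>\<^bsub>M\<^esub> inv_into (carrier M) h y"
      if xy: "x \<in> carrier N" "y \<in> carrier N" for x y
    proof -
      obtain x' y' where "x = h x'" "y = h y'" and *: "x' \<in> carrier M" "y' \<in> carrier M"
        using surj xy by blast
      then have "x \<oplus>\<^bsub>N\<^esub> y = h (x' \<oplus>\<^bsub>M\<^esub> y')"
        by (simp only: hD(2))
      then show ?thesis
        using * \<open>x = h x'\<close> \<open>y = h y'\<close> by simp
    qed
    show "inv_into (carrier M) h (a \<odot>\<^bsub>N\<^esub> x) = a \<odot>\<^bsub>M\<^esub> inv_into (carrier M) h x"
      if ax: "a \<in> carrier R" "x \<in> carrier N" for a x
    proof -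
      obtain x' where "x = h x'" and *: "x' \<in> carrier M"
        using surj[OF ax(2)] by blast
      then have "a \<odot>\<^bsub>N\<^esub> x = h (a \<odot>\<^bsub>M\<^esub> x')"
        using ax by (simp only: hD(3))
      then show ?thesis
        using * \<open>x = h x'\<close> ax by simp
    qed
  qed
qed

lemma right_module_iso_refl: "right_module_iso R M M"
  unfolding right_module_iso_def
  by (intro bexI[of _ "\<lambda>x. x"]) (auto simp: right_module_hom_def bij_betw_def)

lemma right_module_iso_sym:
  assumes "right_module R M" "right_module_iso R M N"
  shows "right_module_iso R N M"
  using assms right_module_hom_inv bij_betw_inv_into unfolding right_module_iso_def by blast

lemma right_module_iso_trans:
  assumes "right_module_iso R M N" "right_module_iso R N K"
  shows "right_module_iso R M K"
proof -
  obtain g h where "g \<in> right_module_hom R M N" "bij_betw g (carrier M) (carrier N)"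
    "h \<in> right_module_hom R N K" "bij_betw h (carrier N) (carrier K)"
    using assms unfolding right_module_iso_def by blast
  then show ?thesis
    unfolding right_module_iso_def
    using right_module_hom_comp[of g R M N h K] bij_betw_trans[of g "carrier M" "carrier N" h]
    by (intro bexI[of _ "\<lambda>x. h (g x)"]) (auto simp: comp_def)
qed

definition copy_module :: "('p \<Rightarrow> 'q) \<Rightarrow> ('r, 'p) module \<Rightarrow> ('r, 'q) module" where
  "copy_module j M =
     \<lparr>carrier = j ` carrier M,
      monoid.mult = undefined,
      one = undefined,
      zero = j \<zero>\<^bsub>M\<^esub>,
      add = (\<lambda>x y. j (inv_into (carrier M) j x \<oplus>\<^bsub>M\<^esub> inv_into (carrier M) j y)),
      smult = (\<lambda>a x. j (a \<odot>\<^bsub>M\<^esub> inv_into (carrier M) j x))\<rparr>"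

lemma copy_module:
  assumes "right_module R M" "inj_on j (carrier M)"
  shows "right_module R (copy_module j M)" "j \<in> right_module_hom R M (copy_module j M)"
    "bij_betw j (carrier M) (carrier (copy_module j M))"
proof -
  interpret M: right_module R M by fact
  have [simp]: "inv_into (carrier M) j (j x) = x" if "x \<in> carrier M" for x
    using assms(2) that by simp
  have "abelian_group (copy_module j M)"
  proof (rule abelian_groupI)
    fix x assume "x \<in> carrier (copy_module j M)"
    then obtain x' where "x = j x'" "x' \<in> carrier M"
      by (auto simp: copy_module_def)
    then show "\<exists>y\<in>carrier (copy_module j M). y \<oplus>\<^bsub>copy_module j M\<^esub> x = \<zero>\<^bsub>copy_module j M\<^esub>"
      by (intro bexI[of _ "j (\<ominus>\<^bsub>M\<^esub> x')"]) (simp_all add: copy_module_def M.M.l_neg)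
  qed (auto simp: copy_module_def M.M.a_ac)
  then show "right_module R (copy_module j M)"
    by (intro right_module.intro right_module_axioms.intro M.R.ring_axioms)
      (auto simp: copy_module_def M.smult_add M.smult_add_scalar M.smult_assoc)
  show "j \<in> right_module_hom R M (copy_module j M)"
    "bij_betw j (carrier M) (carrier (copy_module j M))"
    using assms(2) by (auto simp: right_module_hom_def copy_module_def bij_betw_def)
qed

subsection \<open>Independence of the test type\<close>

lemma fg_projective_splitE:
  fixes R :: "'r ring"
  assumes "fg_projective R P"
  obtains n \<pi> s where "\<pi> \<in> right_module_hom R (free_module R n) P"
    "s \<in> right_module_hom R P (free_module R n)" "\<And>x. x \<in> carrier P \<Longrightarrow> \<pi> (s x) = x"
proof -
  have P: "right_module R P" and fg: "finitely_generated R P"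
    and pr: "projective_wrt TYPE(nat \<Rightarrow> 'r) R P"
    using assms by (auto simp: fg_projective_def)
  interpret P: right_module R P by fact
  obtain n m where m: "m \<in> {..<n} \<rightarrow> carrier P"
    and surj: "linear_combination P n m ` carrier (free_module R n) = carrier P"
    using finitely_generated_imp_linear_combinations[OF P fg] .
  define \<pi> where "\<pi> = linear_combination P n m"
  define j where "j = inv_into (carrier (free_module R n)) \<pi>"
  have \<pi>: "\<pi> \<in> right_module_hom R (free_module R n) P"
    unfolding \<pi>_def by (rule linear_combination_hom[OF P m])
  have "inj_on j (carrier P)"
    unfolding j_def using surj by (intro inj_on_inv_into) (simp add: \<pi>_def)
  note copy = copy_module[OF P this]
  have "(\<lambda>c. j (\<pi> c)) ` carrier (free_module R n) = carrier (copy_module j P)"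
    using surj bij_betw_imp_surj_on[OF copy(3)] by (simp add: \<pi>_def flip: image_image)
  moreover have "(\<lambda>c. j (\<pi> c)) \<in> right_module_hom R (free_module R n) (copy_module j P)"
    by (rule right_module_hom_comp[OF \<pi> copy(2)])
  ultimately obtain s where s: "s \<in> right_module_hom R P (free_module R n)"
    "\<forall>x\<in>carrier P. j (\<pi> (s x)) = j x"
    using pr copy(1,2) right_module_free_module[OF P.R.ring_axioms, of n]
    unfolding projective_wrt_def by meson
  have "\<pi> (s x) = x" if x: "x \<in> carrier P" for x
    using s(2) x right_module_homD(1)[OF \<pi>] right_module_homD(1)[OF s(1)]
      inj_onD[OF \<open>inj_on j (carrier P)\<close>, of "\<pi> (s x)" x] by blast
  with \<pi> s(1) show thesis by (rule that)
qed

lemma split_imp_projective: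
  fixes R :: "'r ring" and P :: "('r, 'p) module"
  assumes "ring R" "\<pi> \<in> right_module_hom R (free_module R n) P"
    "s \<in> right_module_hom R P (free_module R n)" "\<And>x. x \<in> carrier P \<Longrightarrow> \<pi> (s x) = x"
  shows "projective_wrt TYPE('u) R P"
  unfolding projective_wrt_def
proof (intro allI impI; elim conjE)
  fix M N :: "('r, 'u) module" and g f
  assume M: "right_module R M" and N: "right_module R N"
    and g: "g \<in> right_module_hom R M N" and surj: "g ` carrier M = carrier N"
    and f: "f \<in> right_module_hom R P N"
  have F: "right_module R (free_module R n)"
    by (rule right_module_free_module) fact
  define k where "k = (\<lambda>c. f (\<pi> c))"
  have k: "k \<in> right_module_hom R (free_module R n) N"
    unfolding k_def by (rule right_module_hom_comp[OF assms(2) f])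
  define m where "m i = inv_into (carrier M) g (k (unit_vector R n i))" for i
  have m: "m i \<in> carrier M" "g (m i) = k (unit_vector R n i)" for i
    using right_module_homD(1)[OF k unit_vector_closed[OF assms(1)]] surj
    unfolding m_def by (auto intro: inv_into_into f_inv_into_f)
  define h where "h = linear_combination M n m"
  have h: "h \<in> right_module_hom R (free_module R n) M"
    unfolding h_def by (rule linear_combination_hom[OF M]) (use m in auto)
  have "g (h c) = k c" if c: "c \<in> carrier (free_module R n)" for c
  proof -
    have "g (h c) = linear_combination N n (\<lambda>i. k (unit_vector R n i)) c"
      using right_module_hom_linear_combination[OF M N g _ c, of m] m by (simp add: h_def)
    also have "\<dots> = k (linear_combination (free_module R n) n (unit_vector R n) c)"
      by (rule right_module_hom_linear_combination[OF F N k _ c, symmetric])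
        (use unit_vector_closed[OF assms(1)] in auto)
    also have "\<dots> = k c"
      using free_module_expansion[OF assms(1) c] by simp
    finally show ?thesis .
  qed
  then have "\<forall>x\<in>carrier P. g (h (s x)) = f x"
    using right_module_homD(1)[OF assms(3)] assms(4) by (simp add: k_def)
  then show "\<exists>h\<in>right_module_hom R P M. \<forall>x\<in>carrier P. g (h x) = f x"
    using right_module_hom_comp[OF assms(3) h] by (intro bexI[of _ "\<lambda>x. h (s x)"])
qed

theorem fg_projective_any:
  fixes R :: "'r ring" and P :: "('r, 'p) module"
  assumes "fg_projective R P"
  shows "projective_wrt TYPE('u) R P"
proof -
  obtain n \<pi> s where "\<pi> \<in> right_module_hom R (free_module R n) P"
    "s \<in> right_module_hom R P (free_module R n)" "\<And>x. x \<in> carrier P \<Longrightarrow> \<pi> (s x) = x"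
    using fg_projective_splitE[OF assms] by metis
  moreover have "ring R"
    using assms by (auto simp: fg_projective_def right_module_def)
  ultimately show ?thesis
    using split_imp_projective by metis
qed

lemma fg_projective_iso:
  fixes R :: "'r ring" and P :: "('r, 'p) module" and Q :: "('r, 'q) module"
  assumes "fg_projective R P" "right_module_iso R P Q" "right_module R Q"
  shows "fg_projective R Q"
proof -
  have P: "right_module R P" and fg: "finitely_generated R P"
    using assms(1) by (auto simp: fg_projective_def)
  obtain h where h: "h \<in> right_module_hom R P Q" "bij_betw h (carrier P) (carrier Q)"
    using assms(2) by (auto simp: right_module_iso_def)
  define i where "i = inv_into (carrier P) h"
  have i: "i \<in> right_module_hom R Q P" "\<And>x. x \<in> carrier Q \<Longrightarrow> h (i x) = x"
    using right_module_hom_inv[OF P h] h(2)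
    by (auto simp: i_def bij_betw_def intro: f_inv_into_f)
  obtain n \<pi> s where \<pi>s: "\<pi> \<in> right_module_hom R (free_module R n) P"
    "s \<in> right_module_hom R P (free_module R n)" "\<And>x. x \<in> carrier P \<Longrightarrow> \<pi> (s x) = x"
    using fg_projective_splitE[OF assms(1)] by metis
  have "projective_wrt TYPE(nat \<Rightarrow> 'r) R Q"
    by (rule split_imp_projective[OF _ right_module_hom_comp[OF \<pi>s(1) h(1)]
          right_module_hom_comp[OF i(1) \<pi>s(2)]])
      (use P i \<pi>s(3) right_module_homD(1)[OF i(1)] in \<open>auto simp: right_module_def\<close>)
  moreover have "finitely_generated R Q"
    by (rule finitely_generated_image[OF P assms(3) h(1) _ fg]) (use h(2) in \<open>auto simp: bij_betw_def\<close>)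
  ultimately show ?thesis
    using assms(3) by (simp add: fg_projective_def)
qed

lemma fg_projective_representative:
  fixes R :: "'r ring" and P :: "('r, 'p) module"
  assumes "fg_projective R P"
  obtains Q :: "('r, nat \<Rightarrow> 'r) module" where "fg_projective R Q" "right_module_iso R P Q"
proof -
  have P: "right_module R P"
    using assms by (auto simp: fg_projective_def)
  obtain n \<pi> s where \<pi>s: "\<pi> \<in> right_module_hom R (free_module R n) P"
    "s \<in> right_module_hom R P (free_module R n)" "\<And>x. x \<in> carrier P \<Longrightarrow> \<pi> (s x) = x"
    using fg_projective_splitE[OF assms] by metis
  have "inj_on s (carrier P)"
    by (rule inj_on_inverseI[of _ \<pi>]) (rule \<pi>s(3))
  note copy = copy_module[OF P this]
  have "right_module_iso R P (copy_module s P)"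
    using copy(2,3) by (auto simp: right_module_iso_def)
  with fg_projective_iso[OF assms this copy(1)] show thesis
    by (rule that)
qed

subsection \<open>Direct sums and the monoid of isomorphism classes\<close>

lemma right_module_direct_sum:
  assumes "right_module R A" "right_module R B"
  shows "right_module R (direct_sum A B)"
proof -
  interpret A: right_module R A by fact
  interpret B: right_module R B by fact
  have "abelian_group (direct_sum A B)"
  proof (rule abelian_groupI)
    fix x assume "x \<in> carrier (direct_sum A B)"
    then show "\<exists>y\<in>carrier (direct_sum A B). y \<oplus>\<^bsub>direct_sum A B\<^esub> x = \<zero>\<^bsub>direct_sum A B\<^esub>"
      by (intro bexI[of _ "(\<ominus>\<^bsub>A\<^esub> fst x, \<ominus>\<^bsub>B\<^esub> snd x)"])
        (auto simp: direct_sum_def A.M.l_neg B.M.l_neg)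
  qed (auto simp: direct_sum_def A.M.a_ac B.M.a_ac)
  then show ?thesis
    by (intro right_module.intro right_module_axioms.intro A.R.ring_axioms)
      (auto simp: direct_sum_def A.smult_add A.smult_add_scalar A.smult_assoc
        B.smult_add B.smult_add_scalar B.smult_assoc)
qed

lemma direct_sum_homs:
  assumes "right_module R A" "right_module R B"
  shows "(\<lambda>x. (x, \<zero>\<^bsub>B\<^esub>)) \<in> right_module_hom R A (direct_sum A B)"
    "(\<lambda>y. (\<zero>\<^bsub>A\<^esub>, y)) \<in> right_module_hom R B (direct_sum A B)"
proof -
  interpret A: right_module R A by fact
  interpret B: right_module R B by fact
  show "(\<lambda>x. (x, \<zero>\<^bsub>B\<^esub>)) \<in> right_module_hom R A (direct_sum A B)"
    "(\<lambda>y. (\<zero>\<^bsub>A\<^esub>, y)) \<in> right_module_hom R B (direct_sum A B)"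
    by (auto simp: right_module_hom_def direct_sum_def)
qed

lemma finitely_generated_direct_sum:
  assumes "right_module R A" "right_module R B" "finitely_generated R A" "finitely_generated R B"
  shows "finitely_generated R (direct_sum A B)"
proof -
  interpret A: right_module R A by fact
  interpret B: right_module R B by fact
  have AB: "right_module R (direct_sum A B)"
    using assms(1,2) by (rule right_module_direct_sum)
  obtain S where S: "finite S" "S \<subseteq> carrier A"
    "\<forall>H. submodule H R A \<longrightarrow> S \<subseteq> H \<longrightarrow> H = carrier A"
    using assms(3) by (rule finitely_generatedE)
  obtain T where T: "finite T" "T \<subseteq> carrier B"
    "\<forall>H. submodule H R B \<longrightarrow> T \<subseteq> H \<longrightarrow> H = carrier B"
    using assms(4) by (rule finitely_generatedE)
  let ?G = "(\<lambda>x. (x, \<zero>\<^bsub>B\<^esub>)) ` S \<union> (\<lambda>y. (\<zero>\<^bsub>A\<^esub>, y)) ` T"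
  show ?thesis
  proof (rule finitely_generatedI)
    show "finite ?G" "?G \<subseteq> carrier (direct_sum A B)"
      using S(1,2) T(1,2) by (auto simp: direct_sum_def)
    fix H assume H: "submodule H R (direct_sum A B)" "?G \<subseteq> H"
    have "{x \<in> carrier A. (x, \<zero>\<^bsub>B\<^esub>) \<in> H} = carrier A"
      using right_module_hom_vimage_submodule[OF assms(1) AB direct_sum_homs(1)[OF assms(1,2)] H(1)]
        S(2) H(2) by (intro S(3)[rule_format]) auto
    moreover have "{y \<in> carrier B. (\<zero>\<^bsub>A\<^esub>, y) \<in> H} = carrier B"
      using right_module_hom_vimage_submodule[OF assms(2) AB direct_sum_homs(2)[OF assms(1,2)] H(1)]
        T(2) H(2) by (intro T(3)[rule_format]) auto
    ultimately have xy: "(x, \<zero>\<^bsub>B\<^esub>) \<in> H" "(\<zero>\<^bsub>A\<^esub>, y) \<in> H"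
      if "x \<in> carrier A" "y \<in> carrier B" for x y
      using that by blast+
    have "(x, y) \<in> H" if "x \<in> carrier A" "y \<in> carrier B" for x y
      using right_submodule_simps(3)[OF H(1) xy[OF that]] that by (simp add: direct_sum_def)
    then have "carrier (direct_sum A B) \<subseteq> H"
      by (auto simp: direct_sum_def)
    then show "H = carrier (direct_sum A B)"
      using right_submodule_simps(1)[OF H(1)] by blast
  qed
qed

lemma projective_direct_sum:
  assumes "right_module R A" "right_module R B"
    and "projective_wrt TYPE('u) R A" "projective_wrt TYPE('u) R B"
  shows "projective_wrt TYPE('u) R (direct_sum A B)"
  unfolding projective_wrt_def
proof (intro allI impI; elim conjE)
  interpret A: right_module R A by fact
  interpret B: right_module R B by fact
  fix M N :: "(_, 'u) module" and g f
  assume M: "right_module R M" and N: "right_module R N"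
    and g: "g \<in> right_module_hom R M N" and surj: "g ` carrier M = carrier N"
    and f: "f \<in> right_module_hom R (direct_sum A B) N"
  interpret M: right_module R M by fact
  note fD = right_module_homD[OF f] and gD = right_module_homD[OF g]
  note homs = direct_sum_homs[OF assms(1,2)]
  obtain h where h: "h \<in> right_module_hom R A M" "\<forall>x\<in>carrier A. g (h x) = f (x, \<zero>\<^bsub>B\<^esub>)"
    using assms(3) M N g surj right_module_hom_comp[OF homs(1) f]
    unfolding projective_wrt_def by meson
  obtain k where k: "k \<in> right_module_hom R B M" "\<forall>y\<in>carrier B. g (k y) = f (\<zero>\<^bsub>A\<^esub>, y)"
    using assms(4) M N g surj right_module_hom_comp[OF homs(2) f]
    unfolding projective_wrt_def by meson
  note hD = right_module_homD[OF h(1)] and kD = right_module_homD[OF k(1)]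
  show "\<exists>h\<in>right_module_hom R (direct_sum A B) M. \<forall>x\<in>carrier (direct_sum A B). g (h x) = f x"
  proof (intro bexI[of _ "\<lambda>(x, y). h x \<oplus>\<^bsub>M\<^esub> k y"] ballI)
    fix p assume "p \<in> carrier (direct_sum A B)"
    then obtain x y where p: "p = (x, y)" "x \<in> carrier A" "y \<in> carrier B"
      by (auto simp: direct_sum_def)
    have "f (x, y) = f ((x, \<zero>\<^bsub>B\<^esub>) \<oplus>\<^bsub>direct_sum A B\<^esub> (\<zero>\<^bsub>A\<^esub>, y))"
      using p by (simp add: direct_sum_def)
    also have "\<dots> = f (x, \<zero>\<^bsub>B\<^esub>) \<oplus>\<^bsub>N\<^esub> f (\<zero>\<^bsub>A\<^esub>, y)"
      using p by (intro fD(2)) (auto simp: direct_sum_def)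
    finally show "g (case p of (x, y) \<Rightarrow> h x \<oplus>\<^bsub>M\<^esub> k y) = f p"
      using p h(2) k(2) by (simp add: gD hD kD)
  next
    show "(\<lambda>(x, y). h x \<oplus>\<^bsub>M\<^esub> k y) \<in> right_module_hom R (direct_sum A B) M"
      by (rule right_module_homI)
        (auto simp: direct_sum_def hD kD M.smult_add M.M.a_ac)
  qed
qed

lemma fg_projective_direct_sum:
  assumes "fg_projective R A" "fg_projective R B"
  shows "fg_projective R (direct_sum A B)"
  using assms fg_projective_any[OF assms(1)] fg_projective_any[OF assms(2)]
  unfolding fg_projective_def
  by (auto intro: right_module_direct_sum finitely_generated_direct_sum projective_direct_sum)

lemma right_module_iso_direct_sum:
  assumes "right_module_iso R A A'" "right_module_iso R B B'"
  shows "right_module_iso R (direct_sum A B) (direct_sum A' B')"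
proof -
  obtain h k where h: "h \<in> right_module_hom R A A'" "bij_betw h (carrier A) (carrier A')"
    and k: "k \<in> right_module_hom R B B'" "bij_betw k (carrier B) (carrier B')"
    using assms unfolding right_module_iso_def by blast
  have "map_prod h k \<in> right_module_hom R (direct_sum A B) (direct_sum A' B')"
    by (rule right_module_homI)
      (auto simp: direct_sum_def right_module_homD[OF h(1)] right_module_homD[OF k(1)])
  moreover have "bij_betw (map_prod h k) (carrier (direct_sum A B)) (carrier (direct_sum A' B'))"
    unfolding direct_sum_def using bij_betw_map_prod[OF h(2) k(2)] by simp
  ultimately show ?thesis
    unfolding right_module_iso_def by blast
qed

lemma right_module_iso_direct_sum_comm:
  "right_module_iso R (direct_sum A B) (direct_sum B A)"
  unfolding right_module_iso_def
  by (intro bexI[of _ "\<lambda>(x, y). (y, x)"] bij_betwI[of _ _ _ "\<lambda>(x, y). (y, x)"] right_module_homI)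
    (auto simp: direct_sum_def)

lemma right_module_iso_direct_sum_assoc:
  "right_module_iso R (direct_sum (direct_sum A B) C) (direct_sum A (direct_sum B C))"
  unfolding right_module_iso_def
  by (intro bexI[of _ "\<lambda>((x, y), z). (x, (y, z))"] bij_betwI[of _ _ _ "\<lambda>(x, (y, z)). ((x, y), z)"]
      right_module_homI)
    (auto simp: direct_sum_def)

lemma right_module_iso_direct_sum_zero:
  assumes "right_module R Z" "right_module R A" "carrier Z = {\<zero>\<^bsub>Z\<^esub>}"
  shows "right_module_iso R A (direct_sum Z A)"
  unfolding right_module_iso_def
  using direct_sum_homs(2)[OF assms(1,2)]
  by (intro bexI[of _ "\<lambda>y. (\<zero>\<^bsub>Z\<^esub>, y)"] bij_betwI[of _ _ _ snd])
    (auto simp: direct_sum_def assms(3))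

lemma proj_class_eq_iff:
  assumes "fg_projective R A" "fg_projective R B"
  shows "proj_class R A = proj_class R B \<longleftrightarrow> right_module_iso R A B"
proof
  have A: "right_module R A" and B: "right_module R B"
    using assms by (auto simp: fg_projective_def)
  show "right_module_iso R A B" if eq: "proj_class R A = proj_class R B"
  proof -
    obtain C where C: "fg_projective R C" "right_module_iso R A C" "C \<in> proj_class R A"
      using fg_projective_representative[OF assms(1)] unfolding proj_class_def by blast
    then have "right_module_iso R B C"
      using eq by (auto simp: proj_class_def)
    then show ?thesis
      using right_module_iso_trans[OF C(2) right_module_iso_sym[OF B]] by blast
  qed
  show "proj_class R A = proj_class R B" if "right_module_iso R A B"
    unfolding proj_class_def using that right_module_iso_sym[OF A that]
    by (auto intro: right_module_iso_trans)
qed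

theorem proj_class_in_carrier:
  assumes "fg_projective R A"
  shows "proj_class R A \<in> carrier (V_monoid R)"
proof -
  obtain B where B: "fg_projective R B" "right_module_iso R A B" "B \<in> proj_class R A"
    using fg_projective_representative[OF assms] unfolding proj_class_def by blast
  then have "proj_class R A = proj_class R B"
    using proj_class_eq_iff[OF assms] by blast
  then show ?thesis
    using B(1) by (auto simp: V_monoid_def)
qed

theorem proj_class_direct_sum:
  assumes "fg_projective R A" "fg_projective R B"
  shows "proj_class R A \<otimes>\<^bsub>V_monoid R\<^esub> proj_class R B = proj_class R (direct_sum A B)"
proof -
  have "proj_class R (direct_sum C D) = proj_class R (direct_sum A B)"
    if "C \<in> proj_class R A" "D \<in> proj_class R B" for C D
  proof -
    have CD: "fg_projective R C" "fg_projective R D" and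
      iso: "right_module_iso R (direct_sum A B) (direct_sum C D)"
      using that by (auto simp: proj_class_def intro: right_module_iso_direct_sum)
    have "proj_class R (direct_sum A B) = proj_class R (direct_sum C D)"
      using iso by (rule iffD2[OF proj_class_eq_iff[OF fg_projective_direct_sum[OF assms]
            fg_projective_direct_sum[OF CD]]])
    then show ?thesis by (rule sym)
  qed
  moreover obtain C where "C \<in> proj_class R A"
    using fg_projective_representative[OF assms(1)] unfolding proj_class_def by blast
  moreover obtain D where "D \<in> proj_class R B"
    using fg_projective_representative[OF assms(2)] unfolding proj_class_def by blast
  ultimately have "(\<Union>C\<in>proj_class R A. \<Union>D\<in>proj_class R B. proj_class R (direct_sum C D)) =
      proj_class R (direct_sum A B)"
    by blast
  then show ?thesis
    by (simp add: V_monoid_def)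
qed

lemma fg_projective_zero:
  assumes "ring R"
  shows "fg_projective R (free_module R 0)" "carrier (free_module R 0) = {\<zero>\<^bsub>free_module R 0\<^esub>}"
proof -
  have "(\<lambda>x. x) \<in> right_module_hom R (free_module R n) (free_module R n)" for n
    by (auto simp: right_module_hom_def)
  from split_imp_projective[OF assms this this]
  show "fg_projective R (free_module R 0)"
    unfolding fg_projective_def
    using right_module_free_module finitely_generated_free_module assms by blast
  show "carrier (free_module R 0) = {\<zero>\<^bsub>free_module R 0\<^esub>}"
    by (auto simp: free_module_def)
qed

lemma V_monoid_one:
  assumes "ring R"
  shows "\<one>\<^bsub>V_monoid R\<^esub> = proj_class R (free_module R 0)"
proof -
  let ?Z = "free_module R 0"
  note Z = fg_projective_zero[OF assms]
  have "carrier B = {\<zero>\<^bsub>B\<^esub>} \<longleftrightarrow> right_module_iso R ?Z B" if "fg_projective R B" for B :: "(_, nat \<Rightarrow> _) module"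
  proof
    have rm: "right_module R B" "right_module R ?Z"
      using that Z(1) by (auto simp: fg_projective_def)
    interpret B: right_module R B by fact
    show "right_module_iso R ?Z B" if "carrier B = {\<zero>\<^bsub>B\<^esub>}"
      unfolding right_module_iso_def using that Z(2)
      by (intro bexI[of _ "\<lambda>_. \<zero>\<^bsub>B\<^esub>"]) (auto simp: right_module_hom_def bij_betw_def)
    show "carrier B = {\<zero>\<^bsub>B\<^esub>}" if "right_module_iso R ?Z B"
      using that Z(2) right_module_hom_zero[OF rm(2,1)]
      by (auto simp: right_module_iso_def bij_betw_def)
  qed
  then show ?thesis
    by (auto simp: V_monoid_def proj_class_def)
qed

theorem V_monoid_comm_monoid:
  fixes R :: "'r ring"
  assumes "ring R"
  shows "comm_monoid (V_monoid R)"
proof (rule comm_monoidI)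
  let ?V = "V_monoid R"
  note Z = fg_projective_zero[OF assms]
  have car: "\<exists>A::('r, nat \<Rightarrow> 'r) module. \<alpha> = proj_class R A \<and> fg_projective R A" if "\<alpha> \<in> carrier ?V" for \<alpha>
    using that by (simp add: V_monoid_def)
  show "\<one>\<^bsub>?V\<^esub> \<in> carrier ?V"
    unfolding V_monoid_one[OF assms] by (rule proj_class_in_carrier[OF Z(1)])
  fix \<alpha> assume "\<alpha> \<in> carrier ?V"
  then obtain A :: "('r, nat \<Rightarrow> 'r) module" where A: "\<alpha> = proj_class R A" "fg_projective R A"
    using car by blast
  have "right_module_iso R A (direct_sum (free_module R 0) A)"
    using Z A by (intro right_module_iso_direct_sum_zero) (auto simp: fg_projective_def)
  then show "\<one>\<^bsub>?V\<^esub> \<otimes>\<^bsub>?V\<^esub> \<alpha> = \<alpha>"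
    using proj_class_eq_iff[OF A(2) fg_projective_direct_sum[OF Z(1) A(2)]]
    unfolding V_monoid_one[OF assms] A(1) proj_class_direct_sum[OF Z(1) A(2)] by blast
  fix \<beta> assume "\<beta> \<in> carrier ?V"
  then obtain B :: "('r, nat \<Rightarrow> 'r) module" where B: "\<beta> = proj_class R B" "fg_projective R B"
    using car by blast
  show "\<alpha> \<otimes>\<^bsub>?V\<^esub> \<beta> \<in> carrier ?V"
    unfolding A B proj_class_direct_sum[OF A(2) B(2)]
    by (intro proj_class_in_carrier fg_projective_direct_sum A B)
  show "\<alpha> \<otimes>\<^bsub>?V\<^esub> \<beta> = \<beta> \<otimes>\<^bsub>?V\<^esub> \<alpha>"
    unfolding A(1) B(1) proj_class_direct_sum[OF A(2) B(2)] proj_class_direct_sum[OF B(2) A(2)]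
    by (subst proj_class_eq_iff) (intro fg_projective_direct_sum A B right_module_iso_direct_sum_comm)+
  fix \<gamma> assume "\<gamma> \<in> carrier ?V"
  then obtain C :: "('r, nat \<Rightarrow> 'r) module" where C: "\<gamma> = proj_class R C" "fg_projective R C"
    using car by blast
  note AB = fg_projective_direct_sum[OF A(2) B(2)] and BC = fg_projective_direct_sum[OF B(2) C(2)]
  show "\<alpha> \<otimes>\<^bsub>?V\<^esub> \<beta> \<otimes>\<^bsub>?V\<^esub> \<gamma> = \<alpha> \<otimes>\<^bsub>?V\<^esub> (\<beta> \<otimes>\<^bsub>?V\<^esub> \<gamma>)"
    unfolding A(1) B(1) C(1) proj_class_direct_sum[OF A(2) B(2)] proj_class_direct_sum[OF B(2) C(2)]
      proj_class_direct_sum[OF AB C(2)] proj_class_direct_sum[OF A(2) BC]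
    by (subst proj_class_eq_iff)
      (intro fg_projective_direct_sum A B C right_module_iso_direct_sum_assoc)+
qed

section \<open>Consistency of the definitions: free bounded lattices\<close>

lemma lattice_laws:
  assumes "lattice L" "x \<in> carrier L" "y \<in> carrier L"
  shows "z \<in> carrier L \<Longrightarrow> x \<squnion>\<^bsub>L\<^esub> y \<squnion>\<^bsub>L\<^esub> z = x \<squnion>\<^bsub>L\<^esub> (y \<squnion>\<^bsub>L\<^esub> z)"
    "z \<in> carrier L \<Longrightarrow> x \<sqinter>\<^bsub>L\<^esub> y \<sqinter>\<^bsub>L\<^esub> z = x \<sqinter>\<^bsub>L\<^esub> (y \<sqinter>\<^bsub>L\<^esub> z)"
    "x \<squnion>\<^bsub>L\<^esub> (x \<sqinter>\<^bsub>L\<^esub> y) = x" "x \<sqinter>\<^bsub>L\<^esub> (x \<squnion>\<^bsub>L\<^esub> y) = x"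
proof -
  interpret lattice L by fact
  show "x \<squnion>\<^bsub>L\<^esub> y \<squnion>\<^bsub>L\<^esub> z = x \<squnion>\<^bsub>L\<^esub> (y \<squnion>\<^bsub>L\<^esub> z)"
    "x \<sqinter>\<^bsub>L\<^esub> y \<sqinter>\<^bsub>L\<^esub> z = x \<sqinter>\<^bsub>L\<^esub> (y \<sqinter>\<^bsub>L\<^esub> z)" if "z \<in> carrier L"
    using weak_join_assoc weak_meet_assoc assms that unfolding eq_is_equal by auto
  show "x \<squnion>\<^bsub>L\<^esub> (x \<sqinter>\<^bsub>L\<^esub> y) = x"
    by (rule le_antisym) (use assms in \<open>auto intro!: join_le join_left meet_left\<close>)
  show "x \<sqinter>\<^bsub>L\<^esub> (x \<squnion>\<^bsub>L\<^esub> y) = x"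
    by (rule le_antisym) (use assms in \<open>auto intro!: meet_le join_left meet_left\<close>)
qed

lemma lattice_from_operations:
  fixes C :: "'a set" and j m :: "'a \<Rightarrow> 'a \<Rightarrow> 'a"
  defines "L \<equiv> \<lparr>carrier = C, eq = (=), le = (\<lambda>x y. j x y = y)\<rparr>"
  assumes closed: "\<And>x y. x \<in> C \<Longrightarrow> y \<in> C \<Longrightarrow> j x y \<in> C" "\<And>x y. x \<in> C \<Longrightarrow> y \<in> C \<Longrightarrow> m x y \<in> C"
    and comm: "\<And>x y. x \<in> C \<Longrightarrow> y \<in> C \<Longrightarrow> j x y = j y x" "\<And>x y. x \<in> C \<Longrightarrow> y \<in> C \<Longrightarrow> m x y = m y x"
    and assoc: "\<And>x y z. x \<in> C \<Longrightarrow> y \<in> C \<Longrightarrow> z \<in> C \<Longrightarrow> j (j x y) z = j x (j y z)"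
      "\<And>x y z. x \<in> C \<Longrightarrow> y \<in> C \<Longrightarrow> z \<in> C \<Longrightarrow> m (m x y) z = m x (m y z)"
    and absorb: "\<And>x y. x \<in> C \<Longrightarrow> y \<in> C \<Longrightarrow> j x (m x y) = x" "\<And>x y. x \<in> C \<Longrightarrow> y \<in> C \<Longrightarrow> m x (j x y) = x"
  shows "lattice L" "\<And>x y. x \<in> C \<Longrightarrow> y \<in> C \<Longrightarrow> x \<squnion>\<^bsub>L\<^esub> y = j x y"
    "\<And>x y. x \<in> C \<Longrightarrow> y \<in> C \<Longrightarrow> x \<sqinter>\<^bsub>L\<^esub> y = m x y"
proof -
  have idem: "j x x = x" if "x \<in> C" for x
    using absorb(1)[of x "j x x"] absorb(2)[of x x] closed(1)[of x x] that by simp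
  have le_meet: "j x y = y \<longleftrightarrow> m x y = x" if "x \<in> C" "y \<in> C" for x y
    using that absorb comm closed by metis
  have L [simp]: "carrier L = C" "(.=\<^bsub>L\<^esub>) = (=)" "\<And>x y. x \<sqsubseteq>\<^bsub>L\<^esub> y \<longleftrightarrow> j x y = y"
    by (simp_all add: L_def)
  have po: "partial_order L"
  proof
    fix x y z assume xyz: "x \<sqsubseteq>\<^bsub>L\<^esub> y" "y \<sqsubseteq>\<^bsub>L\<^esub> z" "x \<in> carrier L" "y \<in> carrier L" "z \<in> carrier L"
    then show "x \<sqsubseteq>\<^bsub>L\<^esub> z"
      using assoc(1)[of x y z] by simp
  qed (use comm(1) idem in auto)
  interpret partial_order L by fact
  have least: "least L (j x y) (Upper L {x, y})" if xy: "x \<in> C" "y \<in> C" for x y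
  proof (rule least_UpperI)
    show "z \<sqsubseteq>\<^bsub>L\<^esub> j x y" if "z \<in> {x, y}" for z
      using that xy comm(1) assoc(1) idem closed(1) by (metis L(3) empty_iff insert_iff)
    show "j x y \<sqsubseteq>\<^bsub>L\<^esub> z" if "z \<in> Upper L {x, y}" for z
      using that xy assoc(1)[of x y z] by (simp add: Upper_def)
  qed (use xy closed in auto)
  have greatest: "greatest L (m x y) (Lower L {x, y})" if xy: "x \<in> C" "y \<in> C" for x y
  proof (rule greatest_LowerI)
    show "m x y \<sqsubseteq>\<^bsub>L\<^esub> z" if "z \<in> {x, y}" for z
      using that xy comm absorb(1) closed by (metis L(3) empty_iff insert_iff)
    show "z \<sqsubseteq>\<^bsub>L\<^esub> m x y" if "z \<in> Lower L {x, y}" for z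
      using that xy assoc(2)[of z x y] le_meet[of z x] le_meet[of z y] le_meet[of z "m x y"] closed(2)
      by (auto simp: Lower_def)
  qed (use xy closed in auto)
  show lat: "lattice L"
    by (intro lattice.intro upper_semilattice.intro lower_semilattice.intro po
        upper_semilattice_axioms.intro lower_semilattice_axioms.intro)
      (simp only: L(1), rule exI, erule (1) least, simp only: L(1), rule exI, erule (1) greatest)
  interpret lattice L by fact
  show "x \<squnion>\<^bsub>L\<^esub> y = j x y" if "x \<in> C" "y \<in> C" for x y
    using weak_least_unique[OF sup_of_two_least least[OF that]] that
    by (simp add: join_def)
  show "x \<sqinter>\<^bsub>L\<^esub> y = m x y" if "x \<in> C" "y \<in> C" for x y
    using weak_greatest_unique[OF inf_of_two_greatest greatest[OF that]] that
    by (simp add: meet_def)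
qed

lemma lattice_eval_closed:
  assumes "lattice L" "\<And>v. v \<in> set_lattice_term t \<Longrightarrow> \<rho> v \<in> carrier L"
  shows "lattice_eval L \<rho> t \<in> carrier L"
proof -
  interpret lattice L by fact
  show ?thesis using assms(2) by (induction t) auto
qed

primrec term_subst :: "('v \<Rightarrow> 'w lattice_term) \<Rightarrow> 'v lattice_term \<Rightarrow> 'w lattice_term" where
  "term_subst \<sigma> (Var v) = \<sigma> v"
| "term_subst \<sigma> (Join s t) = Join (term_subst \<sigma> s) (term_subst \<sigma> t)"
| "term_subst \<sigma> (Meet s t) = Meet (term_subst \<sigma> s) (term_subst \<sigma> t)"

lemma lattice_eval_subst:
  "lattice_eval L \<rho> (term_subst \<sigma> t) = lattice_eval L (\<lambda>v. lattice_eval L \<rho> (\<sigma> v)) t"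
  by (induction t) auto

text \<open>In terms over \<open>'x + bool\<close>, \<open>Inr False\<close> and \<open>Inr True\<close> stand for \<open>0\<close> and \<open>1\<close>.\<close>

inductive term_cong ::
    "lattice_identity set \<Rightarrow> ('x + bool) lattice_term \<Rightarrow> ('x + bool) lattice_term \<Rightarrow> bool"
  for E where
  tc_refl: "term_cong E t t"
| tc_sym: "term_cong E s t \<Longrightarrow> term_cong E t s"
| tc_trans: "term_cong E s t \<Longrightarrow> term_cong E t u \<Longrightarrow> term_cong E s u"
| tc_Join: "term_cong E s s' \<Longrightarrow> term_cong E t t' \<Longrightarrow> term_cong E (Join s t) (Join s' t')"
| tc_Meet: "term_cong E s s' \<Longrightarrow> term_cong E t t' \<Longrightarrow> term_cong E (Meet s t) (Meet s' t')"
| tc_Join_comm: "term_cong E (Join s t) (Join t s)"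
| tc_Meet_comm: "term_cong E (Meet s t) (Meet t s)"
| tc_Join_assoc: "term_cong E (Join (Join s t) u) (Join s (Join t u))"
| tc_Meet_assoc: "term_cong E (Meet (Meet s t) u) (Meet s (Meet t u))"
| tc_Join_absorb: "term_cong E (Join s (Meet s t)) s"
| tc_Meet_absorb: "term_cong E (Meet s (Join s t)) s"
| tc_bot: "term_cong E (Join (Var (Inr False)) t) t"
| tc_top: "term_cong E (Join t (Var (Inr True))) (Var (Inr True))"
| tc_identity: "(s, t) \<in> E \<Longrightarrow> term_cong E (term_subst \<sigma> s) (term_subst \<sigma> t)"

lemma term_cong_sound:
  assumes M: "bounded_lattice M" "M \<in> lattice_variety E"
    and \<rho>: "\<And>v. \<rho> v \<in> carrier M" "\<rho> (Inr False) = \<bottom>\<^bsub>M\<^esub>" "\<rho> (Inr True) = \<top>\<^bsub>M\<^esub>"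
    and "term_cong E s t"
  shows "lattice_eval M \<rho> s = lattice_eval M \<rho> t"
proof -
  interpret bounded_lattice M by fact
  have lat: "lattice M" ..
  have [simp]: "lattice_eval M \<rho> t \<in> carrier M" for t
    by (rule lattice_eval_closed[OF lat \<rho>(1)])
  show ?thesis
    using assms(6)
  proof induction
    case (tc_bot t)
    show ?case
      using bottom_join[of "lattice_eval M \<rho> t"] by (simp add: \<rho>(2) eq_is_equal)
  next
    case (tc_top t)
    show ?case
      using top_join[of "lattice_eval M \<rho> t"] by (simp add: \<rho>(3) eq_is_equal join_comm)
  next
    case (tc_identity s t \<sigma>)
    have "(\<lambda>v. lattice_eval M \<rho> (\<sigma> v)) \<in> UNIV \<rightarrow> carrier M"
      by simp
    with tc_identity M(2) show ?case
      unfolding lattice_variety_def lattice_eval_subst by blast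
  next
    case (tc_Join_comm s t) show ?case by (simp add: join_comm)
  next
    case (tc_Meet_comm s t) show ?case by (simp add: meet_comm)
  qed (simp_all add: lattice_laws[OF lat])
qed

definition term_class ::
    "lattice_identity set \<Rightarrow> ('x + bool) lattice_term \<Rightarrow> ('x + bool) lattice_term set" where
  "term_class E t = {s. term_cong E t s}"

lemma term_class_eq_iff: "term_class E s = term_class E t \<longleftrightarrow> term_cong E s t"
  by (auto simp: term_class_def intro: tc_refl tc_sym tc_trans)

definition terms_over :: "'x set \<Rightarrow> ('x + bool) lattice_term set" where
  "terms_over X = {t. set_lattice_term t \<subseteq> Inl ` X \<union> range Inr}"

definition class_join ::
    "lattice_identity set \<Rightarrow> ('x + bool) lattice_term set \<Rightarrow> ('x + bool) lattice_term set \<Rightarrow>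
     ('x + bool) lattice_term set" where
  "class_join E A B = (\<Union>s\<in>A. \<Union>t\<in>B. term_class E (Join s t))"

definition class_meet ::
    "lattice_identity set \<Rightarrow> ('x + bool) lattice_term set \<Rightarrow> ('x + bool) lattice_term set \<Rightarrow>
     ('x + bool) lattice_term set" where
  "class_meet E A B = (\<Union>s\<in>A. \<Union>t\<in>B. term_class E (Meet s t))"

lemma class_join: "class_join E (term_class E s) (term_class E t) = term_class E (Join s t)"
  unfolding class_join_def term_class_def by (auto intro: tc_refl tc_trans tc_Join)

lemma class_meet: "class_meet E (term_class E s) (term_class E t) = term_class E (Meet s t)"
  unfolding class_meet_def term_class_def by (auto intro: tc_refl tc_trans tc_Meet)

definition term_lattice ::
    "lattice_identity set \<Rightarrow> 'x set \<Rightarrow> ('x + bool) lattice_term set gorder" where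
  "term_lattice E X =
     \<lparr>carrier = term_class E ` terms_over X, eq = (=), le = (\<lambda>A B. class_join E A B = B)\<rparr>"

lemma term_lattice:
  shows "lattice (term_lattice E X)"
    "\<And>s t. s \<in> terms_over X \<Longrightarrow> t \<in> terms_over X \<Longrightarrow>
      term_class E s \<squnion>\<^bsub>term_lattice E X\<^esub> term_class E t = term_class E (Join s t)"
    "\<And>s t. s \<in> terms_over X \<Longrightarrow> t \<in> terms_over X \<Longrightarrow>
      term_class E s \<sqinter>\<^bsub>term_lattice E X\<^esub> term_class E t = term_class E (Meet s t)"
proof -
  have *: "Join s t \<in> terms_over X" "Meet s t \<in> terms_over X"
    if "s \<in> terms_over X" "t \<in> terms_over X" for s t
    using that by (auto simp: terms_over_def)
  note laws = lattice_from_operations[of "term_class E ` terms_over X" "class_join E" "class_meet E",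
      folded term_lattice_def]
  note rules = class_join class_meet term_class_eq_iff tc_Join_comm tc_Meet_comm tc_Join_assoc
    tc_Meet_assoc tc_Join_absorb tc_Meet_absorb
  show "lattice (term_lattice E X)"
    by (rule laws(1); (elim imageE)?; simp add: rules * imageI)
  show "term_class E s \<squnion>\<^bsub>term_lattice E X\<^esub> term_class E t = term_class E (Join s t)"
    if "s \<in> terms_over X" "t \<in> terms_over X" for s t
    by (subst laws(2); (elim imageE)?; simp add: rules * imageI that)
  show "term_class E s \<sqinter>\<^bsub>term_lattice E X\<^esub> term_class E t = term_class E (Meet s t)"
    if "s \<in> terms_over X" "t \<in> terms_over X" for s t
    by (subst laws(3); (elim imageE)?; simp add: rules * imageI that)
qed

lemma carrier_term_lattice: "carrier (term_lattice E X) = term_class E ` terms_over X"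
  by (simp add: term_lattice_def)

lemma Var_terms_over:
  "Var (Inr b) \<in> terms_over X" "x \<in> X \<Longrightarrow> Var (Inl x) \<in> terms_over X"
  by (auto simp: terms_over_def)

lemma term_lattice_bounds:
  "bounded_lattice (term_lattice E X)"
  "\<bottom>\<^bsub>term_lattice E X\<^esub> = term_class E (Var (Inr False))"
  "\<top>\<^bsub>term_lattice E X\<^esub> = term_class E (Var (Inr True))"
proof -
  let ?L = "term_lattice E X"
  interpret lattice ?L by (rule term_lattice)
  have bot: "term_class E (Var (Inr False)) \<in> carrier ?L"
    "\<And>A. A \<in> carrier ?L \<Longrightarrow> term_class E (Var (Inr False)) \<sqsubseteq>\<^bsub>?L\<^esub> A"
    using Var_terms_over(1)
    by (simp_all add: term_lattice_def) (auto simp: class_join term_class_eq_iff[THEN iffD2, OF tc_bot])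
  have top: "term_class E (Var (Inr True)) \<in> carrier ?L"
    "\<And>A. A \<in> carrier ?L \<Longrightarrow> A \<sqsubseteq>\<^bsub>?L\<^esub> term_class E (Var (Inr True))"
    using Var_terms_over(1)
    by (simp_all add: term_lattice_def) (auto simp: class_join term_class_eq_iff[THEN iffD2, OF tc_top])
  show b: "bounded_lattice ?L"
  proof unfold_locales
    show "\<exists>x. least ?L x (carrier ?L)"
      using bot by (auto simp: least_def)
    show "\<exists>x. greatest ?L x (carrier ?L)"
      using top by (auto simp: greatest_def)
  qed
  interpret bounded_lattice ?L by fact
  show "\<bottom>\<^bsub>?L\<^esub> = term_class E (Var (Inr False))" "\<top>\<^bsub>?L\<^esub> = term_class E (Var (Inr True))"
    using bottom_eq[OF bot] top_eq[OF top] by auto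
qed

lemma term_subst_over:
  "(\<And>v. \<sigma> v \<in> terms_over X) \<Longrightarrow> term_subst \<sigma> t \<in> terms_over X"
  by (induction t) (auto simp: terms_over_def)

lemma term_lattice_variety: "term_lattice E X \<in> lattice_variety E"
  unfolding lattice_variety_def
proof (intro CollectI conjI term_lattice(1) ballI)
  fix st assume "st \<in> E"
  then obtain s t where st: "st = (s, t)" "(s, t) \<in> E"
    by (cases st) auto
  have "lattice_eval (term_lattice E X) \<rho> s = lattice_eval (term_lattice E X) \<rho> t"
    if "\<rho> \<in> UNIV \<rightarrow> carrier (term_lattice E X)" for \<rho>
  proof -
    have "\<forall>v. \<exists>t. \<rho> v = term_class E t \<and> t \<in> terms_over X"
      using that unfolding carrier_term_lattice by auto
    then obtain \<sigma> where \<sigma>: "\<And>v. \<rho> v = term_class E (\<sigma> v)" "\<And>v. \<sigma> v \<in> terms_over X"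
      by metis
    have "lattice_eval (term_lattice E X) \<rho> u = term_class E (term_subst \<sigma> u)" for u
      by (induction u) (simp_all add: \<sigma> term_lattice term_subst_over)
    then show ?thesis
      using st(2) by (simp add: term_class_eq_iff tc_identity)
  qed
  then show "case st of (s, t) \<Rightarrow> \<forall>\<rho>\<in>UNIV \<rightarrow> carrier (term_lattice E X).
      lattice_eval (term_lattice E X) \<rho> s = lattice_eval (term_lattice E X) \<rho> t"
    by (simp add: st(1))
qed

lemma bounded_lattice_homI:
  assumes "bounded_lattice L" "bounded_lattice M" "\<And>x. x \<in> carrier L \<Longrightarrow> h x \<in> carrier M"
    "\<And>x y. x \<in> carrier L \<Longrightarrow> y \<in> carrier L \<Longrightarrow> h (x \<squnion>\<^bsub>L\<^esub> y) = h x \<squnion>\<^bsub>M\<^esub> h y"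
    "\<And>x y. x \<in> carrier L \<Longrightarrow> y \<in> carrier L \<Longrightarrow> h (x \<sqinter>\<^bsub>L\<^esub> y) = h x \<sqinter>\<^bsub>M\<^esub> h y"
    "h \<bottom>\<^bsub>L\<^esub> = \<bottom>\<^bsub>M\<^esub>" "h \<top>\<^bsub>L\<^esub> = \<top>\<^bsub>M\<^esub>"
  shows "h \<in> bounded_lattice_hom L M"
  using assms
  by (auto simp: bounded_lattice_hom_def join_pres_def meet_pres_def bounded_lattice_def)

lemma bounded_lattice_homD:
  assumes "h \<in> bounded_lattice_hom L M"
  shows "x \<in> carrier L \<Longrightarrow> h x \<in> carrier M"
    "x \<in> carrier L \<Longrightarrow> y \<in> carrier L \<Longrightarrow> h (x \<squnion>\<^bsub>L\<^esub> y) = h x \<squnion>\<^bsub>M\<^esub> h y"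
    "x \<in> carrier L \<Longrightarrow> y \<in> carrier L \<Longrightarrow> h (x \<sqinter>\<^bsub>L\<^esub> y) = h x \<sqinter>\<^bsub>M\<^esub> h y"
    "h \<bottom>\<^bsub>L\<^esub> = \<bottom>\<^bsub>M\<^esub>" "h \<top>\<^bsub>L\<^esub> = \<top>\<^bsub>M\<^esub>"
  using assms
  by (auto simp: bounded_lattice_hom_def join_pres_def meet_pres_def)

lemma bounded_lattice_hom_comp:
  assumes "bounded_lattice K" "bounded_lattice L" "bounded_lattice M"
    "g \<in> bounded_lattice_hom K L" "h \<in> bounded_lattice_hom L M"
  shows "restrict (\<lambda>x. h (g x)) (carrier K) \<in> bounded_lattice_hom K M"
proof -
  interpret bounded_lattice K by fact
  show ?thesis
    by (rule bounded_lattice_homI)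
      (simp_all add: assms(1,3) bounded_lattice_homD[OF assms(4)] bounded_lattice_homD[OF assms(5)])
qed

lemma term_lattice_universal:
  fixes M :: "'m gorder"
  assumes M: "bounded_lattice M" "M \<in> lattice_variety E" and f: "f \<in> X \<rightarrow> carrier M"
  shows "\<exists>!h. h \<in> bounded_lattice_hom (term_lattice E X) M \<inter>
      extensional (carrier (term_lattice E X)) \<and> (\<forall>x\<in>X. h (term_class E (Var (Inl x))) = f x)"
proof -
  interpret M: bounded_lattice M by fact
  let ?L = "term_lattice E X"
  define \<rho> where
    "\<rho> = case_sum (\<lambda>x. if x \<in> X then f x else \<bottom>\<^bsub>M\<^esub>) (\<lambda>b. if b then \<top>\<^bsub>M\<^esub> else \<bottom>\<^bsub>M\<^esub>)"
  have \<rho>: "\<rho> v \<in> carrier M" "\<rho> (Inr False) = \<bottom>\<^bsub>M\<^esub>" "\<rho> (Inr True) = \<top>\<^bsub>M\<^esub>"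
    "x \<in> X \<Longrightarrow> \<rho> (Inl x) = f x" for v x
    using f by (auto simp: \<rho>_def split: sum.split)
  define h where
    "h = restrict (\<lambda>A. lattice_eval M \<rho> (SOME t. t \<in> A)) (carrier ?L)"
  have h: "h (term_class E t) = lattice_eval M \<rho> t" if "t \<in> terms_over X" for t
  proof -
    have "term_class E t \<in> carrier ?L"
      using that by (simp add: carrier_term_lattice)
    moreover have "(SOME s. s \<in> term_class E t) \<in> term_class E t"
      by (rule someI[of _ t]) (simp add: term_class_def tc_refl)
    then have "lattice_eval M \<rho> t = lattice_eval M \<rho> (SOME s. s \<in> term_class E t)"
      by (intro term_cong_sound[OF M \<rho>(1-3)]) (simp add: term_class_def)
    ultimately show ?thesis
      by (simp add: h_def)
  qed
  have JM: "Join s t \<in> terms_over X" "Meet s t \<in> terms_over X"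
    if "s \<in> terms_over X" "t \<in> terms_over X" for s t
    using that by (auto simp: terms_over_def)
  show ?thesis
  proof (rule ex1I[of _ h]; (elim conjE IntE)?)
    have "h \<in> bounded_lattice_hom ?L M"
    proof (rule bounded_lattice_homI)
      show "bounded_lattice ?L" "bounded_lattice M"
        by (fact term_lattice_bounds M)+
      show "h \<bottom>\<^bsub>?L\<^esub> = \<bottom>\<^bsub>M\<^esub>" "h \<top>\<^bsub>?L\<^esub> = \<top>\<^bsub>M\<^esub>"
        by (simp_all add: term_lattice_bounds h Var_terms_over \<rho>)
      show "h x \<in> carrier M" if "x \<in> carrier ?L" for x
        using that lattice_eval_closed[OF M.lattice_axioms \<rho>(1)]
        by (auto simp: carrier_term_lattice h)
      show "h (x \<squnion>\<^bsub>?L\<^esub> y) = h x \<squnion>\<^bsub>M\<^esub> h y" "h (x \<sqinter>\<^bsub>?L\<^esub> y) = h x \<sqinter>\<^bsub>M\<^esub> h y"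
        if "x \<in> carrier ?L" "y \<in> carrier ?L" for x y
        using that by (auto simp: carrier_term_lattice term_lattice h JM)
    qed
    moreover have hext: "h \<in> extensional (carrier ?L)"
      by (simp add: h_def)
    ultimately show "h \<in> bounded_lattice_hom ?L M \<inter> extensional (carrier ?L) \<and>
        (\<forall>x\<in>X. h (term_class E (Var (Inl x))) = f x)"
      by (simp add: h Var_terms_over \<rho>(4) hext)
  next
    fix k assume k: "k \<in> bounded_lattice_hom ?L M" "k \<in> extensional (carrier ?L)"
      "\<forall>x\<in>X. k (term_class E (Var (Inl x))) = f x"
    note kD = bounded_lattice_homD[OF k(1)]
    have "k (term_class E t) = lattice_eval M \<rho> t" if "t \<in> terms_over X" for t
      using that
    proof (induction t)
      case (Var v)
      then consider x where "v = Inl x" "x \<in> X" | "v = Inr False" | "v = Inr True"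
        by (auto simp: terms_over_def)
      then show ?case
        using kD(4,5) by cases (auto simp: k(3) \<rho> term_lattice_bounds)
    next
      case (Join s t)
      then have "s \<in> terms_over X" "t \<in> terms_over X"
        by (auto simp: terms_over_def)
      with Join.IH show ?case
        using kD(2)[of "term_class E s" "term_class E t"]
        by (simp add: term_lattice carrier_term_lattice)
    next
      case (Meet s t)
      then have "s \<in> terms_over X" "t \<in> terms_over X"
        by (auto simp: terms_over_def)
      with Meet.IH show ?case
        using kD(3)[of "term_class E s" "term_class E t"]
        by (simp add: term_lattice carrier_term_lattice)
    qed
    then show "k = h"
      using h by (intro extensionalityI[OF k(2), of h]) (auto simp: h_def carrier_term_lattice)
  qed
qed

theorem free_bounded_lattice_term_lattice:
  "free_bounded_lattice_wrt TYPE('m) E X (term_lattice E X) (\<lambda>x. term_class E (Var (Inl x)))"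
  unfolding free_bounded_lattice_wrt_def
  using term_lattice_bounds(1)[of E X] term_lattice_variety[of E X] Var_terms_over(2)[of _ X]
  by (intro conjI allI impI ballI term_lattice_universal) (auto simp: carrier_term_lattice)

theorem free_bounded_lattice_exists:
  "\<exists>(F :: ('x + bool) lattice_term set gorder) \<iota>. free_bounded_lattice E (X :: 'x set) F \<iota>"
  unfolding free_bounded_lattice_def using free_bounded_lattice_term_lattice by blast

lemma free_bounded_lattice_wrtD:
  fixes M :: "'m gorder"
  assumes "free_bounded_lattice_wrt TYPE('m) E X F \<iota>" "bounded_lattice M" "M \<in> lattice_variety E"
    "f \<in> X \<rightarrow> carrier M"
  shows "\<exists>h. h \<in> bounded_lattice_hom F M \<and> h \<in> extensional (carrier F) \<and> (\<forall>x\<in>X. h (\<iota> x) = f x)"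
    "\<lbrakk>h \<in> bounded_lattice_hom F M; h \<in> extensional (carrier F); \<forall>x\<in>X. h (\<iota> x) = f x;
      k \<in> bounded_lattice_hom F M; k \<in> extensional (carrier F); \<forall>x\<in>X. k (\<iota> x) = f x\<rbrakk> \<Longrightarrow> h = k"
proof -
  have "\<exists>!h. h \<in> bounded_lattice_hom F M \<inter> extensional (carrier F) \<and> (\<forall>x\<in>X. h (\<iota> x) = f x)"
    using assms unfolding free_bounded_lattice_wrt_def by blast
  then show "\<exists>h. h \<in> bounded_lattice_hom F M \<and> h \<in> extensional (carrier F) \<and> (\<forall>x\<in>X. h (\<iota> x) = f x)"
    "\<lbrakk>h \<in> bounded_lattice_hom F M; h \<in> extensional (carrier F); \<forall>x\<in>X. h (\<iota> x) = f x;
      k \<in> bounded_lattice_hom F M; k \<in> extensional (carrier F); \<forall>x\<in>X. k (\<iota> x) = f x\<rbrakk> \<Longrightarrow> h = k"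
    by blast+
qed

theorem free_bounded_lattice_any:
  fixes F :: "'f gorder" and \<iota> :: "'x \<Rightarrow> 'f"
  assumes "free_bounded_lattice E X F \<iota>"
  shows "free_bounded_lattice_wrt TYPE('m) E X F \<iota>"
proof -
  define G where "G = term_lattice E X"
  define \<gamma> where "\<gamma> x = term_class E (Var (Inl x))" for x :: 'x
  have freeF: "free_bounded_lattice_wrt TYPE('f) E X F \<iota>"
    "free_bounded_lattice_wrt TYPE(('x + bool) lattice_term set) E X F \<iota>"
    using assms by (auto simp: free_bounded_lattice_def)
  have freeG: "free_bounded_lattice_wrt TYPE('n) E X G \<gamma>"
    using free_bounded_lattice_term_lattice[of E X] by (simp add: G_def \<gamma>_def[abs_def])
  have freeG': "free_bounded_lattice_wrt TYPE('m) E X G \<gamma>" "free_bounded_lattice_wrt TYPE('f) E X G \<gamma>"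
    using free_bounded_lattice_term_lattice[of E X] by (simp_all add: G_def \<gamma>_def[abs_def])
  have F: "bounded_lattice F" "F \<in> lattice_variety E" "\<iota> \<in> X \<rightarrow> carrier F"
    using freeF(1) by (auto simp: free_bounded_lattice_wrt_def)
  have G: "bounded_lattice G" "G \<in> lattice_variety E" "\<gamma> \<in> X \<rightarrow> carrier G"
    using freeG by (auto simp: free_bounded_lattice_wrt_def)
  obtain h where h: "h \<in> bounded_lattice_hom F G" "\<forall>x\<in>X. h (\<iota> x) = \<gamma> x"
    using free_bounded_lattice_wrtD(1)[OF freeF(2) G] by blast
  obtain k where k: "k \<in> bounded_lattice_hom G F" "\<forall>x\<in>X. k (\<gamma> x) = \<iota> x"
    using free_bounded_lattice_wrtD(1)[OF freeG'(2) F] by blast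
  have id: "restrict (\<lambda>x. x) (carrier F) \<in> bounded_lattice_hom F F"
  proof -
    interpret bounded_lattice F by (rule F)
    show ?thesis by (rule bounded_lattice_homI) (simp_all add: F)
  qed
  have "restrict (\<lambda>x. k (h x)) (carrier F) = restrict (\<lambda>x. x) (carrier F)"
    by (rule free_bounded_lattice_wrtD(2)[OF freeF(1) F(1,2,3)])
      (use F(3) h(2) k(2) in
        \<open>auto simp: Pi_iff id intro!: bounded_lattice_hom_comp[OF F(1) G(1) F(1) h(1) k(1)]\<close>)
  then have kh: "k (h x) = x" if "x \<in> carrier F" for x
    using that by (metis restrict_apply')
  show ?thesis
    unfolding free_bounded_lattice_wrt_def
  proof (intro conjI F allI impI ballI; elim conjE)
    fix M :: "'m gorder" and f
    assume M: "bounded_lattice M" "M \<in> lattice_variety E" and f: "f \<in> X \<rightarrow> carrier M"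
    obtain g where g: "g \<in> bounded_lattice_hom G M" "\<forall>x\<in>X. g (\<gamma> x) = f x" "g \<in> extensional (carrier G)"
      using free_bounded_lattice_wrtD(1)[OF freeG'(1) M f] by blast
    show "\<exists>!u. u \<in> bounded_lattice_hom F M \<inter> extensional (carrier F) \<and> (\<forall>x\<in>X. u (\<iota> x) = f x)"
    proof (rule ex1I[of _ "restrict (\<lambda>x. g (h x)) (carrier F)"]; (elim conjE IntE)?)
      show "restrict (\<lambda>x. g (h x)) (carrier F) \<in> bounded_lattice_hom F M \<inter> extensional (carrier F) \<and>
          (\<forall>x\<in>X. restrict (\<lambda>x. g (h x)) (carrier F) (\<iota> x) = f x)"
        using bounded_lattice_hom_comp[OF F(1) G(1) M(1) h(1) g(1)] F(3) g(2) h(2)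
        by (auto simp: Pi_iff)
      fix u assume u: "u \<in> bounded_lattice_hom F M" "u \<in> extensional (carrier F)"
        "\<forall>x\<in>X. u (\<iota> x) = f x"
      have "restrict (\<lambda>x. u (k x)) (carrier G) = g"
        by (rule free_bounded_lattice_wrtD(2)[OF freeG'(1) M f])
          (use G(3) k(2) u(3) g in
            \<open>auto simp: Pi_iff intro!: bounded_lattice_hom_comp[OF G(1) F(1) M(1) k(1) u(1)]\<close>)
      then have "g (h x) = u x" if "x \<in> carrier F" for x
        using kh[OF that] bounded_lattice_homD(1)[OF h(1) that] by (metis restrict_apply')
      then show "u = restrict (\<lambda>x. g (h x)) (carrier F)"
        by (intro extensionalityI[OF u(2) restrict_extensional]) auto
    qed
  qed
qed

end

theory Submission
  imports Defs
begin

text \<open>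
  The two monoids differ in a property of their maximal semilattice quotients, the weak uniform
  refinement property (\<open>weak_uniform_refinement\<close>).  It starts from elements \<open>a\<^sub>i\<close>, \<open>b\<^sub>i\<close> whose sum is an
  order unit, one pair for every index \<open>i\<close>, and asks for elements \<open>c\<^sub>i\<^sub>j\<close> that lie below \<open>a\<^sub>i\<close> and \<open>b\<^sub>j\<close>,
  form an order unit together with \<open>a\<^sub>j\<close> and \<open>b\<^sub>i\<close>, and satisfy the triangle inequality
  \<open>c\<^sub>i\<^sub>k \<le> c\<^sub>i\<^sub>j + c\<^sub>j\<^sub>k\<close> up to multiples.

  For a regular ring \<open>R\<close> such elements exist over every index set
  (\<open>V_monoid_weak_uniform_refinement\<close>).  The class of a projective module is controlled by its trace
  ideal: \<open>[eR]\<close> is below \<open>[P]\<close> if the idempotent \<open>e\<close> lies in the trace ideal of \<open>P\<close>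
  (\<open>idempotent_below\<close>), and \<open>[P]\<close> is an order unit iff this ideal is \<open>R\<close>
  (\<open>order_unit_V_monoid_iff\<close>).  If \<open>1 = \<alpha>\<^sub>i + \<beta>\<^sub>i\<close> is a decomposition along the trace ideals of the two
  given modules, then the products \<open>\<alpha>\<^sub>i \<beta>\<^sub>j\<close> generate ideals with all the required properties, and
  regularity makes them trace ideals of modules \<open>eR\<close>.

  For the free bounded lattice \<open>F\<close> the property fails over \<open>X\<close> (\<open>not_weak_uniform_refinement\<close>).  Two
  generators per index give elements \<open>s\<^sub>l \<sqsubseteq> t\<^sub>l\<close>, and \<open>\<Delta>(0, s\<^sub>l) + \<Delta>(t\<^sub>l, 1)\<close> and \<open>\<Delta>(s\<^sub>l, t\<^sub>l)\<close> sum up to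
  \<open>\<Delta>(0, 1)\<close>.  Suppose that there are \<open>c\<^sub>i\<^sub>j\<close> for these.  Each involves finitely many generators, so the
  free set theorem (\<open>free_triple\<close>), which is where \<open>\<aleph>\<^sub>2\<close> enters, provides indices \<open>i\<close>, \<open>j\<close>, \<open>k\<close> such that
  \<open>c\<^sub>i\<^sub>j\<close>, \<open>c\<^sub>j\<^sub>k\<close>, \<open>c\<^sub>i\<^sub>k\<close> do not depend on the generators of the index that is missing.  A
  non-distributive variety contains a bounded lattice \<open>M\<close> with an element \<open>y\<close> that has two distinct
  complements \<open>x\<close>, \<open>z\<close> (\<open>nondistributive_interval\<close>), say with \<open>z\<close> not below \<open>x\<close>.  Map \<open>F\<close> to \<open>M\<close> so that
  the pairs \<open>(s, t)\<close> of \<open>i\<close>, \<open>j\<close>, \<open>k\<close> become \<open>(0, x)\<close>, \<open>(y, 1)\<close>, \<open>(0, z)\<close>.  Any two of these pairs generate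
  a distributive sublattice, and there homomorphisms to the two-element chain decide what happens
  to the \<open>c\<close>: the congruences on \<open>M\<close> that correspond to \<open>c\<^sub>i\<^sub>j\<close> and \<open>c\<^sub>j\<^sub>k\<close> are trivial, the one that
  corresponds to \<open>c\<^sub>i\<^sub>k\<close> is not.  So the triangle inequality fails.
\<close>

section \<open>Refinement in commutative monoids\<close>

text \<open>
  The preorder of the maximal semilattice quotient: two elements are \<open>below\<close> each other iff
  every additive map to a \<open>\<or>\<close>-semilattice with zero identifies them.  Working with the preorder
  avoids forming that quotient, which is \<open>Con\<^sub>c F\<close> for \<open>Dim F\<close> and the semilattice of finitely
  generated two-sided ideals for \<open>V(R)\<close> with \<open>R\<close> regular.
\<close>

definition below :: "('a, 'b) monoid_scheme \<Rightarrow> 'a \<Rightarrow> 'a \<Rightarrow> bool" where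
  "below G u v \<longleftrightarrow> (\<exists>n::nat. \<exists>z\<in>carrier G. u \<otimes>\<^bsub>G\<^esub> z = v [^]\<^bsub>G\<^esub> n)"

lemma belowI: "\<lbrakk>z \<in> carrier G; u \<otimes>\<^bsub>G\<^esub> z = v [^]\<^bsub>G\<^esub> (n::nat)\<rbrakk> \<Longrightarrow> below G u v"
  by (auto simp: below_def)

lemma below_trans:
  assumes "comm_monoid G" "u \<in> carrier G" "v \<in> carrier G" "w \<in> carrier G"
    and "below G u v" "below G v w"
  shows "below G u w"
proof -
  interpret comm_monoid G by fact
  obtain n y where y: "y \<in> carrier G" "u \<otimes>\<^bsub>G\<^esub> y = v [^]\<^bsub>G\<^esub> (n::nat)"
    using assms(5) by (auto simp: below_def)
  obtain m z where z: "z \<in> carrier G" "v \<otimes>\<^bsub>G\<^esub> z = w [^]\<^bsub>G\<^esub> (m::nat)"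
    using assms(6) by (auto simp: below_def)
  have "u \<otimes>\<^bsub>G\<^esub> (y \<otimes>\<^bsub>G\<^esub> z [^]\<^bsub>G\<^esub> n) = (v \<otimes>\<^bsub>G\<^esub> z) [^]\<^bsub>G\<^esub> n"
    using y z(1) assms(2,3) by (simp add: pow_mult_distrib m_comm flip: m_assoc)
  also have "\<dots> = w [^]\<^bsub>G\<^esub> (m * n)"
    using z assms(4) by (simp add: nat_pow_pow)
  finally show ?thesis
    using y z by (intro belowI) auto
qed

text \<open>
  The unit of the target has a preimage, so the image of the unit acts trivially on it.
\<close>

lemma iso_one:
  assumes "monoid G" "monoid H" "\<phi> \<in> iso G H"
  shows "\<phi> \<one>\<^bsub>G\<^esub> = \<one>\<^bsub>H\<^esub>"
proof -
  interpret G: monoid G by fact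
  interpret H: monoid H by fact
  have hom: "\<phi> \<in> hom G H" and bij: "bij_betw \<phi> (carrier G) (carrier H)"
    using assms(3) by (auto simp: iso_def)
  obtain w where w: "w \<in> carrier G" "\<phi> w = \<one>\<^bsub>H\<^esub>"
    using bij H.one_closed by (metis bij_betw_def imageE)
  have "\<phi> \<one>\<^bsub>G\<^esub> \<in> carrier H"
    using hom by (auto simp: hom_def)
  then have "\<phi> \<one>\<^bsub>G\<^esub> = \<phi> \<one>\<^bsub>G\<^esub> \<otimes>\<^bsub>H\<^esub> \<phi> w"
    using w by simp
  also have "\<dots> = \<phi> (\<one>\<^bsub>G\<^esub> \<otimes>\<^bsub>G\<^esub> w)"
    using w hom_mult[OF hom, of "\<one>\<^bsub>G\<^esub>" w] by simp
  finally show ?thesis using w by simp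
qed

lemma below_iso:
  assumes "monoid G" "monoid H" "\<phi> \<in> iso G H" "u \<in> carrier G" "v \<in> carrier G" "below G u v"
  shows "below H (\<phi> u) (\<phi> v)"
proof -
  interpret G: monoid G by fact
  interpret H: monoid H by fact
  have hom: "\<phi> \<in> hom G H"
    using assms(3) by (auto simp: iso_def)
  have pow: "\<phi> (v [^]\<^bsub>G\<^esub> n) = \<phi> v [^]\<^bsub>H\<^esub> n" for n :: nat
    by (induction n) (simp_all add: iso_one[OF assms(1-3)] hom_mult[OF hom] assms(5))
  obtain n z where z: "z \<in> carrier G" "u \<otimes>\<^bsub>G\<^esub> z = v [^]\<^bsub>G\<^esub> (n::nat)"
    using assms(6) by (auto simp: below_def)
  have "\<phi> u \<otimes>\<^bsub>H\<^esub> \<phi> z = \<phi> v [^]\<^bsub>H\<^esub> n"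
    unfolding pow[symmetric] z(2)[symmetric] using hom_mult[OF hom assms(4) z(1)] by simp
  moreover have "\<phi> z \<in> carrier H"
    using hom z(1) by (auto simp: hom_def)
  ultimately show ?thesis by (intro belowI)
qed

text \<open>
  In the maximal semilattice quotient, the order units form the largest class.  Hence an
  isomorphism of monoids respects the notion although it need not respect a chosen unit: nothing
  forces \<open>[R]\<close> to correspond to \<open>\<Delta>(0, 1)\<close>.
\<close>

definition order_unit :: "('a, 'b) monoid_scheme \<Rightarrow> 'a \<Rightarrow> bool" where
  "order_unit G v \<longleftrightarrow> v \<in> carrier G \<and> (\<forall>w\<in>carrier G. below G w v)"

text \<open>
  The entry \<open>c i j\<close> is to be thought of as the amount by which \<open>a i\<close> fails to be contained in
  \<open>a j\<close>, computed inside the common part of \<open>a i\<close> and \<open>b j\<close>; the last condition is the triangle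
  inequality for this failure.
\<close>

definition refinement_matrix ::
    "('a, 'b) monoid_scheme \<Rightarrow> 'i set \<Rightarrow> ('i \<Rightarrow> 'a) \<Rightarrow> ('i \<Rightarrow> 'a) \<Rightarrow> ('i \<Rightarrow> 'i \<Rightarrow> 'a) \<Rightarrow> bool" where
  "refinement_matrix G I a b c \<longleftrightarrow>
     (\<forall>i\<in>I. \<forall>j\<in>I. c i j \<in> carrier G \<and> below G (c i j) (a i) \<and> below G (c i j) (b j) \<and>
        order_unit G (c i j \<otimes>\<^bsub>G\<^esub> (a j \<otimes>\<^bsub>G\<^esub> b i)) \<and>
        (\<forall>k\<in>I. below G (c i k) (c i j \<otimes>\<^bsub>G\<^esub> c j k)))"

lemma refinement_matrixI:
  assumes "\<And>i j. \<lbrakk>i \<in> I; j \<in> I\<rbrakk> \<Longrightarrow> c i j \<in> carrier G"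
    and "\<And>i j. \<lbrakk>i \<in> I; j \<in> I\<rbrakk> \<Longrightarrow> below G (c i j) (a i)"
    and "\<And>i j. \<lbrakk>i \<in> I; j \<in> I\<rbrakk> \<Longrightarrow> below G (c i j) (b j)"
    and "\<And>i j. \<lbrakk>i \<in> I; j \<in> I\<rbrakk> \<Longrightarrow> order_unit G (c i j \<otimes>\<^bsub>G\<^esub> (a j \<otimes>\<^bsub>G\<^esub> b i))"
    and "\<And>i j k. \<lbrakk>i \<in> I; j \<in> I; k \<in> I\<rbrakk> \<Longrightarrow> below G (c i k) (c i j \<otimes>\<^bsub>G\<^esub> c j k)"
  shows "refinement_matrix G I a b c"
  using assms by (simp add: refinement_matrix_def)

lemma refinement_matrixD:
  assumes "refinement_matrix G I a b c" "i \<in> I" "j \<in> I"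
  shows "c i j \<in> carrier G" "below G (c i j) (a i)" "below G (c i j) (b j)"
    "order_unit G (c i j \<otimes>\<^bsub>G\<^esub> (a j \<otimes>\<^bsub>G\<^esub> b i))"
    "k \<in> I \<Longrightarrow> below G (c i k) (c i j \<otimes>\<^bsub>G\<^esub> c j k)"
  using assms by (simp_all add: refinement_matrix_def)

text \<open>
  The weak uniform refinement property at the largest element of the maximal semilattice
  quotient.  It is the triangle inequality, which ties together the choices of the \<open>c i j\<close> for all
  pairs of indices, that makes the property sensitive to the size of \<open>I\<close>.
\<close>

definition weak_uniform_refinement :: "('a, 'b) monoid_scheme \<Rightarrow> 'i set \<Rightarrow> bool" where
  "weak_uniform_refinement G I \<longleftrightarrow>
     (\<forall>a b. (\<forall>i\<in>I. a i \<in> carrier G \<and> b i \<in> carrier G \<and> order_unit G (a i \<otimes>\<^bsub>G\<^esub> b i)) \<longrightarrow>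
       (\<exists>c. refinement_matrix G I a b c))"

lemma order_unit_iso:
  assumes "monoid G" "monoid H" "\<phi> \<in> iso G H" "order_unit G v"
  shows "order_unit H (\<phi> v)"
proof -
  have bij: "\<phi> ` carrier G = carrier H"
    using assms(3) by (auto simp: iso_def bij_betw_def)
  have v: "v \<in> carrier G" "\<And>w. w \<in> carrier G \<Longrightarrow> below G w v"
    using assms(4) by (auto simp: order_unit_def)
  have "below H w (\<phi> v)" if w: "w \<in> carrier H" for w
  proof -
    obtain w' where "w' \<in> carrier G" "w = \<phi> w'"
      using w bij by blast
    then show ?thesis
      using below_iso[OF assms(1-3) _ v(1)] v(2) by blast
  qed
  moreover have "\<phi> v \<in> carrier H"
    using v(1) bij by blast
  ultimately show ?thesis
    by (simp add: order_unit_def)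
qed

lemma weak_uniform_refinement_iso:
  assumes G: "monoid G" and H: "monoid H" and iso: "G \<cong> H" and WG: "weak_uniform_refinement G I"
  shows "weak_uniform_refinement H I"
  unfolding weak_uniform_refinement_def
proof (intro allI impI)
  interpret G: monoid G by fact
  interpret H: monoid H by fact
  obtain \<phi> where \<phi>: "\<phi> \<in> iso G H"
    using iso by (auto simp: is_iso_def)
  define \<psi> where "\<psi> = inv_into (carrier G) \<phi>"
  have \<phi>h: "\<phi> \<in> hom G H" and bij: "bij_betw \<phi> (carrier G) (carrier H)"
    using \<phi> by (auto simp: iso_def)
  have \<psi>: "\<psi> \<in> iso H G"
    unfolding iso_def
  proof (intro CollectI conjI homI)
    show bij': "bij_betw \<psi> (carrier H) (carrier G)"
      unfolding \<psi>_def by (rule bij_betw_inv_into[OF bij])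
    fix x y assume "x \<in> carrier H" "y \<in> carrier H"
    then obtain x' y' where "x = \<phi> x'" "y = \<phi> y'" "x' \<in> carrier G" "y' \<in> carrier G"
      using bij unfolding bij_betw_def by blast
    moreover from this have "\<phi> x' \<otimes>\<^bsub>H\<^esub> \<phi> y' = \<phi> (x' \<otimes>\<^bsub>G\<^esub> y')"
      by (simp add: hom_mult[OF \<phi>h])
    ultimately show "\<psi> (x \<otimes>\<^bsub>H\<^esub> y) = \<psi> x \<otimes>\<^bsub>G\<^esub> \<psi> y"
      using bij by (simp add: \<psi>_def bij_betw_inv_into_left[OF bij])
  qed (auto simp: \<psi>_def bij_betwE[OF bij_betw_inv_into[OF bij]])
  then have \<psi>h: "\<psi> \<in> hom H G"
    by (simp add: iso_def)
  have \<phi>\<psi>: "\<phi> (\<psi> x) = x" if "x \<in> carrier H" for x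
    unfolding \<psi>_def using that bij by (intro f_inv_into_f) (simp add: bij_betw_def)
  have cl: "x \<in> carrier G \<Longrightarrow> \<phi> x \<in> carrier H" "y \<in> carrier H \<Longrightarrow> \<psi> y \<in> carrier G" for x y
    using \<phi>h \<psi>h by (auto simp: hom_def)
  note mult = hom_mult[OF \<phi>h] hom_mult[OF \<psi>h]
  note bel = below_iso[OF G H \<phi>]
  note unit = order_unit_iso[OF G H \<phi>] order_unit_iso[OF H G \<psi>]
  fix a b
  assume ab: "\<forall>i\<in>I. a i \<in> carrier H \<and> b i \<in> carrier H \<and> order_unit H (a i \<otimes>\<^bsub>H\<^esub> b i)"
  have "\<forall>i\<in>I. \<psi> (a i) \<in> carrier G \<and> \<psi> (b i) \<in> carrier G \<and> order_unit G (\<psi> (a i) \<otimes>\<^bsub>G\<^esub> \<psi> (b i))"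
    using ab cl(2) unit(2) by (simp flip: mult(2))
  from WG[unfolded weak_uniform_refinement_def, THEN spec, THEN spec, THEN mp,
      of "\<lambda>i. \<psi> (a i)" "\<lambda>i. \<psi> (b i)", OF this]
  obtain c where "refinement_matrix G I (\<lambda>i. \<psi> (a i)) (\<lambda>i. \<psi> (b i)) c" ..
  note c = refinement_matrixD[OF this]
  have abc: "a i \<in> carrier H" "b i \<in> carrier H" if "i \<in> I" for i
    using ab that by blast+
  have "refinement_matrix H I a b (\<lambda>i j. \<phi> (c i j))"
  proof (rule refinement_matrixI)
    fix i j assume ij: "i \<in> I" "j \<in> I"
    show "\<phi> (c i j) \<in> carrier H"
      by (rule cl(1)[OF c(1)[OF ij]])
    show "below H (\<phi> (c i j)) (a i)"
      using bel[OF c(1)[OF ij] cl(2)[OF abc(1)[OF ij(1)]] c(2)[OF ij]] \<phi>\<psi>[OF abc(1)[OF ij(1)]] by simp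
    show "below H (\<phi> (c i j)) (b j)"
      using bel[OF c(1)[OF ij] cl(2)[OF abc(2)[OF ij(2)]] c(3)[OF ij]] \<phi>\<psi>[OF abc(2)[OF ij(2)]] by simp
    show "order_unit H (\<phi> (c i j) \<otimes>\<^bsub>H\<^esub> (a j \<otimes>\<^bsub>H\<^esub> b i))"
      using unit(1)[OF c(4)[OF ij]] abc ij cl(2) c(1)[OF ij] by (simp add: mult(1) \<phi>\<psi>)
    show "below H (\<phi> (c i k)) (\<phi> (c i j) \<otimes>\<^bsub>H\<^esub> \<phi> (c j k))" if "k \<in> I" for k
      using bel[OF c(1)[OF ij(1) that] G.m_closed[OF c(1)[OF ij] c(1)[OF ij(2) that]] c(5)[OF ij that]]
        c(1)[OF ij] c(1)[OF ij(2) that] by (simp add: mult(1))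
  qed
  then show "\<exists>c. refinement_matrix H I a b c"
    by (rule exI[of _ "\<lambda>i j. \<phi> (c i j)"])
qed

section \<open>Retracts of finitely generated projective modules\<close>

lemma right_module_submodule:
  assumes "right_module R M" "submodule H R M"
  shows "right_module R (M\<lparr>carrier := H\<rparr>)"
proof -
  interpret M: right_module R M by fact
  note H = right_submodule_simps[OF assms(2)]
  have Hc: "x \<in> carrier M" if "x \<in> H" for x using H(1) that by blast
  have "abelian_group (M\<lparr>carrier := H\<rparr>)"
  proof (rule abelian_groupI)
    fix x assume "x \<in> carrier (M\<lparr>carrier := H\<rparr>)"
    then have x: "x \<in> H" by simp
    have "(\<ominus>\<^bsub>R\<^esub> \<one>\<^bsub>R\<^esub>) \<odot>\<^bsub>M\<^esub> x \<in> H"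
      using x by (intro H(4)) auto
    then have "\<ominus>\<^bsub>M\<^esub> x \<in> H"
      using M.uminus_smult Hc x by simp
    then show "\<exists>y\<in>carrier (M\<lparr>carrier := H\<rparr>). y \<oplus>\<^bsub>M\<lparr>carrier := H\<rparr>\<^esub> x = \<zero>\<^bsub>M\<lparr>carrier := H\<rparr>\<^esub>"
      using x Hc M.M.l_neg by (intro bexI[of _ "\<ominus>\<^bsub>M\<^esub> x"]) auto
  qed (use H Hc in \<open>simp_all add: M.M.a_ac\<close>)
  then show ?thesis
    by (intro right_module.intro right_module_axioms.intro M.R.ring_axioms)
      (use H Hc in \<open>simp_all add: M.smult_add_scalar M.smult_add M.smult_assoc\<close>)
qed

lemma fg_projective_retract:
  fixes R :: "'r ring" and P :: "('r, 'p) module" and Q :: "('r, 'q) module"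
  assumes "fg_projective R P" "right_module R Q"
    and "f \<in> right_module_hom R P Q" "g \<in> right_module_hom R Q P"
    and "\<And>x. x \<in> carrier Q \<Longrightarrow> f (g x) = x"
  shows "fg_projective R Q"
proof -
  have P: "right_module R P" "finitely_generated R P" "ring R"
    using assms(1) by (auto simp: fg_projective_def right_module_def)
  obtain n \<pi> s where \<pi>s: "\<pi> \<in> right_module_hom R (free_module R n) P"
    "s \<in> right_module_hom R P (free_module R n)" "\<And>x. x \<in> carrier P \<Longrightarrow> \<pi> (s x) = x"
    using fg_projective_splitE[OF assms(1)] by metis
  have "f ` carrier P = carrier Q"
  proof
    show "f ` carrier P \<subseteq> carrier Q"
      using right_module_homD(1)[OF assms(3)] by blast
    show "carrier Q \<subseteq> f ` carrier P"
      using right_module_homD(1)[OF assms(4)] assms(5) by (metis imageI subsetI)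
  qed
  then have "finitely_generated R Q"
    using finitely_generated_image P assms(2,3) by blast
  moreover have "projective_wrt TYPE(nat \<Rightarrow> 'r) R Q"
    by (rule split_imp_projective[OF P(3) right_module_hom_comp[OF \<pi>s(1) assms(3)]
          right_module_hom_comp[OF assms(4) \<pi>s(2)]])
      (simp add: \<pi>s(3) right_module_homD(1)[OF assms(4)] assms(5))
  ultimately show ?thesis
    using assms(2) by (simp add: fg_projective_def)
qed

text \<open>
  The complement is the kernel of the retraction \<open>f\<close>; it is again a retract of \<open>P\<close>, by
  \<open>u \<mapsto> u - g (f u)\<close>, and therefore projective.
\<close>

lemma retract_complement:
  fixes R :: "'r ring" and P :: "('r, 'p) module" and Q :: "('r, 'q) module"
  assumes "fg_projective R P" "right_module R Q"
    and "f \<in> right_module_hom R P Q" "g \<in> right_module_hom R Q P"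
    and fg: "\<And>x. x \<in> carrier Q \<Longrightarrow> f (g x) = x"
  obtains K :: "('r, 'p) module" where "fg_projective R K" "right_module_iso R P (direct_sum Q K)"
proof -
  have P: "right_module R P"
    using assms(1) by (auto simp: fg_projective_def right_module_def)
  interpret P: right_module R P by fact
  interpret Q: right_module R Q by fact
  note fD = right_module_homD[OF assms(3)] and gD = right_module_homD[OF assms(4)]
  define H where "H = {u \<in> carrier P. f u \<in> {\<zero>\<^bsub>Q\<^esub>}}"
  have H: "submodule H R P"
    unfolding H_def
    by (rule right_module_hom_vimage_submodule[OF P assms(2,3)], rule Q.right_submoduleI) auto
  define K where "K = P\<lparr>carrier := H\<rparr>"
  have K: "right_module R K"
    unfolding K_def by (rule right_module_submodule[OF P H])
  have finv: "f (\<ominus>\<^bsub>P\<^esub> x) = \<ominus>\<^bsub>Q\<^esub> f x" if "x \<in> carrier P" for x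
    using that fD by (simp flip: P.uminus_smult Q.uminus_smult)
  have smult_minus: "a \<odot>\<^bsub>P\<^esub> (\<ominus>\<^bsub>P\<^esub> x) = \<ominus>\<^bsub>P\<^esub> (a \<odot>\<^bsub>P\<^esub> x)" if "x \<in> carrier P" "a \<in> carrier R" for a x
  proof -
    have "a \<odot>\<^bsub>P\<^esub> (\<ominus>\<^bsub>P\<^esub> x) \<oplus>\<^bsub>P\<^esub> a \<odot>\<^bsub>P\<^esub> x = \<zero>\<^bsub>P\<^esub>"
      using that by (simp flip: P.smult_add add: P.M.l_neg)
    then show ?thesis using that by (metis P.M.minus_equality P.smult_closed P.M.a_inv_closed)
  qed
  \<comment> \<open>The projection onto the kernel \<open>K\<close> along the image of \<open>g\<close>.\<close>
  define r where "r u = u \<oplus>\<^bsub>P\<^esub> \<ominus>\<^bsub>P\<^esub> g (f u)" for u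
  have r: "r \<in> right_module_hom R P K"
  proof (rule right_module_homI)
    show "r x \<in> carrier K" if "x \<in> carrier P" for x
      using that fD gD by (simp add: r_def K_def H_def finv fg Q.M.r_neg)
    show "r (x \<oplus>\<^bsub>P\<^esub> y) = r x \<oplus>\<^bsub>K\<^esub> r y" if "x \<in> carrier P" "y \<in> carrier P" for x y
      using that fD gD by (simp add: r_def K_def P.M.minus_add P.M.a_ac)
    show "r (a \<odot>\<^bsub>P\<^esub> x) = a \<odot>\<^bsub>K\<^esub> r x" if "a \<in> carrier R" "x \<in> carrier P" for a x
      using that fD gD by (simp add: r_def K_def P.smult_add smult_minus)
  qed
  have rK: "r u = u" if "u \<in> carrier K" for u
    using that right_module_hom_zero[OF assms(2) P assms(4)] by (auto simp: r_def K_def H_def)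
  have "fg_projective R K"
    by (rule fg_projective_retract[OF assms(1) K r _ rK])
      (auto simp: right_module_hom_def K_def H_def)
  moreover have "right_module_iso R P (direct_sum Q K)"
    unfolding right_module_iso_def
  proof (intro bexI[of _ "\<lambda>u. (f u, r u)"])
    show "(\<lambda>u. (f u, r u)) \<in> right_module_hom R P (direct_sum Q K)"
      by (rule right_module_homI) (simp_all add: direct_sum_def fD right_module_homD[OF r])
    show "bij_betw (\<lambda>u. (f u, r u)) (carrier P) (carrier (direct_sum Q K))"
    proof (rule bij_betwI[of _ _ _ "\<lambda>(q, k). g q \<oplus>\<^bsub>P\<^esub> k"])
      show "(\<lambda>u. (f u, r u)) \<in> carrier P \<rightarrow> carrier (direct_sum Q K)"
        by (simp add: direct_sum_def fD right_module_homD[OF r])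
      show "(\<lambda>(q, k). g q \<oplus>\<^bsub>P\<^esub> k) \<in> carrier (direct_sum Q K) \<rightarrow> carrier P"
        by (auto simp: direct_sum_def gD K_def H_def)
      show "(\<lambda>(q, k). g q \<oplus>\<^bsub>P\<^esub> k) (f u, r u) = u" if "u \<in> carrier P" for u
        using that fD gD by (simp add: r_def P.M.a_lcomm P.M.r_neg)
      fix y assume "y \<in> carrier (direct_sum Q K)"
      then obtain q k where y: "y = (q, k)" "q \<in> carrier Q" "k \<in> carrier P" "f k = \<zero>\<^bsub>Q\<^esub>"
        by (auto simp: direct_sum_def K_def H_def)
      have "g q \<oplus>\<^bsub>P\<^esub> k \<oplus>\<^bsub>P\<^esub> \<ominus>\<^bsub>P\<^esub> g q = k"
        using y gD by (metis P.M.a_comm P.M.r_neg1 P.M.add.m_closed P.M.a_inv_closed)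
      then show "(f ((\<lambda>(q, k). g q \<oplus>\<^bsub>P\<^esub> k) y), r ((\<lambda>(q, k). g q \<oplus>\<^bsub>P\<^esub> k) y)) = y"
        using y fD gD by (simp add: r_def fg)
    qed
  qed
  ultimately show thesis by (rule that)
qed

definition ring_module :: "'r ring \<Rightarrow> ('r, 'r) module" where
  "ring_module R =
     \<lparr>carrier = carrier R,
      monoid.mult = undefined,
      one = undefined,
      zero = \<zero>\<^bsub>R\<^esub>,
      add = add R,
      smult = (\<lambda>a x. x \<otimes>\<^bsub>R\<^esub> a)\<rparr>"

lemma ring_module_simps [simp]:
  "carrier (ring_module R) = carrier R" "\<zero>\<^bsub>ring_module R\<^esub> = \<zero>\<^bsub>R\<^esub>"
  "x \<oplus>\<^bsub>ring_module R\<^esub> y = x \<oplus>\<^bsub>R\<^esub> y" "a \<odot>\<^bsub>ring_module R\<^esub> x = x \<otimes>\<^bsub>R\<^esub> a"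
  by (simp_all add: ring_module_def)

text \<open>
  For an idempotent \<open>e\<close> this is the right ideal \<open>eR\<close>, described by its fixed points; \<open>e = 1\<close> gives
  the ring as a right module over itself.
\<close>

definition idempotent_module :: "'r ring \<Rightarrow> 'r \<Rightarrow> ('r, 'r) module" where
  "idempotent_module R e = (ring_module R)\<lparr>carrier := {x \<in> carrier R. e \<otimes>\<^bsub>R\<^esub> x = x}\<rparr>"

lemma idempotent_module_simps [simp]:
  "carrier (idempotent_module R e) = {x \<in> carrier R. e \<otimes>\<^bsub>R\<^esub> x = x}"
  "\<zero>\<^bsub>idempotent_module R e\<^esub> = \<zero>\<^bsub>R\<^esub>"
  "x \<oplus>\<^bsub>idempotent_module R e\<^esub> y = x \<oplus>\<^bsub>R\<^esub> y" "a \<odot>\<^bsub>idempotent_module R e\<^esub> x = x \<otimes>\<^bsub>R\<^esub> a"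
  by (simp_all add: idempotent_module_def ring_module_def)

lemma right_module_ring_module:
  assumes "ring R"
  shows "right_module R (ring_module R)"
proof -
  interpret R: ring R by fact
  have "abelian_group (ring_module R)"
    by (rule abelian_groupI) (auto simp: R.a_ac intro!: bexI[of _ "\<ominus>\<^bsub>R\<^esub> x" for x] R.l_neg)
  then show ?thesis
    by (intro right_module.intro right_module_axioms.intro assms)
      (simp_all add: R.l_distr R.r_distr R.m_assoc)
qed

lemma right_module_idempotent_module:
  assumes "ring R" "e \<in> carrier R"
  shows "right_module R (idempotent_module R e)"
proof -
  interpret R: ring R by fact
  interpret M: right_module R "ring_module R" by (rule right_module_ring_module) fact
  have "submodule {x \<in> carrier R. e \<otimes>\<^bsub>R\<^esub> x = x} R (ring_module R)"
    by (rule M.right_submoduleI) (use assms(2) in \<open>auto simp: R.r_distr simp flip: R.m_assoc\<close>)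
  then show ?thesis
    unfolding idempotent_module_def by (rule right_module_submodule[OF M.right_module_axioms])
qed

lemma fg_projective_free_module:
  assumes "ring R"
  shows "fg_projective R (free_module R n)"
proof -
  have "(\<lambda>x. x) \<in> right_module_hom R (free_module R n) (free_module R n)"
    by (simp add: right_module_hom_def)
  from split_imp_projective[OF assms this this] show ?thesis
    using right_module_free_module[OF assms] finitely_generated_free_module[OF assms]
    by (simp add: fg_projective_def)
qed

lemma fg_projective_idempotent_module:
  assumes "ring R" "e \<in> carrier R" "e \<otimes>\<^bsub>R\<^esub> e = e"
  shows "fg_projective R (idempotent_module R e)"
proof (rule fg_projective_retract[OF fg_projective_free_module[OF assms(1), of 1]])
  interpret R: ring R by fact
  show "right_module R (idempotent_module R e)"
    by (rule right_module_idempotent_module) fact+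
  show "(\<lambda>c. e \<otimes>\<^bsub>R\<^esub> c 0) \<in> right_module_hom R (free_module R 1) (idempotent_module R e)"
    using assms(2,3)
    by (intro right_module_homI)
      (auto simp: free_module_def PiE_iff R.r_distr simp flip: R.m_assoc)
  show "(\<lambda>r. \<lambda>i\<in>{..<1}. r) \<in> right_module_hom R (idempotent_module R e) (free_module R 1)"
    by (intro right_module_homI) (auto simp: free_module_def)
qed simp

section \<open>Trace ideals\<close>

text \<open>
  The sums of values of linear forms on \<open>P\<close>.  The inductive form with one summand per step is the
  one that the construction of a splitting in \<open>idempotent_below\<close> follows.
\<close>

inductive_set trace_ideal :: "'r ring \<Rightarrow> ('r, 'p) module \<Rightarrow> 'r set" for R P where
  trace_zero: "\<zero>\<^bsub>R\<^esub> \<in> trace_ideal R P"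
| trace_step: "\<lbrakk>x \<in> trace_ideal R P; f \<in> right_module_hom R P (ring_module R); p \<in> carrier P\<rbrakk> \<Longrightarrow>
    x \<oplus>\<^bsub>R\<^esub> f p \<in> trace_ideal R P"

lemma trace_ideal_closed:
  assumes "ring R" "x \<in> trace_ideal R P"
  shows "x \<in> carrier R"
proof -
  interpret ring R by fact
  show ?thesis
    using assms(2) by induction (use right_module_homD(1) in fastforce)+
qed

lemma trace_ideal_value:
  assumes "ring R" "f \<in> right_module_hom R P (ring_module R)" "p \<in> carrier P"
  shows "f p \<in> trace_ideal R P"
proof -
  interpret ring R by fact
  show ?thesis
    using trace_step[OF trace_zero assms(2,3)] right_module_homD(1)[OF assms(2,3)] by simp
qed

lemma trace_ideal_add:
  assumes "ring R" "x \<in> trace_ideal R P" "y \<in> trace_ideal R P"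
  shows "x \<oplus>\<^bsub>R\<^esub> y \<in> trace_ideal R P"
proof -
  interpret ring R by fact
  note closed = trace_ideal_closed[OF assms(1)]
  show ?thesis
    using assms(3)
  proof induction
    case (trace_step y f p)
    have "x \<oplus>\<^bsub>R\<^esub> (y \<oplus>\<^bsub>R\<^esub> f p) = (x \<oplus>\<^bsub>R\<^esub> y) \<oplus>\<^bsub>R\<^esub> f p"
      using closed[OF assms(2)] closed[OF trace_step(1)] right_module_homD(1)[OF trace_step(2,3)]
      by (simp add: a_assoc)
    with trace_step show ?case by (simp add: trace_ideal.trace_step)
  qed (use closed[OF assms(2)] assms(2) in simp)
qed

text \<open>
  A left multiple of a linear form is a linear form, and a value multiplied on the right is the
  value at a multiple: this makes the trace a two-sided ideal.
\<close>

lemma trace_ideal_mult: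
  assumes "right_module R P" "x \<in> trace_ideal R P" "r \<in> carrier R"
  shows "r \<otimes>\<^bsub>R\<^esub> x \<in> trace_ideal R P" "x \<otimes>\<^bsub>R\<^esub> r \<in> trace_ideal R P"
proof -
  interpret right_module R P by fact
  have R: "ring R" ..
  note closed = trace_ideal_closed[OF R]
  show "r \<otimes>\<^bsub>R\<^esub> x \<in> trace_ideal R P"
    using assms(2)
  proof induction
    case (trace_step x f p)
    note fD = right_module_homD[OF trace_step(2)]
    have "(\<lambda>p. r \<otimes>\<^bsub>R\<^esub> f p) \<in> right_module_hom R P (ring_module R)"
      using fD assms(3) by (intro right_module_homI) (simp_all add: R.r_distr R.m_assoc)
    from trace_ideal.trace_step[OF trace_step(4) this trace_step(3)] show ?case
      using closed[OF trace_step(1)] fD(1)[OF trace_step(3)] assms(3) by (simp add: R.r_distr)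
  qed (use assms(3) in \<open>simp add: trace_zero\<close>)
  show "x \<otimes>\<^bsub>R\<^esub> r \<in> trace_ideal R P"
    using assms(2)
  proof induction
    case (trace_step x f p)
    note fD = right_module_homD[OF trace_step(2)]
    have "r \<odot>\<^bsub>P\<^esub> p \<in> carrier P"
      using trace_step(3) assms(3) by simp
    from trace_ideal.trace_step[OF trace_step(4,2) this] show ?case
      using closed[OF trace_step(1)] fD trace_step(3) assms(3) by (simp add: R.l_distr)
  qed (use assms(3) in \<open>simp add: trace_zero\<close>)
qed

lemma trace_ideal_mono:
  assumes "g \<in> right_module_hom R P Q" "g ` carrier P = carrier Q" "x \<in> trace_ideal R Q"
  shows "x \<in> trace_ideal R P"
  using assms(3)
proof induction
  case (trace_step x f q)
  obtain p where p: "p \<in> carrier P" "q = g p"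
    using trace_step(3) assms(2) by blast
  show ?case
    using trace_ideal.trace_step[OF trace_step(4) right_module_hom_comp[OF assms(1) trace_step(2)] p(1)]
    by (simp add: p(2))
qed (rule trace_zero)

lemma trace_ideal_iso:
  assumes "right_module_iso R P Q" "x \<in> trace_ideal R Q"
  shows "x \<in> trace_ideal R P"
  using assms trace_ideal_mono by (fastforce simp: right_module_iso_def bij_betw_def)

lemma trace_ideal_direct_summand:
  assumes "right_module R A" "right_module R B"
  shows "x \<in> trace_ideal R A \<Longrightarrow> x \<in> trace_ideal R (direct_sum A B)"
    "x \<in> trace_ideal R B \<Longrightarrow> x \<in> trace_ideal R (direct_sum A B)"
proof -
  interpret A: right_module R A by fact
  interpret B: right_module R B by fact
  have homs: "fst \<in> right_module_hom R (direct_sum A B) A" "snd \<in> right_module_hom R (direct_sum A B) B"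
    by (auto simp: right_module_hom_def direct_sum_def)
  have "fst ` carrier (direct_sum A B) = carrier A" "snd ` carrier (direct_sum A B) = carrier B"
    using A.M.zero_closed B.M.zero_closed by (force simp: direct_sum_def)+
  with homs show "x \<in> trace_ideal R A \<Longrightarrow> x \<in> trace_ideal R (direct_sum A B)"
    "x \<in> trace_ideal R B \<Longrightarrow> x \<in> trace_ideal R (direct_sum A B)"
    by (blast intro: trace_ideal_mono)+
qed

text \<open>
  Every linear form on a direct sum is the sum of its restrictions to the two summands.
\<close>

lemma trace_ideal_direct_sumE:
  assumes "right_module R A" "right_module R B" "x \<in> trace_ideal R (direct_sum A B)"
  obtains a b where "a \<in> trace_ideal R A" "b \<in> trace_ideal R B" "x = a \<oplus>\<^bsub>R\<^esub> b"
proof -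
  interpret A: right_module R A by fact
  interpret B: right_module R B by fact
  have R: "ring R" ..
  note closed = trace_ideal_closed[OF R] and homs = direct_sum_homs[OF assms(1,2)]
  have "\<exists>a\<in>trace_ideal R A. \<exists>b\<in>trace_ideal R B. x = a \<oplus>\<^bsub>R\<^esub> b"
    using assms(3)
  proof induction
    case trace_zero
    show ?case
      by (intro bexI[of _ "\<zero>\<^bsub>R\<^esub>"]) (simp_all add: trace_ideal.trace_zero)
  next
    case (trace_step x f p)
    then obtain a b where ab: "a \<in> trace_ideal R A" "b \<in> trace_ideal R B" "x = a \<oplus>\<^bsub>R\<^esub> b"
      by blast
    obtain p1 p2 where p: "p = (p1, p2)" "p1 \<in> carrier A" "p2 \<in> carrier B"
      using trace_step(3) by (auto simp: direct_sum_def)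
    note fD = right_module_homD[OF trace_step(2)]
    have in12: "(p1, \<zero>\<^bsub>B\<^esub>) \<in> carrier (direct_sum A B)" "(\<zero>\<^bsub>A\<^esub>, p2) \<in> carrier (direct_sum A B)"
      using p by (auto simp: direct_sum_def)
    have "p = (p1, \<zero>\<^bsub>B\<^esub>) \<oplus>\<^bsub>direct_sum A B\<^esub> (\<zero>\<^bsub>A\<^esub>, p2)"
      using p by (simp add: direct_sum_def)
    then have "f p = f (p1, \<zero>\<^bsub>B\<^esub>) \<oplus>\<^bsub>R\<^esub> f (\<zero>\<^bsub>A\<^esub>, p2)"
      using fD(2)[OF in12] by simp
    then have "x \<oplus>\<^bsub>R\<^esub> f p = (a \<oplus>\<^bsub>R\<^esub> f (p1, \<zero>\<^bsub>B\<^esub>)) \<oplus>\<^bsub>R\<^esub> (b \<oplus>\<^bsub>R\<^esub> f (\<zero>\<^bsub>A\<^esub>, p2))"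
      using ab(3) closed[OF ab(1)] closed[OF ab(2)] fD(1)[OF in12(1)] fD(1)[OF in12(2)]
      by (simp add: A.R.a_ac)
    moreover have "a \<oplus>\<^bsub>R\<^esub> f (p1, \<zero>\<^bsub>B\<^esub>) \<in> trace_ideal R A"
      using trace_ideal.trace_step[OF ab(1) right_module_hom_comp[OF homs(1) trace_step(2)] p(2)] .
    moreover have "b \<oplus>\<^bsub>R\<^esub> f (\<zero>\<^bsub>A\<^esub>, p2) \<in> trace_ideal R B"
      using trace_ideal.trace_step[OF ab(2) right_module_hom_comp[OF homs(2) trace_step(2)] p(3)] .
    ultimately show ?case by blast
  qed
  then show thesis using that by blast
qed

section \<open>Refinement in the monoid of a regular ring\<close>

lemma V_monoid_carrierE:
  fixes R :: "'r ring"
  assumes "\<alpha> \<in> carrier (V_monoid R)"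
  obtains A :: "('r, nat \<Rightarrow> 'r) module" where "fg_projective R A" "\<alpha> = proj_class R A"
  using assms by (auto simp: V_monoid_def)

lemma retract_class:
  fixes R :: "'r ring" and P :: "('r, 'p) module" and Q :: "('r, 'q) module"
  assumes "fg_projective R P" "right_module R Q"
    and "f \<in> right_module_hom R P Q" "g \<in> right_module_hom R Q P"
    and "\<And>x. x \<in> carrier Q \<Longrightarrow> f (g x) = x"
  shows "\<exists>z\<in>carrier (V_monoid R). proj_class R Q \<otimes>\<^bsub>V_monoid R\<^esub> z = proj_class R P"
proof -
  have Q: "fg_projective R Q"
    by (rule fg_projective_retract) fact+
  obtain K :: "('r, 'p) module" where K: "fg_projective R K" "right_module_iso R P (direct_sum Q K)"
    using retract_complement[OF assms] .
  have "proj_class R P = proj_class R (direct_sum Q K)"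
    using proj_class_eq_iff[OF assms(1) fg_projective_direct_sum[OF Q K(1)]] K(2) by simp
  then show ?thesis
    using proj_class_direct_sum[OF Q K(1)] proj_class_in_carrier[OF K(1)]
    by (intro bexI[of _ "proj_class R K"]) simp_all
qed

text \<open>
  By induction, splitting off the last coordinate.
\<close>

lemma proj_class_free_module:
  fixes R :: "'r ring"
  assumes R: "ring R"
  shows "proj_class R (free_module R n) = proj_class R (idempotent_module R \<one>\<^bsub>R\<^esub>) [^]\<^bsub>V_monoid R\<^esub> n"
proof (induction n)
  case 0
  interpret V: comm_monoid "V_monoid R" by (rule V_monoid_comm_monoid[OF R])
  show ?case by (simp add: V_monoid_one[OF R])
next
  case (Suc n)
  interpret R: ring R by fact
  interpret V: comm_monoid "V_monoid R" by (rule V_monoid_comm_monoid[OF R])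
  let ?U = "idempotent_module R \<one>\<^bsub>R\<^esub>"
  have U: "fg_projective R ?U"
    by (rule fg_projective_idempotent_module) (simp_all add: R)
  note F = fg_projective_free_module[OF R]
  have "right_module_iso R (free_module R (Suc n)) (direct_sum (free_module R n) ?U)"
    unfolding right_module_iso_def
  proof (intro bexI[of _ "\<lambda>c. (restrict c {..<n}, c n)"])
    show "(\<lambda>c. (restrict c {..<n}, c n)) \<in> right_module_hom R (free_module R (Suc n))
        (direct_sum (free_module R n) ?U)"
    proof (rule right_module_homI)
      fix c assume c: "c \<in> carrier (free_module R (Suc n))"
      then show "(restrict c {..<n}, c n) \<in> carrier (direct_sum (free_module R n) ?U)"
        by (simp add: free_module_def direct_sum_def PiE_iff)
      show "(restrict (c \<oplus>\<^bsub>free_module R (Suc n)\<^esub> d) {..<n}, (c \<oplus>\<^bsub>free_module R (Suc n)\<^esub> d) n) =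
          (restrict c {..<n}, c n) \<oplus>\<^bsub>direct_sum (free_module R n) ?U\<^esub> (restrict d {..<n}, d n)" for d
        unfolding free_module_def direct_sum_def by (simp add: restrict_def fun_eq_iff)
      show "(restrict (a \<odot>\<^bsub>free_module R (Suc n)\<^esub> c) {..<n}, (a \<odot>\<^bsub>free_module R (Suc n)\<^esub> c) n) =
          a \<odot>\<^bsub>direct_sum (free_module R n) ?U\<^esub> (restrict c {..<n}, c n)" for a
        unfolding free_module_def direct_sum_def by (simp add: restrict_def fun_eq_iff)
    qed
    show "bij_betw (\<lambda>c. (restrict c {..<n}, c n)) (carrier (free_module R (Suc n)))
        (carrier (direct_sum (free_module R n) ?U))"
    proof (rule bij_betwI[of _ _ _ "\<lambda>(c, x). \<lambda>i\<in>{..<Suc n}. if i = n then x else c i"])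
      show "(\<lambda>(c, x). \<lambda>i\<in>{..<Suc n}. if i = n then x else c i) \<in>
          carrier (direct_sum (free_module R n) ?U) \<rightarrow> carrier (free_module R (Suc n))"
        by (simp add: Pi_iff free_module_def direct_sum_def PiE_iff split_def)
      show "(\<lambda>c. (restrict c {..<n}, c n)) \<in>
          carrier (free_module R (Suc n)) \<rightarrow> carrier (direct_sum (free_module R n) ?U)"
        by (simp add: Pi_iff free_module_def direct_sum_def PiE_iff)
      fix c assume "c \<in> carrier (free_module R (Suc n))"
      then show "(\<lambda>(c, x). \<lambda>i\<in>{..<Suc n}. if i = n then x else c i) (restrict c {..<n}, c n) = c"
        by (intro ext) (simp add: free_module_def PiE_iff extensional_def)
    next
      fix y assume y: "y \<in> carrier (direct_sum (free_module R n) ?U)"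
      obtain c x where cx: "y = (c, x)"
        by (cases y)
      with y have "c i = undefined" if "\<not> i < n" for i
        using that by (simp add: free_module_def direct_sum_def PiE_iff extensional_def)
      then have "restrict (\<lambda>i\<in>{..<Suc n}. if i = n then x else c i) {..<n} = c"
        by (intro ext) (simp add: restrict_def)
      then show "(restrict ((\<lambda>(c, x). \<lambda>i\<in>{..<Suc n}. if i = n then x else c i) y) {..<n},
          (\<lambda>(c, x). \<lambda>i\<in>{..<Suc n}. if i = n then x else c i) y n) = y"
        by (simp add: cx)
    qed
  qed
  then have "proj_class R (free_module R (Suc n)) = proj_class R (direct_sum (free_module R n) ?U)"
    using proj_class_eq_iff[OF F fg_projective_direct_sum[OF F U]] by blast
  then show ?case
    by (simp add: Suc proj_class_direct_sum[OF F U, symmetric])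
qed

lemma proj_class_below_ring:
  fixes R :: "'r ring" and P :: "('r, 'p) module"
  assumes "fg_projective R P"
  shows "below (V_monoid R) (proj_class R P) (proj_class R (idempotent_module R \<one>\<^bsub>R\<^esub>))"
proof -
  have P: "right_module R P" "ring R"
    using assms by (auto simp: fg_projective_def right_module_def)
  obtain n \<pi> s where \<pi>s: "\<pi> \<in> right_module_hom R (free_module R n) P"
    "s \<in> right_module_hom R P (free_module R n)" "\<And>x. x \<in> carrier P \<Longrightarrow> \<pi> (s x) = x"
    using fg_projective_splitE[OF assms] by metis
  from retract_class[where f=\<pi> and g=s, OF fg_projective_free_module[OF P(2)] P(1) \<pi>s] show ?thesis
    unfolding proj_class_free_module[OF P(2)] below_def by blast
qed

text \<open>
  If a single value \<open>f q\<close> is the idempotent \<open>e\<close>, then \<open>x \<mapsto> q \<cdot> x\<close> embeds \<open>eR\<close> into \<open>Q\<close> and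
  \<open>u \<mapsto> e \<cdot> f u\<close> retracts \<open>Q\<close> onto it.
\<close>

lemma idempotent_split:
  fixes R :: "'r ring" and Q :: "('r, 'q) module"
  assumes Q: "fg_projective R Q" and e: "e \<in> carrier R" "e \<otimes>\<^bsub>R\<^esub> e = e"
    and f: "f \<in> right_module_hom R Q (ring_module R)" "q \<in> carrier Q" "f q = e"
  shows "\<exists>z\<in>carrier (V_monoid R). proj_class R (idempotent_module R e) \<otimes>\<^bsub>V_monoid R\<^esub> z = proj_class R Q"
proof (rule retract_class[OF Q])
  interpret Q: right_module R Q
    using Q by (simp add: fg_projective_def)
  note fD = right_module_homD[OF f(1)]
  show "right_module R (idempotent_module R e)"
    by (rule right_module_idempotent_module[OF Q.R.ring_axioms e(1)])
  show "(\<lambda>u. e \<otimes>\<^bsub>R\<^esub> f u) \<in> right_module_hom R Q (idempotent_module R e)"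
    using fD e by (intro right_module_homI) (simp_all add: Q.R.r_distr Q.R.m_assoc[symmetric])
  show "(\<lambda>x. x \<odot>\<^bsub>Q\<^esub> q) \<in> right_module_hom R (idempotent_module R e) Q"
    using f(2) by (intro right_module_homI) (auto simp: Q.smult_add_scalar Q.smult_assoc)
  show "e \<otimes>\<^bsub>R\<^esub> f (x \<odot>\<^bsub>Q\<^esub> q) = x" if "x \<in> carrier (idempotent_module R e)" for x
    using that fD f(2,3) e by auto
qed

text \<open>
  If \<open>e\<close> is a sum of \<open>n\<close> values of linear forms on \<open>P\<close>, it is a single value of a linear form on
  \<open>P\<^sup>n\<close>, so \<open>eR\<close> is a direct summand of \<open>P\<^sup>n\<close>.  Since the powers of \<open>P\<close> live in different types,
  they are replaced by representatives of their isomorphism classes, and the induction is on the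
  summands that have not yet been absorbed into \<open>Q\<close>.
\<close>

lemma idempotent_below:
  fixes R :: "'r ring" and P :: "('r, 'p) module"
  assumes P: "fg_projective R P" and e: "e \<in> trace_ideal R P" "e \<otimes>\<^bsub>R\<^esub> e = e"
  shows "below (V_monoid R) (proj_class R (idempotent_module R e)) (proj_class R P)"
proof -
  interpret P: right_module R P
    using P by (simp add: fg_projective_def)
  have R: "ring R" ..
  let ?V = "V_monoid R"
  interpret V: comm_monoid ?V by (rule V_monoid_comm_monoid[OF R])
  note closed = trace_ideal_closed[OF R] and Pc = proj_class_in_carrier[OF P]
  have eR: "e \<in> carrier R" by (rule closed[OF e(1)])
  have *: "\<exists>n::nat. \<exists>z\<in>carrier ?V. proj_class R (idempotent_module R e) \<otimes>\<^bsub>?V\<^esub> z =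
      proj_class R Q \<otimes>\<^bsub>?V\<^esub> proj_class R P [^]\<^bsub>?V\<^esub> n"
    if "x \<in> trace_ideal R P" "fg_projective R Q" "f \<in> right_module_hom R Q (ring_module R)"
      "q \<in> carrier Q" "e = f q \<oplus>\<^bsub>R\<^esub> x" for x f q and Q :: "('r, nat \<Rightarrow> 'r) module"
    using that
  proof (induction arbitrary: Q f q)
    case trace_zero
    note fD = right_module_homD[OF trace_zero(2)]
    have "f q = e"
      using trace_zero fD(1)[OF trace_zero(3)] by simp
    from idempotent_split[where f=f and q=q, OF trace_zero(1) eR e(2) trace_zero(2,3) this] show ?case
      using proj_class_in_carrier[OF trace_zero(1)] by (intro exI[of _ 0]) simp
  next
    case (trace_step x g p)
    note Q = trace_step(5)
    note fD = right_module_homD[OF trace_step(6)] and gD = right_module_homD[OF trace_step(2)]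
    have QP: "fg_projective R (direct_sum Q P)"
      by (rule fg_projective_direct_sum[OF Q P])
    then have rQP: "right_module R (direct_sum Q P)"
      by (simp add: fg_projective_def)
    obtain Q' :: "('r, nat \<Rightarrow> 'r) module" where Q': "fg_projective R Q'" "right_module_iso R (direct_sum Q P) Q'"
      using fg_projective_representative[OF QP] .
    obtain h where h: "h \<in> right_module_hom R (direct_sum Q P) Q'"
      "bij_betw h (carrier (direct_sum Q P)) (carrier Q')"
      using Q'(2) by (auto simp: right_module_iso_def)
    let ?k = "inv_into (carrier (direct_sum Q P)) h"
    have k: "?k \<in> right_module_hom R Q' (direct_sum Q P)"
      by (rule right_module_hom_inv[OF rQP h])
    have qp: "(q, p) \<in> carrier (direct_sum Q P)"
      using trace_step(3,7) by (simp add: direct_sum_def)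
    have khqp: "?k (h (q, p)) = (q, p)"
      using qp h(2) by (simp add: bij_betw_def)
    have "(\<lambda>(q, p). f q \<oplus>\<^bsub>R\<^esub> g p) \<in> right_module_hom R (direct_sum Q P) (ring_module R)"
      using fD gD by (intro right_module_homI) (auto simp: direct_sum_def P.R.a_ac P.R.l_distr)
    from right_module_hom_comp[OF k this]
    have f': "(\<lambda>u. (\<lambda>(q, p). f q \<oplus>\<^bsub>R\<^esub> g p) (?k u)) \<in> right_module_hom R Q' (ring_module R)" .
    \<comment> \<open>The summand \<open>g p\<close> moves from the remaining sum into the value of the form on \<open>Q \<oplus> P\<close>.\<close>
    have "e = (\<lambda>(q, p). f q \<oplus>\<^bsub>R\<^esub> g p) (?k (h (q, p))) \<oplus>\<^bsub>R\<^esub> x"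
      unfolding khqp trace_step(8)
      using fD(1)[OF trace_step(7)] gD(1)[OF trace_step(3)] closed[OF trace_step(1)]
      by (simp add: P.R.a_ac)
    from trace_step.IH[OF Q'(1) f' right_module_homD(1)[OF h(1) qp] this]
    obtain n :: nat and z where z: "z \<in> carrier ?V" "proj_class R (idempotent_module R e) \<otimes>\<^bsub>?V\<^esub> z =
      proj_class R Q' \<otimes>\<^bsub>?V\<^esub> proj_class R P [^]\<^bsub>?V\<^esub> n"
      by blast
    have "proj_class R Q' = proj_class R Q \<otimes>\<^bsub>?V\<^esub> proj_class R P"
      using proj_class_eq_iff[OF QP Q'(1)] Q'(2) proj_class_direct_sum[OF Q P] by simp
    then have "proj_class R Q' \<otimes>\<^bsub>?V\<^esub> proj_class R P [^]\<^bsub>?V\<^esub> n =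
        proj_class R Q \<otimes>\<^bsub>?V\<^esub> proj_class R P [^]\<^bsub>?V\<^esub> Suc n"
      using proj_class_in_carrier[OF Q] Pc by (simp add: V.m_ac)
    with z show ?case by metis
  qed
  \<comment> \<open>The induction starts with \<open>Q = 0\<close>, where all of \<open>e\<close> is still to be absorbed.\<close>
  have Z: "(\<lambda>_. \<zero>\<^bsub>R\<^esub>) \<in> right_module_hom R (free_module R 0) (ring_module R)"
    by (rule right_module_homI) simp_all
  have "\<zero>\<^bsub>free_module R 0\<^esub> \<in> carrier (free_module R 0)" "e = \<zero>\<^bsub>R\<^esub> \<oplus>\<^bsub>R\<^esub> e"
    using eR fg_projective_zero(2)[OF R] by simp_all
  from *[OF e(1) fg_projective_zero(1)[OF R] Z this(1) this(2)] show ?thesis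
    using Pc unfolding below_def V_monoid_one[OF R, symmetric] by auto
qed

text \<open>
  The trace ideal of a power of \<open>P\<close> is contained in that of \<open>P\<close>, so a power with \<open>R\<close> as a direct
  summand forces \<open>1\<close> into the trace ideal of \<open>P\<close>.
\<close>

lemma ring_below_imp_one_in_trace:
  fixes R :: "'r ring" and P :: "('r, 'p) module"
  assumes P: "fg_projective R P"
    and "below (V_monoid R) (proj_class R (idempotent_module R \<one>\<^bsub>R\<^esub>)) (proj_class R P)"
  shows "\<one>\<^bsub>R\<^esub> \<in> trace_ideal R P"
proof -
  interpret P: right_module R P
    using P by (simp add: fg_projective_def)
  have R: "ring R" ..
  let ?V = "V_monoid R" and ?U = "idempotent_module R \<one>\<^bsub>R\<^esub>"
  interpret V: comm_monoid ?V by (rule V_monoid_comm_monoid[OF R])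
  have U: "fg_projective R ?U"
    by (rule fg_projective_idempotent_module) (simp_all add: R)
  have pow: "x \<in> trace_ideal R P"
    if "fg_projective R Q" "proj_class R Q = proj_class R P [^]\<^bsub>?V\<^esub> n" "x \<in> trace_ideal R Q"
    for n :: nat and x and Q :: "('r, nat \<Rightarrow> 'r) module"
    using that
  proof (induction n arbitrary: x Q)
    case 0
    have "right_module_iso R Q (free_module R 0)"
      using 0 fg_projective_zero[OF R] proj_class_eq_iff[of R Q "free_module R 0"]
      by (simp add: V_monoid_one[OF R])
    then have "right_module_iso R (free_module R 0) Q"
      using 0(1) right_module_iso_sym by (auto simp: fg_projective_def)
    from trace_ideal_iso[OF this 0(3)]
    have "x \<in> trace_ideal R (free_module R 0)" .
    then have "x = \<zero>\<^bsub>R\<^esub>"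
    proof induction
      case (trace_step x f p)
      then have "p = \<zero>\<^bsub>free_module R 0\<^esub>"
        using fg_projective_zero(2)[OF R] by blast
      then show ?case
        using trace_step
          right_module_hom_zero[OF right_module_free_module[OF R] right_module_ring_module[OF R] trace_step(2)]
        by simp
    qed simp
    then show ?case by (simp add: trace_zero)
  next
    case (Suc n)
    have "proj_class R P [^]\<^bsub>?V\<^esub> n \<in> carrier ?V"
      using proj_class_in_carrier[OF P] by simp
    then obtain S :: "('r, nat \<Rightarrow> 'r) module"
      where S: "fg_projective R S" "proj_class R P [^]\<^bsub>?V\<^esub> n = proj_class R S"
      by (rule V_monoid_carrierE)
    have "right_module_iso R (direct_sum S P) Q"
      using Suc.prems(1,2) S proj_class_eq_iff[OF fg_projective_direct_sum[OF S(1) P] Suc.prems(1)]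
      by (simp add: proj_class_direct_sum[OF S(1) P])
    from trace_ideal_iso[OF this Suc.prems(3)]
    have "x \<in> trace_ideal R (direct_sum S P)" .
    then obtain a b where ab: "a \<in> trace_ideal R S" "b \<in> trace_ideal R P" "x = a \<oplus>\<^bsub>R\<^esub> b"
      using S(1) trace_ideal_direct_sumE[OF _ P.right_module_axioms] unfolding fg_projective_def by metis
    then show ?case
      using Suc.IH[OF S(1) S(2)[symmetric] ab(1)] trace_ideal_add[OF R] by blast
  qed
  obtain n and z where z: "z \<in> carrier ?V" "proj_class R ?U \<otimes>\<^bsub>?V\<^esub> z = proj_class R P [^]\<^bsub>?V\<^esub> (n::nat)"
    using assms(2) by (auto simp: below_def)
  obtain Z :: "('r, nat \<Rightarrow> 'r) module" where Z: "fg_projective R Z" "z = proj_class R Z"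
    using z(1) by (rule V_monoid_carrierE)
  note UZ = fg_projective_direct_sum[OF U Z(1)]
  obtain Q :: "('r, nat \<Rightarrow> 'r) module" where Q: "fg_projective R Q" "right_module_iso R (direct_sum ?U Z) Q"
    using fg_projective_representative[OF UZ] .
  have "proj_class R Q = proj_class R P [^]\<^bsub>?V\<^esub> n"
    using proj_class_eq_iff[OF UZ Q(1)] Q(2) z(2) proj_class_direct_sum[OF U Z(1)] Z(2) by simp
  moreover have "\<one>\<^bsub>R\<^esub> \<in> trace_ideal R ?U"
    by (rule trace_ideal_value[OF R, of "\<lambda>x. x"]) (auto simp: right_module_hom_def)
  then have "\<one>\<^bsub>R\<^esub> \<in> trace_ideal R (direct_sum ?U Z)"
    using U Z(1) by (intro trace_ideal_direct_summand(1)) (simp_all add: fg_projective_def)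
  then have "\<one>\<^bsub>R\<^esub> \<in> trace_ideal R Q"
    using UZ unfolding fg_projective_def by (metis trace_ideal_iso[OF right_module_iso_sym[OF _ Q(2)]])
  ultimately show ?thesis
    using pow[OF Q(1)] by blast
qed

lemma order_unit_V_monoid_iff:
  fixes R :: "'r ring" and P :: "('r, 'p) module"
  assumes P: "fg_projective R P"
  shows "order_unit (V_monoid R) (proj_class R P) \<longleftrightarrow> \<one>\<^bsub>R\<^esub> \<in> trace_ideal R P"
proof
  interpret P: right_module R P
    using P by (simp add: fg_projective_def)
  have R: "ring R" ..
  let ?V = "V_monoid R" and ?U = "idempotent_module R \<one>\<^bsub>R\<^esub>"
  have V: "comm_monoid ?V" by (rule V_monoid_comm_monoid[OF R])
  have U: "fg_projective R ?U"
    by (rule fg_projective_idempotent_module) (simp_all add: R)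
  note Pc = proj_class_in_carrier[OF P] and Uc = proj_class_in_carrier[OF U]
  show "\<one>\<^bsub>R\<^esub> \<in> trace_ideal R P" if "order_unit ?V (proj_class R P)"
    using that Uc by (intro ring_below_imp_one_in_trace[OF P]) (simp add: order_unit_def)
  assume "\<one>\<^bsub>R\<^esub> \<in> trace_ideal R P"
  then have UP: "below ?V (proj_class R ?U) (proj_class R P)"
    by (rule idempotent_below[OF P]) simp
  have "below ?V \<alpha> (proj_class R P)" if \<alpha>: "\<alpha> \<in> carrier ?V" for \<alpha>
  proof -
    obtain A :: "('r, nat \<Rightarrow> 'r) module" where "fg_projective R A" "\<alpha> = proj_class R A"
      using \<alpha> by (rule V_monoid_carrierE)
    then have "below ?V \<alpha> (proj_class R ?U)"
      using proj_class_below_ring by blast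
    then show ?thesis
      using below_trans[OF V \<alpha> Uc Pc _ UP] by blast
  qed
  then show "order_unit ?V (proj_class R P)"
    using Pc by (simp add: order_unit_def)
qed

text \<open>
  The refinement is the product of the two sides of a partition of unity.  The trace ideals of
  \<open>A i\<close> and \<open>B i\<close> sum up to \<open>R\<close>, so \<open>1 = \<alpha> i + \<beta> i\<close> with \<open>\<alpha> i\<close> in the first and \<open>\<beta> i\<close> in the
  second; let \<open>x i j = \<alpha> i \<cdot> \<beta> j\<close>.  Inserting \<open>1 = \<alpha> j + \<beta> j\<close> gives
  \<open>x i k = \<alpha> i \<cdot> x j k + x i j \<cdot> \<beta> k\<close>, the triangle inequality for the two-sided ideals generated by
  the \<open>x i j\<close>, and \<open>\<alpha> i = \<alpha> i \<cdot> \<alpha> j + x i j\<close>, which gives the order units.  Regularity serves to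
  turn these ideals into trace ideals: \<open>x i j\<close> and some idempotent \<open>e i j\<close> generate the same right
  ideal.
\<close>

theorem V_monoid_weak_uniform_refinement:
  fixes R :: "'r ring" and I :: "'i set"
  assumes "regular_ring R"
  shows "weak_uniform_refinement (V_monoid R) I"
  unfolding weak_uniform_refinement_def
proof (intro allI impI)
  have R: "ring R" and reg: "\<And>x. x \<in> carrier R \<Longrightarrow> \<exists>y\<in>carrier R. x \<otimes>\<^bsub>R\<^esub> y \<otimes>\<^bsub>R\<^esub> x = x"
    using assms by (auto simp: regular_ring_def)
  interpret R: ring R by (rule R)
  let ?V = "V_monoid R"
  interpret V: comm_monoid ?V by (rule V_monoid_comm_monoid[OF R])
  fix a b :: "'i \<Rightarrow> ('r, nat \<Rightarrow> 'r) module set"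
  assume ab: "\<forall>i\<in>I. a i \<in> carrier ?V \<and> b i \<in> carrier ?V \<and> order_unit ?V (a i \<otimes>\<^bsub>?V\<^esub> b i)"
  have "\<forall>i\<in>I. \<exists>A::('r, nat \<Rightarrow> 'r) module. fg_projective R A \<and> a i = proj_class R A"
    using ab V_monoid_carrierE by metis
  then obtain A :: "'i \<Rightarrow> ('r, nat \<Rightarrow> 'r) module"
    where A: "\<And>i. i \<in> I \<Longrightarrow> fg_projective R (A i)" "\<And>i. i \<in> I \<Longrightarrow> a i = proj_class R (A i)"
    by metis
  have "\<forall>i\<in>I. \<exists>B::('r, nat \<Rightarrow> 'r) module. fg_projective R B \<and> b i = proj_class R B"
    using ab V_monoid_carrierE by metis
  then obtain B :: "'i \<Rightarrow> ('r, nat \<Rightarrow> 'r) module"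
    where B: "\<And>i. i \<in> I \<Longrightarrow> fg_projective R (B i)" "\<And>i. i \<in> I \<Longrightarrow> b i = proj_class R (B i)"
    by metis
  have rm: "right_module R (A i)" "right_module R (B i)" if "i \<in> I" for i
    using A(1)[OF that] B(1)[OF that] by (simp_all add: fg_projective_def)
  have "\<exists>\<alpha> \<beta>. \<alpha> \<in> trace_ideal R (A i) \<and> \<beta> \<in> trace_ideal R (B i) \<and> \<alpha> \<oplus>\<^bsub>R\<^esub> \<beta> = \<one>\<^bsub>R\<^esub>" if i: "i \<in> I" for i
  proof -
    have "order_unit ?V (proj_class R (direct_sum (A i) (B i)))"
      using ab i A(2) B(2) proj_class_direct_sum[OF A(1) B(1)] by metis
    then have "\<one>\<^bsub>R\<^esub> \<in> trace_ideal R (direct_sum (A i) (B i))"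
      using order_unit_V_monoid_iff[OF fg_projective_direct_sum[OF A(1) B(1)]] i by blast
    then show ?thesis
      using trace_ideal_direct_sumE[OF rm[OF i]] by metis
  qed
  then obtain \<alpha> \<beta> where \<alpha>: "\<And>i. i \<in> I \<Longrightarrow> \<alpha> i \<in> trace_ideal R (A i)"
    and \<beta>: "\<And>i. i \<in> I \<Longrightarrow> \<beta> i \<in> trace_ideal R (B i)"
    and \<alpha>\<beta>: "\<And>i. i \<in> I \<Longrightarrow> \<alpha> i \<oplus>\<^bsub>R\<^esub> \<beta> i = \<one>\<^bsub>R\<^esub>"
    by metis
  have \<alpha>R: "\<alpha> i \<in> carrier R" and \<beta>R: "\<beta> i \<in> carrier R" if "i \<in> I" for i
    using trace_ideal_closed[OF R] \<alpha>[OF that] \<beta>[OF that] by blast+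
  define x where "x i j = \<alpha> i \<otimes>\<^bsub>R\<^esub> \<beta> j" for i j
  have xR: "x i j \<in> carrier R" if "i \<in> I" "j \<in> I" for i j
    using \<alpha>R \<beta>R that by (simp add: x_def)
  define y where "y i j = (SOME y. y \<in> carrier R \<and> x i j \<otimes>\<^bsub>R\<^esub> y \<otimes>\<^bsub>R\<^esub> x i j = x i j)" for i j
  have y: "y i j \<in> carrier R" "x i j \<otimes>\<^bsub>R\<^esub> y i j \<otimes>\<^bsub>R\<^esub> x i j = x i j" if "i \<in> I" "j \<in> I" for i j
  proof -
    have "\<exists>y. y \<in> carrier R \<and> x i j \<otimes>\<^bsub>R\<^esub> y \<otimes>\<^bsub>R\<^esub> x i j = x i j"
      using reg[OF xR[OF that]] by blast
    from someI_ex[OF this]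
    show "y i j \<in> carrier R" "x i j \<otimes>\<^bsub>R\<^esub> y i j \<otimes>\<^bsub>R\<^esub> x i j = x i j"
      unfolding y_def by blast+
  qed
  define e where "e i j = x i j \<otimes>\<^bsub>R\<^esub> y i j" for i j
  have eR: "e i j \<in> carrier R" and ee: "e i j \<otimes>\<^bsub>R\<^esub> e i j = e i j" and ex: "e i j \<otimes>\<^bsub>R\<^esub> x i j = x i j"
    if "i \<in> I" "j \<in> I" for i j
    using xR y that by (simp_all add: e_def flip: R.m_assoc)
  define C where "C i j = idempotent_module R (e i j)" for i j
  have C: "fg_projective R (C i j)" if "i \<in> I" "j \<in> I" for i j
    unfolding C_def using R eR ee that by (intro fg_projective_idempotent_module)
  then have rC: "right_module R (C i j)" if "i \<in> I" "j \<in> I" for i j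
    using that by (simp add: fg_projective_def)
  have xC: "x i j \<in> trace_ideal R (C i j)" if "i \<in> I" "j \<in> I" for i j
    by (rule trace_ideal_value[OF R, of "\<lambda>x. x"])
      (use xR ex that in \<open>auto simp: C_def right_module_hom_def\<close>)
  have eA: "e i j \<in> trace_ideal R (A i)" and eB: "e i j \<in> trace_ideal R (B j)" if "i \<in> I" "j \<in> I" for i j
  proof -
    have "x i j \<in> trace_ideal R (A i)" "x i j \<in> trace_ideal R (B j)"
      unfolding x_def using trace_ideal_mult rm \<alpha> \<beta> \<alpha>R \<beta>R that by metis+
    then show "e i j \<in> trace_ideal R (A i)" "e i j \<in> trace_ideal R (B j)"
      unfolding e_def using trace_ideal_mult(2) rm y(1) that by metis+
  qed
  have below: "below ?V (proj_class R (C i j)) (proj_class R P)"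
    if "fg_projective R P" "e i j \<in> trace_ideal R P" "i \<in> I" "j \<in> I" for i j and P :: "('r, 'p) module"
    unfolding C_def using that ee by (intro idempotent_below)
  have "refinement_matrix ?V I a b (\<lambda>i j. proj_class R (C i j))"
  proof (rule refinement_matrixI)
    fix i j assume i: "i \<in> I" and j: "j \<in> I"
    show "proj_class R (C i j) \<in> carrier ?V"
      by (rule proj_class_in_carrier[OF C[OF i j]])
    show "below ?V (proj_class R (C i j)) (a i)"
      using below[OF A(1)[OF i] eA[OF i j] i j] A(2)[OF i] by simp
    show "below ?V (proj_class R (C i j)) (b j)"
      using idempotent_below[OF B(1)[OF j] eB[OF i j] ee[OF i j]] B(2)[OF j] by (simp add: C_def)
    show "order_unit ?V (proj_class R (C i j) \<otimes>\<^bsub>?V\<^esub> (a j \<otimes>\<^bsub>?V\<^esub> b i))"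
    proof -
      let ?AB = "direct_sum (A j) (B i)" and ?P = "direct_sum (C i j) (direct_sum (A j) (B i))"
      have AB: "fg_projective R ?AB"
        by (rule fg_projective_direct_sum[OF A(1)[OF j] B(1)[OF i]])
      then have rAB: "right_module R ?AB" by (simp add: fg_projective_def)
      have P: "fg_projective R ?P"
        by (rule fg_projective_direct_sum[OF C[OF i j] AB])
      note summand = trace_ideal_direct_summand[OF rC[OF i j] rAB]
        trace_ideal_direct_summand[OF rm(1)[OF j] rm(2)[OF i]]
      have "\<alpha> i = \<alpha> i \<otimes>\<^bsub>R\<^esub> (\<alpha> j \<oplus>\<^bsub>R\<^esub> \<beta> j)"
        using \<alpha>\<beta>[OF j] \<alpha>R[OF i] by simp
      also have "\<dots> = \<alpha> i \<otimes>\<^bsub>R\<^esub> \<alpha> j \<oplus>\<^bsub>R\<^esub> x i j"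
        using \<alpha>R \<beta>R i j by (simp add: x_def R.r_distr)
      finally have eq: "\<alpha> i = \<alpha> i \<otimes>\<^bsub>R\<^esub> \<alpha> j \<oplus>\<^bsub>R\<^esub> x i j" .
      have "\<alpha> i \<otimes>\<^bsub>R\<^esub> \<alpha> j \<in> trace_ideal R ?P"
        using trace_ideal_mult(1)[OF rm(1)[OF j] \<alpha>[OF j] \<alpha>R[OF i]] summand by blast
      moreover have "x i j \<in> trace_ideal R ?P"
        using xC[OF i j] summand by blast
      ultimately have "\<alpha> i \<in> trace_ideal R ?P"
        by (subst eq) (rule trace_ideal_add[OF R])
      moreover have "\<beta> i \<in> trace_ideal R ?P"
        using \<beta>[OF i] summand by blast
      ultimately have "\<one>\<^bsub>R\<^esub> \<in> trace_ideal R ?P"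
        by (subst \<alpha>\<beta>[OF i, symmetric]) (rule trace_ideal_add[OF R])
      then have "order_unit ?V (proj_class R ?P)"
        using order_unit_V_monoid_iff[OF P] by blast
      then show ?thesis
        using proj_class_direct_sum[OF C[OF i j] AB] proj_class_direct_sum[OF A(1)[OF j] B(1)[OF i]]
          A(2)[OF j] B(2)[OF i] by simp
    qed
    fix k assume k: "k \<in> I"
    let ?P = "direct_sum (C i j) (C j k)"
    have P: "fg_projective R ?P"
      by (rule fg_projective_direct_sum[OF C[OF i j] C[OF j k]])
    then have rP: "right_module R ?P" by (simp add: fg_projective_def)
    note summand = trace_ideal_direct_summand[OF rC[OF i j] rC[OF j k]]
    have "x i k = \<alpha> i \<otimes>\<^bsub>R\<^esub> (\<alpha> j \<oplus>\<^bsub>R\<^esub> \<beta> j) \<otimes>\<^bsub>R\<^esub> \<beta> k"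
      using \<alpha>\<beta>[OF j] \<alpha>R[OF i] by (simp add: x_def)
    also have "\<dots> = \<alpha> i \<otimes>\<^bsub>R\<^esub> x j k \<oplus>\<^bsub>R\<^esub> x i j \<otimes>\<^bsub>R\<^esub> \<beta> k"
      using \<alpha>R \<beta>R i j k by (simp add: x_def R.r_distr R.l_distr R.m_assoc)
    finally have eq: "x i k = \<alpha> i \<otimes>\<^bsub>R\<^esub> x j k \<oplus>\<^bsub>R\<^esub> x i j \<otimes>\<^bsub>R\<^esub> \<beta> k" .
    have "x i k \<in> trace_ideal R ?P"
      unfolding eq using summand(1)[OF xC[OF i j]] summand(2)[OF xC[OF j k]] rP \<alpha>R[OF i] \<beta>R[OF k]
      by (intro trace_ideal_add[OF R] trace_ideal_mult)
    then have "e i k \<in> trace_ideal R ?P"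
      unfolding e_def by (rule trace_ideal_mult(2)[OF rP _ y(1)[OF i k]])
    from idempotent_below[OF P this ee[OF i k]]
    show "below ?V (proj_class R (C i k)) (proj_class R (C i j) \<otimes>\<^bsub>?V\<^esub> proj_class R (C j k))"
      by (simp add: C_def[of i k] proj_class_direct_sum[OF C[OF i j] C[OF j k]])
  qed
  then show "\<exists>c. refinement_matrix ?V I a b c"
    by (rule exI[of _ "\<lambda>i j. proj_class R (C i j)"])
qed

section \<open>A free set theorem\<close>

text \<open>
  The union of \<open>B\<close> and of the finite sets indexed by \<open>B \<times> B\<close> is not larger than the infinite set
  \<open>B\<close>, so it cannot cover \<open>C\<close>.
\<close>

lemma card_ordLess_avoid:
  assumes "infinite B" "|B| <o |C|" "\<And>x y. \<lbrakk>x \<in> B; y \<in> B\<rbrakk> \<Longrightarrow> finite (T x y)"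
  shows "\<exists>c\<in>C. c \<notin> B \<and> (\<forall>x\<in>B. \<forall>y\<in>B. c \<notin> T x y)"
proof -
  have fin: "|T x y| \<le>o |B|" if "x \<in> B" "y \<in> B" for x y
    using assms(1,3) that
    by (meson card_of_ordLeq_infinite card_of_ordLeq_finite ordLeq_total card_of_Well_order)
  have refl: "|B| \<le>o |B|"
    by (rule card_of_refl[THEN ordIso_imp_ordLeq])
  have "|\<Union>y\<in>B. T x y| \<le>o |B|" if "x \<in> B" for x
    using fin that by (intro card_of_UNION_ordLeq_infinite[OF assms(1) refl]) blast
  then have "|\<Union>x\<in>B. \<Union>y\<in>B. T x y| \<le>o |B|"
    by (intro card_of_UNION_ordLeq_infinite[OF assms(1) refl]) blast
  then have "|B \<union> (\<Union>x\<in>B. \<Union>y\<in>B. T x y)| \<le>o |B|"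
    using assms(1) card_of_Un_ordLeq_infinite_Field[OF _ refl _ card_of_Card_order]
    by (simp add: Field_card_of)
  then have "\<not> C \<subseteq> B \<union> (\<Union>x\<in>B. \<Union>y\<in>B. T x y)"
    using assms(2) card_of_mono1 ordLeq_transitive not_ordLess_ordLeq by metis
  then obtain c where "c \<in> C" "c \<notin> B \<union> (\<Union>x\<in>B. \<Union>y\<in>B. T x y)"
    by blast
  then show ?thesis
    by blast
qed

lemma subset_of_cardinality:
  assumes "Card_order r" "r <o |C|"
  obtains B where "B \<subseteq> C" "|B| =o r"
proof -
  have "|Field r| \<le>o |C|"
    by (rule ordLess_imp_ordLeq[OF ordIso_ordLess_trans[OF card_of_Field_ordIso[OF assms(1)] assms(2)]])
  from iffD1[OF internalize_card_of_ordLeq2 this] obtain B where "B \<subseteq> C" "|Field r| =o |B|"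
    by blast
  moreover from this(2) have "|B| =o r"
    by (rule ordIso_transitive[OF ordIso_symmetric card_of_Field_ordIso[OF assms(1)]])
  ultimately show thesis
    by (intro that)
qed

text \<open>
  Kuratowski's free set theorem for pairs, with \<open>\<aleph>\<^sub>2\<close> the least cardinal for which it holds.  One
  passes from \<open>X\<close> to a subset \<open>W\<close> of size \<open>\<aleph>\<^sub>1\<close> and from there to a countable infinite \<open>V\<close>, and picks
  \<open>k\<close>, \<open>j\<close>, \<open>i\<close> in this order: \<open>k\<close> avoids all \<open>S i j\<close> over \<open>W\<close>, then \<open>j \<in> W\<close> avoids all \<open>S i k\<close>
  over \<open>V\<close>, and finally \<open>i \<in> V\<close> avoids the single finite set \<open>S j k\<close>.
\<close>

lemma free_triple:
  assumes "cardSuc (cardSuc natLeq) \<le>o |X|"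
    and fin: "\<And>i j. \<lbrakk>i \<in> X; j \<in> X\<rbrakk> \<Longrightarrow> finite (S i j)"
  shows "\<exists>i\<in>X. \<exists>j\<in>X. \<exists>k\<in>X. i \<noteq> j \<and> j \<noteq> k \<and> i \<noteq> k \<and> k \<notin> S i j \<and> i \<notin> S j k \<and> j \<notin> S i k"
proof -
  have card: "Card_order natLeq" "Card_order (cardSuc natLeq)"
    using natLeq_Card_order cardSuc_Card_order by blast+
  have "cardSuc natLeq <o |X|"
    by (rule ordLess_ordLeq_trans[OF cardSuc_greater[OF card(2)] assms(1)])
  note less = this
  obtain W where W: "W \<subseteq> X" "|W| =o cardSuc natLeq"
    by (rule subset_of_cardinality[OF card(2) less])
  have WX: "|W| <o |X|"
    by (rule ordIso_ordLess_trans[OF W(2) less])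
  have "natLeq <o |W|"
    by (rule ordLess_ordIso_trans[OF cardSuc_greater[OF card(1)] ordIso_symmetric[OF W(2)]])
  note less = this
  obtain V where V: "V \<subseteq> W" "|V| =o natLeq"
    by (rule subset_of_cardinality[OF card(1) less])
  have VW: "|V| <o |W|"
    by (rule ordIso_ordLess_trans[OF V(2) less])
  have infV: "infinite V"
    using infinite_iff_natLeq_ordLeq[of V] ordIso_imp_ordLeq[OF ordIso_symmetric[OF V(2)]] by simp
  then have infW: "infinite W"
    using V(1) finite_subset by blast
  have finW: "finite (S i j)" if "i \<in> W" "j \<in> W" for i j
    using that W(1) by (intro fin) auto
  obtain k where k: "k \<in> X" "k \<notin> W" "\<And>i j. \<lbrakk>i \<in> W; j \<in> W\<rbrakk> \<Longrightarrow> k \<notin> S i j"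
    using card_ordLess_avoid[where T = S, OF infW WX finW] by blast
  have finV: "finite (S i k)" if "i \<in> V" for i
    using that W(1) V(1) k(1) by (intro fin) auto
  have "\<exists>j\<in>W. j \<notin> V \<and> (\<forall>i\<in>V. \<forall>l\<in>V. j \<notin> S i k)"
    by (rule card_ordLess_avoid[OF infV VW]) (rule finV)
  then obtain j where j: "j \<in> W" "j \<notin> V" "\<And>i. i \<in> V \<Longrightarrow> j \<notin> S i k"
    by blast
  have "infinite (V - S j k)"
    using infV fin[of j k] j(1) W(1) k(1) by auto
  then obtain i where i: "i \<in> V" "i \<notin> S j k"
    using infinite_imp_nonempty by blast
  have "k \<notin> S i j" "j \<notin> S i k" "i \<noteq> j" "i \<noteq> k" "j \<noteq> k"
    using i k(2,3) j V(1) by auto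
  moreover have "i \<in> X" "j \<in> X"
    using i(1) j(1) V(1) W(1) by auto
  ultimately show ?thesis
    using i(2) k(1) by blast
qed

lemma injection_from_pairs:
  assumes "infinite X"
  obtains e :: "'x \<times> bool \<Rightarrow> 'x" where "inj_on e (X \<times> UNIV)" "e ` (X \<times> UNIV) \<subseteq> X"
proof -
  have "|UNIV :: bool set| \<le>o |X|"
    using assms by (meson card_of_ordLeq_infinite finite ordLeq_total card_of_Well_order)
  then have "|X \<times> (UNIV :: bool set)| \<le>o |X|"
    by (intro ordIso_imp_ordLeq[OF card_of_Times_infinite_simps(1)[OF assms]]) simp_all
  then show thesis
    using that unfolding card_of_ordLeq[symmetric] by metis
qed

section \<open>Relative complements in non-distributive lattices\<close>

text \<open>
  The order is defined through the join so that only the two operations of \<open>L\<close> matter, and the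
  equivalence of the record is plain equality on the smaller carrier.
\<close>

definition sublattice :: "'a gorder \<Rightarrow> 'a set \<Rightarrow> 'a gorder" where
  "sublattice L C = \<lparr>carrier = C, eq = (=), le = (\<lambda>x y. x \<squnion>\<^bsub>L\<^esub> y = y)\<rparr>"

lemma carrier_sublattice [simp]: "carrier (sublattice L C) = C"
  by (simp add: sublattice_def)

lemma sublattice:
  assumes L: "lattice L" and C: "C \<subseteq> carrier L"
    and closed: "\<And>x y. \<lbrakk>x \<in> C; y \<in> C\<rbrakk> \<Longrightarrow> x \<squnion>\<^bsub>L\<^esub> y \<in> C" "\<And>x y. \<lbrakk>x \<in> C; y \<in> C\<rbrakk> \<Longrightarrow> x \<sqinter>\<^bsub>L\<^esub> y \<in> C"
  shows "lattice (sublattice L C)"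
    "\<And>x y. \<lbrakk>x \<in> C; y \<in> C\<rbrakk> \<Longrightarrow> x \<squnion>\<^bsub>sublattice L C\<^esub> y = x \<squnion>\<^bsub>L\<^esub> y"
    "\<And>x y. \<lbrakk>x \<in> C; y \<in> C\<rbrakk> \<Longrightarrow> x \<sqinter>\<^bsub>sublattice L C\<^esub> y = x \<sqinter>\<^bsub>L\<^esub> y"
proof -
  have CL: "x \<in> carrier L" if "x \<in> C" for x
    using C that by blast
  note laws = lattice_laws(1,2)[OF L CL CL CL] lattice_laws(3,4)[OF L CL CL]
  note from_ops = lattice_from_operations[of C "join L" "meet L", folded sublattice_def]
  show "lattice (sublattice L C)"
    by (rule from_ops) ((rule join_comm meet_comm | simp add: closed laws)+)
  show "x \<squnion>\<^bsub>sublattice L C\<^esub> y = x \<squnion>\<^bsub>L\<^esub> y" if "x \<in> C" "y \<in> C" for x y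
    by (rule from_ops) ((rule join_comm meet_comm | simp add: closed laws that)+)
  show "x \<sqinter>\<^bsub>sublattice L C\<^esub> y = x \<sqinter>\<^bsub>L\<^esub> y" if "x \<in> C" "y \<in> C" for x y
    by (rule from_ops) ((rule join_comm meet_comm | simp add: closed laws that)+)
qed

lemma sublattice_in_variety:
  assumes L: "L \<in> lattice_variety E" and C: "C \<subseteq> carrier L"
    and closed: "\<And>x y. \<lbrakk>x \<in> C; y \<in> C\<rbrakk> \<Longrightarrow> x \<squnion>\<^bsub>L\<^esub> y \<in> C" "\<And>x y. \<lbrakk>x \<in> C; y \<in> C\<rbrakk> \<Longrightarrow> x \<sqinter>\<^bsub>L\<^esub> y \<in> C"
  shows "sublattice L C \<in> lattice_variety E"
proof -
  have lat: "lattice L"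
    using L by (simp add: lattice_variety_def)
  note sub = sublattice[OF lat C closed]
  have ev: "lattice_eval (sublattice L C) \<rho> t = lattice_eval L \<rho> t \<and> lattice_eval L \<rho> t \<in> C"
    if "\<rho> \<in> UNIV \<rightarrow> C" for \<rho> :: "nat \<Rightarrow> 'a" and t
    by (induction t) (use that closed sub(2,3) in auto)
  have "lattice_eval (sublattice L C) \<rho> s = lattice_eval (sublattice L C) \<rho> t"
    if "(s, t) \<in> E" "\<rho> \<in> UNIV \<rightarrow> C" for s t \<rho>
  proof -
    have "\<rho> \<in> UNIV \<rightarrow> carrier L"
      using that(2) C by blast
    then have "lattice_eval L \<rho> s = lattice_eval L \<rho> t"
      using L that(1) unfolding lattice_variety_def by blast
    then show ?thesis
      using ev[OF that(2)] by simp
  qed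
  then show ?thesis
    using sub(1) unfolding lattice_variety_def by auto
qed

lemma bounded_sublattice:
  assumes L: "lattice L" and C: "C \<subseteq> carrier L"
    and closed: "\<And>x y. \<lbrakk>x \<in> C; y \<in> C\<rbrakk> \<Longrightarrow> x \<squnion>\<^bsub>L\<^esub> y \<in> C" "\<And>x y. \<lbrakk>x \<in> C; y \<in> C\<rbrakk> \<Longrightarrow> x \<sqinter>\<^bsub>L\<^esub> y \<in> C"
    and p: "p \<in> C" "\<And>x. x \<in> C \<Longrightarrow> p \<sqsubseteq>\<^bsub>L\<^esub> x" and q: "q \<in> C" "\<And>x. x \<in> C \<Longrightarrow> x \<sqsubseteq>\<^bsub>L\<^esub> q"
  shows "bounded_lattice (sublattice L C)" "\<bottom>\<^bsub>sublattice L C\<^esub> = p" "\<top>\<^bsub>sublattice L C\<^esub> = q"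
proof -
  interpret L: lattice L by fact
  let ?S = "sublattice L C"
  interpret S: lattice ?S by (rule sublattice[OF L C closed])
  have le: "x \<sqsubseteq>\<^bsub>?S\<^esub> y \<longleftrightarrow> x \<sqsubseteq>\<^bsub>L\<^esub> y" if "x \<in> C" "y \<in> C" for x y
    using that C L.le_iff_meet[of x y] by (auto simp: sublattice_def)
  have bot: "p \<in> carrier ?S" "\<And>x. x \<in> carrier ?S \<Longrightarrow> p \<sqsubseteq>\<^bsub>?S\<^esub> x"
    using p by (simp_all add: le)
  have top: "q \<in> carrier ?S" "\<And>x. x \<in> carrier ?S \<Longrightarrow> x \<sqsubseteq>\<^bsub>?S\<^esub> q"
    using q by (simp_all add: le)
  show b: "bounded_lattice ?S"
  proof unfold_locales
    show "\<exists>x. least ?S x (carrier ?S)" using bot by (auto simp: least_def)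
    show "\<exists>x. greatest ?S x (carrier ?S)" using top by (auto simp: greatest_def)
  qed
  interpret bounded_lattice ?S by fact
  show "\<bottom>\<^bsub>?S\<^esub> = p" "\<top>\<^bsub>?S\<^esub> = q"
    using bottom_eq[OF bot] top_eq[OF top] by auto
qed

context lattice
begin

lemma join_mono: "\<lbrakk>a \<sqsubseteq> b; c \<sqsubseteq> d; a \<in> carrier L; b \<in> carrier L; c \<in> carrier L; d \<in> carrier L\<rbrakk> \<Longrightarrow> a \<squnion> c \<sqsubseteq> b \<squnion> d"
  by (meson join_closed join_le join_left join_right le_trans)

lemma meet_mono: "\<lbrakk>a \<sqsubseteq> b; c \<sqsubseteq> d; a \<in> carrier L; b \<in> carrier L; c \<in> carrier L; d \<in> carrier L\<rbrakk> \<Longrightarrow> a \<sqinter> c \<sqsubseteq> b \<sqinter> d"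
  by (meson meet_closed meet_le meet_left meet_right le_trans)

lemma le_joinI1: "\<lbrakk>a \<sqsubseteq> b; a \<in> carrier L; b \<in> carrier L; c \<in> carrier L\<rbrakk> \<Longrightarrow> a \<sqsubseteq> b \<squnion> c"
  by (meson join_closed join_left le_trans)

lemma le_joinI2: "\<lbrakk>a \<sqsubseteq> c; a \<in> carrier L; b \<in> carrier L; c \<in> carrier L\<rbrakk> \<Longrightarrow> a \<sqsubseteq> b \<squnion> c"
  by (meson join_closed join_right le_trans)

lemma meet_leI1: "\<lbrakk>a \<sqsubseteq> c; a \<in> carrier L; b \<in> carrier L; c \<in> carrier L\<rbrakk> \<Longrightarrow> a \<sqinter> b \<sqsubseteq> c"
  by (meson meet_closed meet_left le_trans)

lemma meet_leI2: "\<lbrakk>b \<sqsubseteq> c; a \<in> carrier L; b \<in> carrier L; c \<in> carrier L\<rbrakk> \<Longrightarrow> a \<sqinter> b \<sqsubseteq> c"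
  by (meson meet_closed meet_right le_trans)

lemmas order_intros = le_refl join_left join_right meet_left meet_right le_joinI1 le_joinI2 meet_leI1 meet_leI2
lemmas order_safe_intros = join_le meet_le join_closed meet_closed

lemma join_absorb2: "\<lbrakk>a \<sqsubseteq> b; a \<in> carrier L; b \<in> carrier L\<rbrakk> \<Longrightarrow> a \<squnion> b = b"
  using le_iff_meet by blast

lemma meet_absorb1: "\<lbrakk>a \<sqsubseteq> b; a \<in> carrier L; b \<in> carrier L\<rbrakk> \<Longrightarrow> a \<sqinter> b = a"
  using le_iff_join by metis

text \<open>
  Both sides of the modular law are comparable and have the same join and the same meet with
  \<open>b\<close>; cancellation identifies them.
\<close>

lemma cancellation_imp_modular:
  assumes canc: "\<And>x y z. \<lbrakk>x \<in> carrier L; y \<in> carrier L; z \<in> carrier L; x \<squnion> y = z \<squnion> y; x \<sqinter> y = z \<sqinter> y\<rbrakk> \<Longrightarrow> x = z"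
    and carr [simp]: "a \<in> carrier L" "b \<in> carrier L" "c \<in> carrier L" and ac: "a \<sqsubseteq> c"
  shows "a \<squnion> (b \<sqinter> c) = (a \<squnion> b) \<sqinter> c"
proof (rule canc[of _ b])
  let ?p = "a \<squnion> (b \<sqinter> c)" and ?q = "(a \<squnion> b) \<sqinter> c"
  have pq: "?p \<sqsubseteq> ?q"
    using carr ac by (blast intro!: order_safe_intros intro: order_intros)
  show "?p \<squnion> b = ?q \<squnion> b"
  proof (rule le_antisym)
    show "?p \<squnion> b \<sqsubseteq> ?q \<squnion> b"
      using pq by (intro join_mono) auto
    have "?q \<squnion> b \<sqsubseteq> a \<squnion> b"
      using carr by (blast intro!: order_safe_intros intro: order_intros)
    moreover have "a \<squnion> b \<sqsubseteq> ?p \<squnion> b"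
      using carr by (blast intro!: order_safe_intros intro: order_intros)
    ultimately show "?q \<squnion> b \<sqsubseteq> ?p \<squnion> b"
      by (rule le_trans) auto
  qed auto
  show "?p \<sqinter> b = ?q \<sqinter> b"
  proof (rule le_antisym)
    show "?p \<sqinter> b \<sqsubseteq> ?q \<sqinter> b"
      using pq by (intro meet_mono) auto
    have "?q \<sqinter> b \<sqsubseteq> b \<sqinter> c"
      using carr by (blast intro!: order_safe_intros intro: order_intros)
    moreover have "b \<sqinter> c \<sqsubseteq> ?p \<sqinter> b"
      using carr by (blast intro!: order_safe_intros intro: order_intros)
    ultimately show "?q \<sqinter> b \<sqsubseteq> ?p \<sqinter> b"
      by (rule le_trans) auto
  qed auto
qed auto

text \<open>
  Let \<open>d\<close> and \<open>e\<close> be the join of the pairwise meets and the meet of the pairwise joins of \<open>x\<close>, \<open>y\<close>,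
  \<open>z\<close>.  In a modular lattice the three elements \<open>med u = d \<squnion> (u \<sqinter> e)\<close> have pairwise join \<open>e\<close> and
  pairwise meet \<open>d\<close>: they form a diamond, possibly a degenerate one.  Cancellation identifies
  \<open>med x\<close> with \<open>med z\<close>, the diamond collapses to \<open>d = e\<close>, and distributivity is what one gets by
  meeting this equation with \<open>x\<close>.
\<close>

lemma cancellation_imp_distributive:
  assumes canc: "\<And>x y z. \<lbrakk>x \<in> carrier L; y \<in> carrier L; z \<in> carrier L; x \<squnion> y = z \<squnion> y; x \<sqinter> y = z \<sqinter> y\<rbrakk> \<Longrightarrow> x = z"
    and x: "x \<in> carrier L" and y: "y \<in> carrier L" and z: "z \<in> carrier L"
  shows "x \<sqinter> (y \<squnion> z) = (x \<sqinter> y) \<squnion> (x \<sqinter> z)"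
proof -
  have modular: "a \<squnion> (b \<sqinter> c) = (a \<squnion> b) \<sqinter> c"
    if "a \<in> carrier L" "b \<in> carrier L" "c \<in> carrier L" "a \<sqsubseteq> c" for a b c
    by (rule cancellation_imp_modular[OF canc that])
  have lat: "lattice L" ..
  note L [simp] = x y z
  define d where "d = (y \<sqinter> z) \<squnion> ((z \<sqinter> x) \<squnion> (x \<sqinter> y))"
  define e where "e = (y \<squnion> z) \<sqinter> ((z \<squnion> x) \<sqinter> (x \<squnion> y))"
  have [simp]: "d \<in> carrier L" "e \<in> carrier L"
    by (simp_all add: d_def e_def)
  have "d \<sqsubseteq> e"
    unfolding d_def e_def using L by (blast intro!: order_safe_intros intro: order_intros)
  \<comment> \<open>The cyclic symmetry of the data lets the two computations below serve all pairs of medians;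
    the second one is the dual of the first, with the other form of the median.\<close>
  have join_e: "(u \<sqinter> (v \<squnion> w)) \<squnion> (v \<sqinter> (w \<squnion> u)) = (v \<squnion> w) \<sqinter> ((w \<squnion> u) \<sqinter> (u \<squnion> v))"
    if uvw [simp]: "u \<in> carrier L" "v \<in> carrier L" "w \<in> carrier L" for u v w
  proof -
    have "(u \<sqinter> (v \<squnion> w)) \<squnion> (v \<sqinter> (w \<squnion> u)) = (v \<sqinter> (w \<squnion> u)) \<squnion> (u \<sqinter> (v \<squnion> w))"
      by (simp add: join_comm)
    also have "\<dots> = ((v \<sqinter> (w \<squnion> u)) \<squnion> u) \<sqinter> (v \<squnion> w)"
      using uvw by (intro modular) (blast intro!: order_safe_intros intro: order_intros)+
    also have "(v \<sqinter> (w \<squnion> u)) \<squnion> u = u \<squnion> (v \<sqinter> (w \<squnion> u))"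
      by (rule join_comm)
    also have "\<dots> = (u \<squnion> v) \<sqinter> (w \<squnion> u)"
      using uvw by (intro modular) (blast intro!: order_safe_intros intro: order_intros)+
    finally show ?thesis
      using lattice_laws(2)[OF lat] by (simp add: meet_comm)
  qed
  have meet_d: "(u \<squnion> (v \<sqinter> w)) \<sqinter> (v \<squnion> (w \<sqinter> u)) = (v \<sqinter> w) \<squnion> ((w \<sqinter> u) \<squnion> (u \<sqinter> v))"
    if uvw [simp]: "u \<in> carrier L" "v \<in> carrier L" "w \<in> carrier L" for u v w
  proof -
    have "(u \<squnion> (v \<sqinter> w)) \<sqinter> (v \<squnion> (w \<sqinter> u)) = ((v \<sqinter> w) \<squnion> u) \<sqinter> (v \<squnion> (w \<sqinter> u))"
      by (simp add: join_comm)
    also have "\<dots> = (v \<sqinter> w) \<squnion> (u \<sqinter> (v \<squnion> (w \<sqinter> u)))"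
      using uvw by (intro modular[symmetric]) (blast intro!: order_safe_intros intro: order_intros)+
    also have "u \<sqinter> (v \<squnion> (w \<sqinter> u)) = ((w \<sqinter> u) \<squnion> v) \<sqinter> u"
      by (simp add: join_comm meet_comm)
    also have "\<dots> = (w \<sqinter> u) \<squnion> (v \<sqinter> u)"
      using uvw by (intro modular[symmetric]) (blast intro!: order_safe_intros intro: order_intros)+
    also have "v \<sqinter> u = u \<sqinter> v"
      by (rule meet_comm)
    finally show ?thesis .
  qed
  have perm: "(z \<squnion> x) \<sqinter> ((x \<squnion> y) \<sqinter> (y \<squnion> z)) = e" "(z \<sqinter> x) \<squnion> ((x \<sqinter> y) \<squnion> (y \<sqinter> z)) = d"
    "(x \<squnion> y) \<sqinter> ((y \<squnion> z) \<sqinter> (z \<squnion> x)) = e" "(x \<sqinter> y) \<squnion> ((y \<sqinter> z) \<squnion> (z \<sqinter> x)) = d"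
    unfolding d_def e_def using lattice_laws(1,2)[OF lat]
    by (metis L join_closed meet_closed join_comm meet_comm)+
  define med where "med u = d \<squnion> (u \<sqinter> e)" for u
  have med_closed [simp]: "med u \<in> carrier L" if "u \<in> carrier L" for u
    using that by (simp add: med_def)
  have med': "med u = (d \<squnion> u) \<sqinter> e" if "u \<in> carrier L" for u
    unfolding med_def by (rule modular) (use that \<open>d \<sqsubseteq> e\<close> in auto)
  have ue: "u \<sqinter> e = u \<sqinter> (v \<squnion> w)" and du: "d \<squnion> u = u \<squnion> (v \<sqinter> w)"
    if uvw: "(u, v, w) = (x, y, z) \<or> (u, v, w) = (y, z, x) \<or> (u, v, w) = (z, x, y)" for u v w
  proof -
    have carr [simp]: "u \<in> carrier L" "v \<in> carrier L" "w \<in> carrier L"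
      using uvw by auto
    have e: "e = (v \<squnion> w) \<sqinter> ((w \<squnion> u) \<sqinter> (u \<squnion> v))" and d: "d = (v \<sqinter> w) \<squnion> ((w \<sqinter> u) \<squnion> (u \<sqinter> v))"
      using uvw perm by (auto simp: d_def e_def)
    show "u \<sqinter> e = u \<sqinter> (v \<squnion> w)"
      unfolding e
      using carr by (intro le_antisym) (blast intro!: order_safe_intros intro: order_intros)+
    show "d \<squnion> u = u \<squnion> (v \<sqinter> w)"
      unfolding d
      using carr by (intro le_antisym) (blast intro!: order_safe_intros intro: order_intros)+
  qed
  have med_join: "med u \<squnion> med v = e" and med_meet: "med u \<sqinter> med v = d"
    if uvw: "(u, v, w) = (x, y, z) \<or> (u, v, w) = (y, z, x) \<or> (u, v, w) = (z, x, y)" for u v w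
  proof -
    have carr [simp]: "u \<in> carrier L" "v \<in> carrier L" "w \<in> carrier L"
      using uvw by auto
    have vwu: "(v, w, u) = (x, y, z) \<or> (v, w, u) = (y, z, x) \<or> (v, w, u) = (z, x, y)"
      using uvw by auto
    have e: "(v \<squnion> w) \<sqinter> ((w \<squnion> u) \<sqinter> (u \<squnion> v)) = e" and d: "(v \<sqinter> w) \<squnion> ((w \<sqinter> u) \<squnion> (u \<sqinter> v)) = d"
      using uvw perm by (auto simp: d_def e_def)
    have "med u \<squnion> med v = d \<squnion> ((u \<sqinter> e) \<squnion> (v \<sqinter> e))"
      unfolding med_def
      using carr \<open>d \<in> carrier L\<close> \<open>e \<in> carrier L\<close>
      by (intro le_antisym) (blast intro!: order_safe_intros intro: order_intros)+
    also have "(u \<sqinter> e) \<squnion> (v \<sqinter> e) = e"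
      unfolding ue[OF uvw] ue[OF vwu] using join_e[of u v w] e by simp
    finally show "med u \<squnion> med v = e"
      using join_absorb2[OF \<open>d \<sqsubseteq> e\<close>] by simp
    have "med u \<sqinter> med v = ((d \<squnion> u) \<sqinter> (d \<squnion> v)) \<sqinter> e"
      unfolding med'[OF \<open>u \<in> carrier L\<close>] med'[OF \<open>v \<in> carrier L\<close>]
      using carr \<open>d \<in> carrier L\<close> \<open>e \<in> carrier L\<close>
      by (intro le_antisym) (blast intro!: order_safe_intros intro: order_intros)+
    also have "(d \<squnion> u) \<sqinter> (d \<squnion> v) = d"
      unfolding du[OF uvw] du[OF vwu] using meet_d[of u v w] d by simp
    finally show "med u \<sqinter> med v = d"
      using meet_absorb1[OF \<open>d \<sqsubseteq> e\<close>] by simp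
  qed
  have "med x = med z"
  proof (rule canc[of _ "med y"])
    show "med x \<squnion> med y = med z \<squnion> med y" "med x \<sqinter> med y = med z \<sqinter> med y"
      using med_join[of x y z] med_join[of y z x] med_meet[of x y z] med_meet[of y z x]
      by (simp_all add: join_comm[of L "med y"] meet_comm[of L "med y"])
  qed auto
  then have "e = d"
    using med_join[of z x y] med_meet[of z x y]
      join_absorb2[of "med z" "med z"] meet_absorb1[of "med z" "med z"]
    by simp
  have "x \<sqinter> (y \<squnion> z) = x \<sqinter> d"
    using ue[of x y z] \<open>e = d\<close> by simp
  also have "\<dots> = (((x \<sqinter> y) \<squnion> (x \<sqinter> z)) \<squnion> (y \<sqinter> z)) \<sqinter> x"
    unfolding d_def using lattice_laws(1)[OF lat] by (metis L join_closed meet_closed join_comm meet_comm)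
  also have "\<dots> = ((x \<sqinter> y) \<squnion> (x \<sqinter> z)) \<squnion> ((y \<sqinter> z) \<sqinter> x)"
    using L by (intro modular[symmetric]) (blast intro!: order_safe_intros intro: order_intros)+
  also have "\<dots> = (x \<sqinter> y) \<squnion> (x \<sqinter> z)"
    using L by (intro le_antisym) (blast intro!: order_safe_intros intro: order_intros)+
  finally show ?thesis .
qed

end

text \<open>
  A failure of cancellation is a pair \<open>x\<close>, \<open>z\<close> of elements with the same join and the same meet
  with \<open>y\<close>; the interval between that meet and that join is a bounded lattice of the variety in
  which \<open>y\<close> is a complement of both.  This replaces the usual embedding of the diamond or the
  pentagon, and treats the two at once.
\<close>

lemma nondistributive_interval:
  fixes L :: "'a gorder"
  assumes L: "L \<in> lattice_variety E" and nd: "\<not> distributive_lattice L"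
  obtains M :: "'a gorder" and x y z where "M \<in> lattice_variety E" "bounded_lattice M"
    "x \<in> carrier M" "y \<in> carrier M" "z \<in> carrier M"
    "x \<squnion>\<^bsub>M\<^esub> y = \<top>\<^bsub>M\<^esub>" "z \<squnion>\<^bsub>M\<^esub> y = \<top>\<^bsub>M\<^esub>" "x \<sqinter>\<^bsub>M\<^esub> y = \<bottom>\<^bsub>M\<^esub>" "z \<sqinter>\<^bsub>M\<^esub> y = \<bottom>\<^bsub>M\<^esub>"
    "\<not> z \<sqsubseteq>\<^bsub>M\<^esub> x"
proof -
  have lat: "lattice L"
    using L by (simp add: lattice_variety_def)
  interpret lattice L by fact
  have "\<exists>x y z. x \<in> carrier L \<and> y \<in> carrier L \<and> z \<in> carrier L \<and> x \<squnion>\<^bsub>L\<^esub> y = z \<squnion>\<^bsub>L\<^esub> y \<and>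
      x \<sqinter>\<^bsub>L\<^esub> y = z \<sqinter>\<^bsub>L\<^esub> y \<and> x \<noteq> z"
  proof (rule ccontr)
    assume *: "\<not> ?thesis"
    have "distributive_lattice L"
      unfolding distributive_lattice_def
      by (intro conjI lat ballI cancellation_imp_distributive) (use * in blast)+
    with nd show False ..
  qed
  then obtain x y z where L: "x \<in> carrier L" "y \<in> carrier L" "z \<in> carrier L"
    and xyz: "x \<squnion>\<^bsub>L\<^esub> y = z \<squnion>\<^bsub>L\<^esub> y" "x \<sqinter>\<^bsub>L\<^esub> y = z \<sqinter>\<^bsub>L\<^esub> y" and neq: "\<not> z \<sqsubseteq>\<^bsub>L\<^esub> x"
    using le_antisym by metis
  define p q where "p = x \<sqinter>\<^bsub>L\<^esub> y" and "q = x \<squnion>\<^bsub>L\<^esub> y"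
  have pq: "p \<in> carrier L" "q \<in> carrier L"
    using L by (simp_all add: p_def q_def)
  define C where "C = {u \<in> carrier L. p \<sqsubseteq>\<^bsub>L\<^esub> u \<and> u \<sqsubseteq>\<^bsub>L\<^esub> q}"
  have C: "C \<subseteq> carrier L"
    by (auto simp: C_def)
  have closed: "u \<squnion>\<^bsub>L\<^esub> v \<in> C" "u \<sqinter>\<^bsub>L\<^esub> v \<in> C" if "u \<in> C" "v \<in> C" for u v
    using that pq by (auto simp: C_def intro: join_le meet_le le_joinI1 meet_leI1)
  have inC: "x \<in> C" "y \<in> C" "z \<in> C" "p \<in> C" "q \<in> C"
    using L pq xyz join_left[OF L(3,2)] meet_left[OF L(3,2)] join_left[OF L(1,2)] meet_left[OF L(1,2)]
      join_right[OF L(1,2)] meet_right[OF L(1,2)]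
    by (auto simp: C_def p_def q_def intro: le_joinI1 meet_leI1)
  have bounds: "\<And>u. u \<in> C \<Longrightarrow> p \<sqsubseteq>\<^bsub>L\<^esub> u" "\<And>u. u \<in> C \<Longrightarrow> u \<sqsubseteq>\<^bsub>L\<^esub> q"
    by (auto simp: C_def)
  note sub = sublattice[OF lat C closed]
  note bsub = bounded_sublattice[OF lat C closed inC(4) bounds(1) inC(5) bounds(2)]
  show thesis
  proof (rule that[of "sublattice L C" x y z])
    show "sublattice L C \<in> lattice_variety E"
      by (rule sublattice_in_variety[OF assms(1) C closed])
    show "bounded_lattice (sublattice L C)"
      by (rule bsub)
    show "\<not> z \<sqsubseteq>\<^bsub>sublattice L C\<^esub> x"
      using neq L le_iff_meet[of z x] by (simp add: sublattice_def)
  qed (use inC in \<open>simp_all add: sub bsub flip: xyz, simp_all add: p_def q_def\<close>)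
qed

section \<open>Homomorphisms and the dimension monoid\<close>

text \<open>
  For a lattice homomorphism \<open>h\<close>, the congruences of the pairs \<open>(a, b)\<close> in the multiset lie below the
  kernel of \<open>h\<close>.  Testing homomorphisms instead of comparing congruences is how the images of
  elements of \<open>Dim F\<close> in \<open>Con F\<close> are handled here.
\<close>

definition collapses :: "('a \<Rightarrow> 'b) \<Rightarrow> ('a \<times> 'a) multiset \<Rightarrow> bool" where
  "collapses h m \<longleftrightarrow> (\<forall>(a, b)\<in>set_mset m. h a = h b)"

lemma collapses_simps [simp]:
  "collapses h {#}" "collapses h (add_mset (a, b) m) \<longleftrightarrow> h a = h b \<and> collapses h m"
  "collapses h (m + n) \<longleftrightarrow> collapses h m \<and> collapses h n"
  by (auto simp: collapses_def)

text \<open>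
  (D1) preserves the property because \<open>h\<close> is isotone, and (D2) because, in the codomain,
  \<open>h a = h a \<squnion> h b\<close> and \<open>h a \<sqinter> h b = h b\<close> both say that \<open>h b\<close> is below \<open>h a\<close>.
\<close>

lemma collapses_dim_cong:
  assumes F: "lattice F" and M: "lattice M" and hM: "\<And>a. a \<in> carrier F \<Longrightarrow> h a \<in> carrier M"
    and hj: "\<And>a b. \<lbrakk>a \<in> carrier F; b \<in> carrier F\<rbrakk> \<Longrightarrow> h (a \<squnion>\<^bsub>F\<^esub> b) = h a \<squnion>\<^bsub>M\<^esub> h b"
    and hm: "\<And>a b. \<lbrakk>a \<in> carrier F; b \<in> carrier F\<rbrakk> \<Longrightarrow> h (a \<sqinter>\<^bsub>F\<^esub> b) = h a \<sqinter>\<^bsub>M\<^esub> h b"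
    and "dim_cong F m n"
  shows "collapses h m \<longleftrightarrow> collapses h n"
proof -
  interpret F: lattice F by fact
  interpret M: lattice M by fact
  have mono: "h a \<sqsubseteq>\<^bsub>M\<^esub> h b" if "a \<in> carrier F" "b \<in> carrier F" "a \<sqsubseteq>\<^bsub>F\<^esub> b" for a b
    using that hj[of a b] hM F.le_iff_meet[of a b] M.le_iff_meet[of "h a" "h b"] by simp
  show ?thesis
    using assms(6)
  proof induction
    case (D1 a b c)
    have "h a = h c \<longleftrightarrow> h a = h b \<and> h b = h c"
      using mono[of a b] mono[of b c] D1 hM by (metis M.le_antisym)
    then show ?case by (simp add: conj_commute)
  next
    case (D2 a b)
    have "h a = h a \<squnion>\<^bsub>M\<^esub> h b \<longleftrightarrow> h a \<sqinter>\<^bsub>M\<^esub> h b = h b"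
      using D2 hM M.le_iff_meet[of "h b" "h a"] M.le_iff_join[of "h b" "h a"]
      by (metis join_comm meet_comm)
    then show ?case
      using D2 by (simp add: hj hm)
  qed auto
qed

definition annihilates :: "('a \<Rightarrow> 'b) \<Rightarrow> ('a \<times> 'a) multiset set \<Rightarrow> bool" where
  "annihilates h \<alpha> \<longleftrightarrow> (\<forall>m\<in>\<alpha>. collapses h m)"

lemma dimension_monoid_carrierE:
  assumes "\<alpha> \<in> carrier (dimension_monoid F)"
  obtains m where "set_mset m \<subseteq> dim_generators F" "\<alpha> = dim_class F m"
  using assms by (auto simp: dimension_monoid_def)

lemma dim_class_in_carrier:
  "set_mset m \<subseteq> dim_generators F \<Longrightarrow> dim_class F m \<in> carrier (dimension_monoid F)"
  by (auto simp: dimension_monoid_def)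

lemma dim_interval_sum:
  assumes F: "lattice F" and abc: "a \<in> carrier F" "b \<in> carrier F" "c \<in> carrier F" "a \<sqsubseteq>\<^bsub>F\<^esub> b" "b \<sqsubseteq>\<^bsub>F\<^esub> c"
  shows "dim_class F {#(a, b)#} \<otimes>\<^bsub>dimension_monoid F\<^esub> dim_class F {#(b, c)#} = dim_class F {#(a, c)#}"
proof -
  have gen: "set_mset {#(a, b)#} \<subseteq> dim_generators F" "set_mset {#(b, c)#} \<subseteq> dim_generators F"
    using abc by (auto simp: dim_generators_def)
  have "dim_cong F {#(a, c)#} ({#(a, b)#} + {#(b, c)#})"
    using abc by (intro D1)
  then have "dim_class F ({#(a, b)#} + {#(b, c)#}) = dim_class F {#(a, c)#}"
    using gen dim_class_eq_iff[of "{#(a, b)#} + {#(b, c)#}" F "{#(a, c)#}"] dim_sym by fastforce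
  then show ?thesis
    using dim_class_mult[OF gen] by simp
qed

text \<open>
  Each generator \<open>\<Delta>(a, b)\<close> is a summand of \<open>\<Delta>(0, 1) = \<Delta>(0, a) + \<Delta>(a, b) + \<Delta>(b, 1)\<close>.
\<close>

lemma order_unit_dimension_monoid:
  assumes "bounded_lattice F"
  shows "order_unit (dimension_monoid F) (dim_class F {#(\<bottom>\<^bsub>F\<^esub>, \<top>\<^bsub>F\<^esub>)#})"
proof -
  interpret F: bounded_lattice F by fact
  have F: "lattice F" ..
  let ?D = "dimension_monoid F"
  interpret D: comm_monoid ?D by (rule dimension_monoid_comm_monoid)
  let ?u = "dim_class F {#(\<bottom>\<^bsub>F\<^esub>, \<top>\<^bsub>F\<^esub>)#}"
  have u: "?u \<in> carrier ?D"
    by (rule dim_class_in_carrier) (simp add: dim_generators_def)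
  have "below ?D (dim_class F m) ?u" if "set_mset m \<subseteq> dim_generators F" for m
    using that
  proof (induction m)
    case empty
    have "dim_class F {#} = \<one>\<^bsub>?D\<^esub>"
      by (simp add: dimension_monoid_def)
    then show ?case
      by (intro belowI[of "\<one>\<^bsub>?D\<^esub>" _ _ _ 0]) simp_all
  next
    case (add p m)
    obtain a b where p: "p = (a, b)" "a \<in> carrier F" "b \<in> carrier F" "a \<sqsubseteq>\<^bsub>F\<^esub> b"
      using add.prems by (auto simp: dim_generators_def)
    have m: "set_mset m \<subseteq> dim_generators F"
      using add.prems by simp
    obtain n z where z: "z \<in> carrier ?D" "dim_class F m \<otimes>\<^bsub>?D\<^esub> z = ?u [^]\<^bsub>?D\<^esub> (n::nat)"
      using add.IH[OF m] by (auto simp: below_def)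
    have gen: "set_mset {#p#} \<subseteq> dim_generators F"
      using p by (simp add: dim_generators_def)
    define \<delta> where "\<delta> a b = dim_class F {#(a, b)#}" for a b
    have \<delta>: "\<delta> \<bottom>\<^bsub>F\<^esub> a \<in> carrier ?D" "\<delta> a b \<in> carrier ?D" "\<delta> b \<top>\<^bsub>F\<^esub> \<in> carrier ?D" "dim_class F m \<in> carrier ?D"
      unfolding \<delta>_def using p m by (auto intro!: dim_class_in_carrier simp: dim_generators_def)
    have ab: "\<delta> \<bottom>\<^bsub>F\<^esub> a \<otimes>\<^bsub>?D\<^esub> \<delta> a b = \<delta> \<bottom>\<^bsub>F\<^esub> b" "\<delta> \<bottom>\<^bsub>F\<^esub> b \<otimes>\<^bsub>?D\<^esub> \<delta> b \<top>\<^bsub>F\<^esub> = ?u"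
      unfolding \<delta>_def using p by (simp_all add: dim_interval_sum[OF F])
    have "dim_class F (add_mset p m) = dim_class F m \<otimes>\<^bsub>?D\<^esub> \<delta> a b"
      using dim_class_mult[OF m gen] by (simp add: \<delta>_def p(1))
    then have "dim_class F (add_mset p m) \<otimes>\<^bsub>?D\<^esub> (z \<otimes>\<^bsub>?D\<^esub> (\<delta> \<bottom>\<^bsub>F\<^esub> a \<otimes>\<^bsub>?D\<^esub> \<delta> b \<top>\<^bsub>F\<^esub>)) =
        (dim_class F m \<otimes>\<^bsub>?D\<^esub> z) \<otimes>\<^bsub>?D\<^esub> ((\<delta> \<bottom>\<^bsub>F\<^esub> a \<otimes>\<^bsub>?D\<^esub> \<delta> a b) \<otimes>\<^bsub>?D\<^esub> \<delta> b \<top>\<^bsub>F\<^esub>)"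
      using \<delta> z(1) by (simp add: D.m_ac)
    also have "\<dots> = ?u [^]\<^bsub>?D\<^esub> Suc n"
      by (simp add: z(2) ab)
    finally have sum: "dim_class F (add_mset p m) \<otimes>\<^bsub>?D\<^esub> (z \<otimes>\<^bsub>?D\<^esub> (\<delta> \<bottom>\<^bsub>F\<^esub> a \<otimes>\<^bsub>?D\<^esub> \<delta> b \<top>\<^bsub>F\<^esub>)) =
        ?u [^]\<^bsub>?D\<^esub> Suc n" .
    show ?case
      by (rule belowI[OF _ sum]) (use \<delta> z(1) in simp)
  qed
  then have "below ?D \<alpha> ?u" if "\<alpha> \<in> carrier ?D" for \<alpha>
    using that by (elim dimension_monoid_carrierE) simp
  then show ?thesis
    using u by (simp add: order_unit_def)
qed

locale lattice_homomorphism =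
  fixes F :: "'f gorder" and M :: "'m gorder" and h :: "'f \<Rightarrow> 'm"
  assumes F: "bounded_lattice F" and M: "bounded_lattice M" and h: "h \<in> bounded_lattice_hom F M"
begin

lemma annihilates_class:
  assumes "set_mset m \<subseteq> dim_generators F"
  shows "annihilates h (dim_class F m) \<longleftrightarrow> collapses h m"
proof -
  interpret F: bounded_lattice F by (rule F)
  interpret M: bounded_lattice M by (rule M)
  have "lattice F" "lattice M" ..
  then have "collapses h m \<longleftrightarrow> collapses h n" if "dim_cong F m n" for n
    using bounded_lattice_homD(1-3)[OF h] that by (rule collapses_dim_cong)
  then show ?thesis
    using dim_refl[OF assms] unfolding annihilates_def dim_class_def by blast
qed

lemma annihilates_interval:
  assumes "a \<in> carrier F" "b \<in> carrier F" "a \<sqsubseteq>\<^bsub>F\<^esub> b"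
  shows "annihilates h (dim_class F {#(a, b)#}) \<longleftrightarrow> h a = h b"
  using assms by (subst annihilates_class) (simp_all add: dim_generators_def)

lemma annihilates_mult:
  assumes "\<alpha> \<in> carrier (dimension_monoid F)" "\<beta> \<in> carrier (dimension_monoid F)"
  shows "annihilates h (\<alpha> \<otimes>\<^bsub>dimension_monoid F\<^esub> \<beta>) \<longleftrightarrow> annihilates h \<alpha> \<and> annihilates h \<beta>"
proof -
  obtain m n where mn: "set_mset m \<subseteq> dim_generators F" "\<alpha> = dim_class F m"
    "set_mset n \<subseteq> dim_generators F" "\<beta> = dim_class F n"
    using assms dimension_monoid_carrierE by metis
  then have "set_mset (m + n) \<subseteq> dim_generators F"
    by simp
  then show ?thesis
    using mn by (simp add: dim_class_mult annihilates_class del: set_mset_union)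
qed

text \<open>
  For a fixed \<open>h\<close>, being annihilated is an additive test with values in a two-element semilattice,
  and such tests only see the maximal semilattice quotient.
\<close>

lemma annihilates_below:
  assumes \<alpha>: "\<alpha> \<in> carrier (dimension_monoid F)" and \<beta>: "\<beta> \<in> carrier (dimension_monoid F)"
    and "below (dimension_monoid F) \<alpha> \<beta>" "annihilates h \<beta>"
  shows "annihilates h \<alpha>"
proof -
  let ?D = "dimension_monoid F"
  interpret D: comm_monoid ?D by (rule dimension_monoid_comm_monoid)
  obtain n z where z: "z \<in> carrier ?D" "\<alpha> \<otimes>\<^bsub>?D\<^esub> z = \<beta> [^]\<^bsub>?D\<^esub> (n::nat)"
    using assms(3) by (auto simp: below_def)
  have "annihilates h \<one>\<^bsub>?D\<^esub>"
    using annihilates_class[of "{#}"] by (simp add: dimension_monoid_def)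
  then have "annihilates h (\<beta> [^]\<^bsub>?D\<^esub> n)"
    using assms(4) \<beta> by (induction n) (simp_all add: annihilates_mult)
  then show ?thesis
    using annihilates_mult[OF \<alpha> z(1)] z(2) by simp
qed

lemma annihilates_order_unit:
  assumes "order_unit (dimension_monoid F) \<alpha>" "annihilates h \<alpha>"
  shows "\<bottom>\<^bsub>M\<^esub> = \<top>\<^bsub>M\<^esub>"
proof -
  interpret F: bounded_lattice F by (rule F)
  have u: "dim_class F {#(\<bottom>\<^bsub>F\<^esub>, \<top>\<^bsub>F\<^esub>)#} \<in> carrier (dimension_monoid F)"
    by (rule dim_class_in_carrier) (simp add: dim_generators_def)
  then have "annihilates h (dim_class F {#(\<bottom>\<^bsub>F\<^esub>, \<top>\<^bsub>F\<^esub>)#})"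
    using assms annihilates_below by (auto simp: order_unit_def)
  then have "h \<bottom>\<^bsub>F\<^esub> = h \<top>\<^bsub>F\<^esub>"
    by (simp add: annihilates_interval)
  then show ?thesis
    using bounded_lattice_homD(4,5)[OF h] by simp
qed

end

section \<open>Generators of free bounded lattices\<close>

inductive_set lattice_span :: "'a gorder \<Rightarrow> 'a set \<Rightarrow> 'a set" for F Y where
  span_base: "a \<in> Y \<Longrightarrow> a \<in> lattice_span F Y"
| span_bottom: "\<bottom>\<^bsub>F\<^esub> \<in> lattice_span F Y"
| span_top: "\<top>\<^bsub>F\<^esub> \<in> lattice_span F Y"
| span_join: "\<lbrakk>a \<in> lattice_span F Y; b \<in> lattice_span F Y\<rbrakk> \<Longrightarrow> a \<squnion>\<^bsub>F\<^esub> b \<in> lattice_span F Y"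
| span_meet: "\<lbrakk>a \<in> lattice_span F Y; b \<in> lattice_span F Y\<rbrakk> \<Longrightarrow> a \<sqinter>\<^bsub>F\<^esub> b \<in> lattice_span F Y"

lemma lattice_span_mono:
  assumes "Y \<subseteq> Z" "a \<in> lattice_span F Y"
  shows "a \<in> lattice_span F Z"
  using assms(2) by induction (use assms(1) in \<open>auto intro: lattice_span.intros\<close>)

lemma lattice_span_image_Un:
  "a \<in> lattice_span F (\<iota> ` Y) \<Longrightarrow> a \<in> lattice_span F (\<iota> ` (Y \<union> Z))"
  "a \<in> lattice_span F (\<iota> ` Z) \<Longrightarrow> a \<in> lattice_span F (\<iota> ` (Y \<union> Z))"
  by (erule lattice_span_mono[rotated]; blast)+

lemma lattice_span_closed:
  assumes "bounded_lattice F" "Y \<subseteq> carrier F" "a \<in> lattice_span F Y"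
  shows "a \<in> carrier F"
proof -
  interpret bounded_lattice F by fact
  show ?thesis using assms(3) by induction (use assms(2) in auto)
qed

lemma lattice_span_finite_support:
  assumes "a \<in> lattice_span F (\<iota> ` X)"
  shows "\<exists>Y\<subseteq>X. finite Y \<and> a \<in> lattice_span F (\<iota> ` Y)"
  using assms
proof induction
  case (span_base a)
  then obtain x where "x \<in> X" "a = \<iota> x" by blast
  then show ?case
    by (intro exI[of _ "{x}"]) (auto intro: lattice_span.span_base)
next
  case span_bottom
  show ?case by (intro exI[of _ "{}"]) (auto intro: lattice_span.span_bottom)
next
  case span_top
  show ?case by (intro exI[of _ "{}"]) (auto intro: lattice_span.span_top)
next
  case (span_join a b)
  then obtain Y Z where YZ: "Y \<subseteq> X" "finite Y" "a \<in> lattice_span F (\<iota> ` Y)"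
    "Z \<subseteq> X" "finite Z" "b \<in> lattice_span F (\<iota> ` Z)" by blast
  have "a \<in> lattice_span F (\<iota> ` (Y \<union> Z))" "b \<in> lattice_span F (\<iota> ` (Y \<union> Z))"
    using YZ(3,6) by (simp_all only: lattice_span_image_Un)
  then show ?case
    using YZ by (intro exI[of _ "Y \<union> Z"]) (auto intro: lattice_span.span_join)
next
  case (span_meet a b)
  then obtain Y Z where YZ: "Y \<subseteq> X" "finite Y" "a \<in> lattice_span F (\<iota> ` Y)"
    "Z \<subseteq> X" "finite Z" "b \<in> lattice_span F (\<iota> ` Z)" by blast
  have "a \<in> lattice_span F (\<iota> ` (Y \<union> Z))" "b \<in> lattice_span F (\<iota> ` (Y \<union> Z))"
    using YZ(3,6) by (simp_all only: lattice_span_image_Un)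
  then show ?case
    using YZ by (intro exI[of _ "Y \<union> Z"]) (auto intro: lattice_span.span_meet)
qed

lemma lattice_span_finite_support_set:
  assumes "finite A" "A \<subseteq> lattice_span F (\<iota> ` X)"
  shows "\<exists>Y\<subseteq>X. finite Y \<and> A \<subseteq> lattice_span F (\<iota> ` Y)"
  using assms
proof (induction A rule: finite_induct)
  case (insert a A)
  obtain Y where Y: "Y \<subseteq> X" "finite Y" "A \<subseteq> lattice_span F (\<iota> ` Y)"
    using insert.IH insert.prems by auto
  have "a \<in> lattice_span F (\<iota> ` X)"
    using insert.prems by simp
  from lattice_span_finite_support[OF this]
  obtain Z where Z: "Z \<subseteq> X" "finite Z" "a \<in> lattice_span F (\<iota> ` Z)"
    by auto
  have "insert a A \<subseteq> lattice_span F (\<iota> ` (Y \<union> Z))"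
    using Y(3) Z(3) lattice_span_image_Un[of _ F \<iota>] by (intro subsetI) blast
  then show ?case
    using Y Z by (intro exI[of _ "Y \<union> Z"]) auto
qed blast

text \<open>
  The sublattice spanned by the generators is itself a bounded lattice of the variety.  The
  homomorphism of \<open>F\<close> onto it that fixes the generators is, as a map into \<open>F\<close>, the identity, by the
  uniqueness part of the universal property.
\<close>

lemma free_bounded_lattice_spanned:
  fixes F :: "'f gorder"
  assumes "free_bounded_lattice E X F \<iota>"
  shows "carrier F = lattice_span F (\<iota> ` X)"
proof
  let ?S = "lattice_span F (\<iota> ` X)"
  have free: "free_bounded_lattice_wrt TYPE('f) E X F \<iota>"
    using assms by (simp add: free_bounded_lattice_def)
  then have F: "bounded_lattice F" "F \<in> lattice_variety E" "\<iota> \<in> X \<rightarrow> carrier F"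
    by (auto simp: free_bounded_lattice_wrt_def)
  interpret F: bounded_lattice F by fact
  have lat: "lattice F" ..
  have SF: "?S \<subseteq> carrier F"
    using lattice_span_closed[OF F(1)] F(3) by blast
  then show "?S \<subseteq> carrier F" .
  note closed = span_join[of _ F "\<iota> ` X"] span_meet[of _ F "\<iota> ` X"]
  note sub = sublattice[OF lat SF closed]
  have between: "\<bottom>\<^bsub>F\<^esub> \<sqsubseteq>\<^bsub>F\<^esub> a" "a \<sqsubseteq>\<^bsub>F\<^esub> \<top>\<^bsub>F\<^esub>" if "a \<in> ?S" for a
    using that SF by auto
  note bsub = bounded_sublattice[OF lat SF closed span_bottom between(1) span_top between(2)]
  have "\<iota> \<in> X \<rightarrow> carrier (sublattice F ?S)"
    by (auto intro: span_base)
  from free_bounded_lattice_wrtD(1)[OF free bsub(1) sublattice_in_variety[OF F(2) SF closed] this]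
  obtain h where h: "h \<in> bounded_lattice_hom F (sublattice F ?S)"
    "h \<in> extensional (carrier F)" "\<forall>x\<in>X. h (\<iota> x) = \<iota> x"
    by blast
  note hD = bounded_lattice_homD[OF h(1), unfolded carrier_sublattice]
  have hF: "h \<in> bounded_lattice_hom F F"
    by (rule bounded_lattice_homI[OF F(1) F(1)]) (use SF hD in \<open>auto simp: sub bsub\<close>)
  have id: "restrict (\<lambda>a. a) (carrier F) \<in> bounded_lattice_hom F F"
    by (rule bounded_lattice_homI) (simp_all add: F)
  have "h = restrict (\<lambda>a. a) (carrier F)"
    by (rule free_bounded_lattice_wrtD(2)[OF free F hF h(2,3) id]) (use F(3) in auto)
  then show "carrier F \<subseteq> ?S"
    using hD(1) by (metis restrict_apply' subsetI)
qed

lemma bounded_lattice_hom_eq_on_span: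
  assumes F: "bounded_lattice F" and Y: "Y \<subseteq> carrier F"
    and g: "g \<in> bounded_lattice_hom F M" and h: "h \<in> bounded_lattice_hom F M"
    and eq: "\<And>a. a \<in> Y \<Longrightarrow> g a = h a" and a: "a \<in> lattice_span F Y"
  shows "g a = h a"
  using a
  by induction
    (simp_all add: eq bounded_lattice_homD[OF g] bounded_lattice_homD[OF h] lattice_span_closed[OF F Y])

section \<open>Failure of refinement in free bounded lattices\<close>

text \<open>
  The injection \<open>e\<close> attaches two generators of \<open>F\<close> to each index, with which one can build a pair
  \<open>lower l \<sqsubseteq> upper l\<close> that admits any prescribed pair of comparable values.  A single generator per
  index would not do: for the families \<open>\<Delta>(0, x\<^sub>i)\<close> and \<open>\<Delta>(x\<^sub>i, 1)\<close> the elements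
  \<open>\<Delta>(x\<^sub>i \<sqinter> x\<^sub>j, x\<^sub>i)\<close> form a refinement matrix.  From \<open>\<iota>\<close>, only generation and the existence of
  extensions to the single test lattice \<open>M\<close> are kept.
\<close>

locale paired_generators =
  fixes F :: "'f gorder" and M :: "'m gorder" and \<iota> :: "'x \<Rightarrow> 'f" and X :: "'x set"
    and e :: "'x \<times> bool \<Rightarrow> 'x"
  assumes F: "bounded_lattice F" and M: "bounded_lattice M"
    and \<iota>: "\<iota> \<in> X \<rightarrow> carrier F" and spanned: "carrier F = lattice_span F (\<iota> ` X)"
    and extend: "\<And>f. f \<in> X \<rightarrow> carrier M \<Longrightarrow> \<exists>h. h \<in> bounded_lattice_hom F M \<and> (\<forall>x\<in>X. h (\<iota> x) = f x)"
    and e_inj: "inj_on e (X \<times> UNIV)" and e_range: "e ` (X \<times> UNIV) \<subseteq> X"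
begin

sublocale F: bounded_lattice F by (rule F)
sublocale M: bounded_lattice M by (rule M)

lemma lattices: "lattice F" "lattice M" ..

lemma eX: "l \<in> X \<Longrightarrow> e (l, b) \<in> X"
  using e_range by blast

lemma \<iota>_closed: "x \<in> X \<Longrightarrow> \<iota> x \<in> carrier F"
  using \<iota> by blast

lemma M_bounds [simp]:
  assumes "a \<in> carrier M"
  shows "\<bottom>\<^bsub>M\<^esub> \<squnion>\<^bsub>M\<^esub> a = a" "a \<squnion>\<^bsub>M\<^esub> \<bottom>\<^bsub>M\<^esub> = a" "\<top>\<^bsub>M\<^esub> \<squnion>\<^bsub>M\<^esub> a = \<top>\<^bsub>M\<^esub>" "a \<squnion>\<^bsub>M\<^esub> \<top>\<^bsub>M\<^esub> = \<top>\<^bsub>M\<^esub>"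
    "\<bottom>\<^bsub>M\<^esub> \<sqinter>\<^bsub>M\<^esub> a = \<bottom>\<^bsub>M\<^esub>" "a \<sqinter>\<^bsub>M\<^esub> \<bottom>\<^bsub>M\<^esub> = \<bottom>\<^bsub>M\<^esub>" "\<top>\<^bsub>M\<^esub> \<sqinter>\<^bsub>M\<^esub> a = a" "a \<sqinter>\<^bsub>M\<^esub> \<top>\<^bsub>M\<^esub> = a"
    "a \<squnion>\<^bsub>M\<^esub> a = a" "a \<sqinter>\<^bsub>M\<^esub> a = a"
proof -
  show "\<bottom>\<^bsub>M\<^esub> \<squnion>\<^bsub>M\<^esub> a = a" "\<top>\<^bsub>M\<^esub> \<squnion>\<^bsub>M\<^esub> a = \<top>\<^bsub>M\<^esub>" "\<bottom>\<^bsub>M\<^esub> \<sqinter>\<^bsub>M\<^esub> a = \<bottom>\<^bsub>M\<^esub>" "\<top>\<^bsub>M\<^esub> \<sqinter>\<^bsub>M\<^esub> a = a"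
    using M.bottom_join M.top_join M.bottom_meet M.top_meet assms by (simp_all add: M.eq_is_equal)
  then show "a \<squnion>\<^bsub>M\<^esub> \<bottom>\<^bsub>M\<^esub> = a" "a \<squnion>\<^bsub>M\<^esub> \<top>\<^bsub>M\<^esub> = \<top>\<^bsub>M\<^esub>" "a \<sqinter>\<^bsub>M\<^esub> \<bottom>\<^bsub>M\<^esub> = \<bottom>\<^bsub>M\<^esub>" "a \<sqinter>\<^bsub>M\<^esub> \<top>\<^bsub>M\<^esub> = a"
    by (simp_all add: join_comm meet_comm)
  show "a \<squnion>\<^bsub>M\<^esub> a = a" "a \<sqinter>\<^bsub>M\<^esub> a = a"
    using M.join_absorb2[of a a] M.meet_absorb1[of a a] assms by simp_all
qed

definition lower :: "'x \<Rightarrow> 'f" where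
  "lower l = \<iota> (e (l, False)) \<sqinter>\<^bsub>F\<^esub> \<iota> (e (l, True))"

definition upper :: "'x \<Rightarrow> 'f" where
  "upper l = \<iota> (e (l, True))"

lemma lower_upper:
  assumes "l \<in> X"
  shows "lower l \<in> carrier F" "upper l \<in> carrier F" "lower l \<sqsubseteq>\<^bsub>F\<^esub> upper l"
  using assms by (simp_all add: lower_def upper_def \<iota>_closed eX F.meet_right)

definition outer :: "'x \<Rightarrow> ('f \<times> 'f) multiset set" where
  "outer l = dim_class F {#(\<bottom>\<^bsub>F\<^esub>, lower l)#} \<otimes>\<^bsub>dimension_monoid F\<^esub> dim_class F {#(upper l, \<top>\<^bsub>F\<^esub>)#}"

definition inner :: "'x \<Rightarrow> ('f \<times> 'f) multiset set" where
  "inner l = dim_class F {#(lower l, upper l)#}"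

lemma dim_interval_closed:
  "\<lbrakk>a \<in> carrier F; b \<in> carrier F; a \<sqsubseteq>\<^bsub>F\<^esub> b\<rbrakk> \<Longrightarrow> dim_class F {#(a, b)#} \<in> carrier (dimension_monoid F)"
  by (rule dim_class_in_carrier) (simp add: dim_generators_def)

lemma outer_inner:
  assumes l: "l \<in> X"
  shows "outer l \<in> carrier (dimension_monoid F)" "inner l \<in> carrier (dimension_monoid F)"
    "order_unit (dimension_monoid F) (outer l \<otimes>\<^bsub>dimension_monoid F\<^esub> inner l)"
proof -
  let ?D = "dimension_monoid F"
  interpret D: comm_monoid ?D by (rule dimension_monoid_comm_monoid)
  note lu = lower_upper[OF l]
  note closed = dim_interval_closed[of "\<bottom>\<^bsub>F\<^esub>" "lower l"] dim_interval_closed[of "upper l" "\<top>\<^bsub>F\<^esub>"]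
    dim_interval_closed[of "lower l" "upper l"]
  show "outer l \<in> carrier ?D" "inner l \<in> carrier ?D"
    using closed lu by (simp_all add: outer_def inner_def)
  have "outer l \<otimes>\<^bsub>?D\<^esub> inner l =
      dim_class F {#(\<bottom>\<^bsub>F\<^esub>, lower l)#} \<otimes>\<^bsub>?D\<^esub> dim_class F {#(lower l, upper l)#} \<otimes>\<^bsub>?D\<^esub>
      dim_class F {#(upper l, \<top>\<^bsub>F\<^esub>)#}"
    using closed lu by (simp add: outer_def inner_def D.m_ac)
  also have "\<dots> = dim_class F {#(\<bottom>\<^bsub>F\<^esub>, \<top>\<^bsub>F\<^esub>)#}"
    using lu by (simp add: dim_interval_sum[OF lattices(1)])
  finally show "order_unit ?D (outer l \<otimes>\<^bsub>?D\<^esub> inner l)"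
    using order_unit_dimension_monoid[OF F] by simp
qed

text \<open>
  An assignment \<open>P\<close> prescribes the values of \<open>lower l\<close> and \<open>upper l\<close> for every index \<open>l\<close>; it is
  admissible if the first value is below the second.
\<close>

definition admissible :: "('x \<Rightarrow> 'm \<times> 'm) \<Rightarrow> bool" where
  "admissible P \<longleftrightarrow> (\<forall>l. fst (P l) \<in> carrier M \<and> snd (P l) \<in> carrier M \<and>
     fst (P l) \<sqinter>\<^bsub>M\<^esub> snd (P l) = fst (P l))"

text \<open>
  The value of the first generator of an index is the one meant for \<open>lower\<close>; as it lies below that
  of the second, the meet in the definition of \<open>lower\<close> does not change it.  Generators that belong
  to no index are sent to \<open>\<bottom>\<close>.
\<close>

definition generator_value :: "('x \<Rightarrow> 'm \<times> 'm) \<Rightarrow> 'x \<Rightarrow> 'm" where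
  "generator_value P u =
     (if u \<in> e ` (X \<times> UNIV)
      then case inv_into (X \<times> UNIV) e u of (l, b) \<Rightarrow> if b then snd (P l) else fst (P l)
      else \<bottom>\<^bsub>M\<^esub>)"

definition assignment_hom :: "('x \<Rightarrow> 'm \<times> 'm) \<Rightarrow> 'f \<Rightarrow> 'm" where
  "assignment_hom P = (SOME h. h \<in> bounded_lattice_hom F M \<and> (\<forall>u\<in>X. h (\<iota> u) = generator_value P u))"

lemma generator_value_pair:
  "l \<in> X \<Longrightarrow> generator_value P (e (l, b)) = (if b then snd (P l) else fst (P l))"
  using inv_into_f_f[OF e_inj, of "(l, b)"] by (simp add: generator_value_def)

lemma generator_value_cases:
  assumes "u \<in> X"
  obtains l b where "l \<in> X" "u = e (l, b)" | "\<And>P. generator_value P u = \<bottom>\<^bsub>M\<^esub>"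
  using assms by (cases "u \<in> e ` (X \<times> UNIV)") (auto simp: generator_value_def)

lemma assignment_hom:
  assumes P: "admissible P"
  shows "assignment_hom P \<in> bounded_lattice_hom F M"
    "u \<in> X \<Longrightarrow> assignment_hom P (\<iota> u) = generator_value P u"
proof -
  have "generator_value P u \<in> carrier M" if "u \<in> X" for u
    using that P by (cases u rule: generator_value_cases) (simp_all add: generator_value_pair admissible_def)
  then have "generator_value P \<in> X \<rightarrow> carrier M" by blast
  from someI_ex[OF extend[OF this]]
  show "assignment_hom P \<in> bounded_lattice_hom F M"
    "u \<in> X \<Longrightarrow> assignment_hom P (\<iota> u) = generator_value P u"
    unfolding assignment_hom_def by blast+
qed

lemma assignment_homomorphism: "admissible P \<Longrightarrow> lattice_homomorphism F M (assignment_hom P)"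
  by unfold_locales (use F M assignment_hom(1) in auto)

lemmas assignment_annihilates_class = lattice_homomorphism.annihilates_class[OF assignment_homomorphism]
  and assignment_annihilates_interval = lattice_homomorphism.annihilates_interval[OF assignment_homomorphism]
  and assignment_annihilates_mult = lattice_homomorphism.annihilates_mult[OF assignment_homomorphism]
  and assignment_annihilates_below = lattice_homomorphism.annihilates_below[OF assignment_homomorphism]
  and assignment_annihilates_order_unit =
    lattice_homomorphism.annihilates_order_unit[OF assignment_homomorphism]

lemma assignment_lower_upper:
  assumes P: "admissible P" and "l \<in> X"
  shows "assignment_hom P (lower l) = fst (P l)" "assignment_hom P (upper l) = snd (P l)"
  using assms bounded_lattice_homD(3)[OF assignment_hom(1)[OF P] \<iota>_closed \<iota>_closed, OF eX eX]
  by (simp_all add: lower_def upper_def assignment_hom(2)[OF P] eX generator_value_pair admissible_def)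

lemma annihilates_outer_inner:
  assumes P: "admissible P" and l: "l \<in> X"
  shows "annihilates (assignment_hom P) (outer l) \<longleftrightarrow> fst (P l) = \<bottom>\<^bsub>M\<^esub> \<and> snd (P l) = \<top>\<^bsub>M\<^esub>"
    "annihilates (assignment_hom P) (inner l) \<longleftrightarrow> fst (P l) = snd (P l)"
proof -
  note lu = lower_upper[OF l]
  show "annihilates (assignment_hom P) (outer l) \<longleftrightarrow> fst (P l) = \<bottom>\<^bsub>M\<^esub> \<and> snd (P l) = \<top>\<^bsub>M\<^esub>"
    using lu bounded_lattice_homD(4,5)[OF assignment_hom(1)[OF P]]
    by (auto simp: outer_def assignment_annihilates_mult[OF P] dim_interval_closed
        assignment_annihilates_interval[OF P]
        assignment_lower_upper[OF P l])
  show "annihilates (assignment_hom P) (inner l) \<longleftrightarrow> fst (P l) = snd (P l)"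
    using lu by (simp add: inner_def assignment_annihilates_interval[OF P] assignment_lower_upper[OF P l])
qed

text \<open>
  A subalgebra \<open>Q\<close> of \<open>M \<times> M \<times> M\<close> that contains the values of three assignments on the generators
  contains the joint values of the three homomorphisms everywhere.
\<close>

lemma assignment_relation:
  assumes P: "admissible P" "admissible P'" "admissible P''"
    and bounds: "Q \<bottom>\<^bsub>M\<^esub> \<bottom>\<^bsub>M\<^esub> \<bottom>\<^bsub>M\<^esub>" "Q \<top>\<^bsub>M\<^esub> \<top>\<^bsub>M\<^esub> \<top>\<^bsub>M\<^esub>"
    and join: "\<And>a b a' b' a'' b''. \<lbrakk>{a, b, a', b', a'', b''} \<subseteq> carrier M; Q a a' a''; Q b b' b''\<rbrakk> \<Longrightarrow>
      Q (a \<squnion>\<^bsub>M\<^esub> b) (a' \<squnion>\<^bsub>M\<^esub> b') (a'' \<squnion>\<^bsub>M\<^esub> b'')"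
    and meet: "\<And>a b a' b' a'' b''. \<lbrakk>{a, b, a', b', a'', b''} \<subseteq> carrier M; Q a a' a''; Q b b' b''\<rbrakk> \<Longrightarrow>
      Q (a \<sqinter>\<^bsub>M\<^esub> b) (a' \<sqinter>\<^bsub>M\<^esub> b') (a'' \<sqinter>\<^bsub>M\<^esub> b'')"
    and pairs: "\<And>l. l \<in> X \<Longrightarrow> Q (fst (P l)) (fst (P' l)) (fst (P'' l)) \<and> Q (snd (P l)) (snd (P' l)) (snd (P'' l))"
    and a: "a \<in> carrier F"
  shows "Q (assignment_hom P a) (assignment_hom P' a) (assignment_hom P'' a)"
proof -
  note h = assignment_hom[OF P(1)] and h' = assignment_hom[OF P(2)] and h'' = assignment_hom[OF P(3)]
  note hD = bounded_lattice_homD[OF h(1)] bounded_lattice_homD[OF h'(1)] bounded_lattice_homD[OF h''(1)]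
  have "a \<in> lattice_span F (\<iota> ` X)"
    using a spanned by simp
  then show ?thesis
  proof induction
    case (span_base a)
    then obtain u where u: "u \<in> X" "a = \<iota> u" by blast
    from u(1) show ?case
      by (cases u rule: generator_value_cases)
        (use pairs bounds u(1) in \<open>auto simp: u(2) h(2) h'(2) h''(2) generator_value_pair eX\<close>)
  next
    case (span_join a b)
    then have "a \<in> carrier F" "b \<in> carrier F" by (simp_all add: spanned)
    with span_join.IH show ?case by (simp add: hD join)
  next
    case (span_meet a b)
    then have "a \<in> carrier F" "b \<in> carrier F" by (simp_all add: spanned)
    with span_meet.IH show ?case by (simp add: hD meet)
  qed (simp_all add: hD bounds)
qed

lemma annihilates_transfer:
  assumes P: "admissible P" and "\<alpha> \<in> carrier (dimension_monoid F)"
    and "\<And>P'. P' \<in> Ps \<Longrightarrow> admissible P' \<and> annihilates (assignment_hom P') \<alpha>"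
    and "\<And>a b. \<lbrakk>a \<in> carrier F; b \<in> carrier F; \<And>P'. P' \<in> Ps \<Longrightarrow> assignment_hom P' a = assignment_hom P' b\<rbrakk> \<Longrightarrow>
      assignment_hom P a = assignment_hom P b"
  shows "annihilates (assignment_hom P) \<alpha>"
proof -
  obtain m where m: "set_mset m \<subseteq> dim_generators F" "\<alpha> = dim_class F m"
    using assms(2) by (rule dimension_monoid_carrierE)
  have "collapses (assignment_hom P') m" if "P' \<in> Ps" for P'
    using assms(3)[OF that] assignment_annihilates_class[OF _ m(1), of P'] m(2) by simp
  then have "assignment_hom P a = assignment_hom P b" if "(a, b) \<in> set_mset m" for a b
    using that m(1) by (intro assms(4)) (auto simp: collapses_def dim_generators_def)
  then have "collapses (assignment_hom P) m"
    by (auto simp: collapses_def)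
  then show ?thesis
    using assignment_annihilates_class[OF P m(1)] m(2) by simp
qed

text \<open>
  If all values of \<open>P\<close> lie in \<open>{\<bottom>, x, y, \<top>}\<close>, where \<open>x\<close> and \<open>y\<close> are complements, then so does the
  image of its homomorphism, and that sublattice embeds into the square of the two-element chain.
  The two coordinates are again given by assignments, \<open>P'\<close> and \<open>P''\<close>, so annihilation need only be
  tested on them.  The table \<open>T\<close> is the graph of this embedding.
\<close>

lemma annihilates_complementary:
  assumes xy: "x \<in> carrier M" "y \<in> carrier M" "x \<squnion>\<^bsub>M\<^esub> y = \<top>\<^bsub>M\<^esub>" "x \<sqinter>\<^bsub>M\<^esub> y = \<bottom>\<^bsub>M\<^esub>"
    and nontriv: "\<bottom>\<^bsub>M\<^esub> \<noteq> \<top>\<^bsub>M\<^esub>"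
    and P: "admissible P" "admissible P'" "admissible P''"
    and T: "T = {(\<bottom>\<^bsub>M\<^esub>, \<bottom>\<^bsub>M\<^esub>, \<bottom>\<^bsub>M\<^esub>), (x, \<top>\<^bsub>M\<^esub>, \<bottom>\<^bsub>M\<^esub>), (y, \<bottom>\<^bsub>M\<^esub>, \<top>\<^bsub>M\<^esub>), (\<top>\<^bsub>M\<^esub>, \<top>\<^bsub>M\<^esub>, \<top>\<^bsub>M\<^esub>)}"
    and pairs: "\<And>l. l \<in> X \<Longrightarrow> (fst (P l), fst (P' l), fst (P'' l)) \<in> T \<and> (snd (P l), snd (P' l), snd (P'' l)) \<in> T"
    and \<alpha>: "\<alpha> \<in> carrier (dimension_monoid F)"
    and "annihilates (assignment_hom P') \<alpha>" "annihilates (assignment_hom P'') \<alpha>"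
  shows "annihilates (assignment_hom P) \<alpha>"
proof (rule annihilates_transfer[OF P(1) \<alpha>, of "{P', P''}"])
  have xy': "y \<squnion>\<^bsub>M\<^esub> x = \<top>\<^bsub>M\<^esub>" "y \<sqinter>\<^bsub>M\<^esub> x = \<bottom>\<^bsub>M\<^esub>"
    using xy by (simp_all add: join_comm meet_comm)
  have rel: "(assignment_hom P a, assignment_hom P' a, assignment_hom P'' a) \<in> T" if "a \<in> carrier F" for a
  proof (rule assignment_relation[OF P, where Q = "\<lambda>a b c. (a, b, c) \<in> T"])
    show "(a \<squnion>\<^bsub>M\<^esub> b, a' \<squnion>\<^bsub>M\<^esub> b', a'' \<squnion>\<^bsub>M\<^esub> b'') \<in> T" "(a \<sqinter>\<^bsub>M\<^esub> b, a' \<sqinter>\<^bsub>M\<^esub> b', a'' \<sqinter>\<^bsub>M\<^esub> b'') \<in> T"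
      if "(a, a', a'') \<in> T" "(b, b', b'') \<in> T" for a b a' b' a'' b''
      using that unfolding T by (elim insertE emptyE Pair_inject; hypsubst; simp add: xy xy')+
    show "(\<bottom>\<^bsub>M\<^esub>, \<bottom>\<^bsub>M\<^esub>, \<bottom>\<^bsub>M\<^esub>) \<in> T" "(\<top>\<^bsub>M\<^esub>, \<top>\<^bsub>M\<^esub>, \<top>\<^bsub>M\<^esub>) \<in> T"
      by (simp_all add: T)
  qed (use that pairs in blast)+
  show "assignment_hom P a = assignment_hom P b"
    if "a \<in> carrier F" "b \<in> carrier F" "\<And>Q. Q \<in> {P', P''} \<Longrightarrow> assignment_hom Q a = assignment_hom Q b" for a b
    using rel[OF that(1)] rel[OF that(2)] that(3)[of P'] that(3)[of P''] nontriv
    by (auto simp: T)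
qed (use assms in auto)

text \<open>
  The principal ideal below \<open>x\<close> and the principal filter above \<open>z\<close> are disjoint, so sending the
  former to \<open>\<bottom>\<close> and the latter to \<open>\<top>\<close> is a well-defined lattice homomorphism on their union.  If
  the values of \<open>P\<close> on the generators lie in this union, the homomorphism of \<open>P'\<close> factors through
  that of \<open>P\<close>.
\<close>

lemma annihilates_separating:
  assumes xz: "x \<in> carrier M" "z \<in> carrier M" "\<not> z \<sqsubseteq>\<^bsub>M\<^esub> x"
    and P: "admissible P" "admissible P'"
    and Q: "Q = (\<lambda>u v. u \<sqsubseteq>\<^bsub>M\<^esub> x \<and> v = \<bottom>\<^bsub>M\<^esub> \<or> z \<sqsubseteq>\<^bsub>M\<^esub> u \<and> v = \<top>\<^bsub>M\<^esub>)"
    and pairs: "\<And>l. l \<in> X \<Longrightarrow> Q (fst (P l)) (fst (P' l)) \<and> Q (snd (P l)) (snd (P' l))"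
    and \<alpha>: "\<alpha> \<in> carrier (dimension_monoid F)" and "annihilates (assignment_hom P) \<alpha>"
  shows "annihilates (assignment_hom P') \<alpha>"
proof (rule annihilates_transfer[OF P(2) \<alpha>, of "{P}"])
  have rel: "Q (assignment_hom P a) (assignment_hom P' a)" if "a \<in> carrier F" for a
  proof (rule assignment_relation[OF P P(2), where Q = "\<lambda>a b c. Q a b"])
    show "Q \<bottom>\<^bsub>M\<^esub> \<bottom>\<^bsub>M\<^esub>" "Q \<top>\<^bsub>M\<^esub> \<top>\<^bsub>M\<^esub>"
      using xz by (simp_all add: Q)
    show "Q (a \<squnion>\<^bsub>M\<^esub> b) (a' \<squnion>\<^bsub>M\<^esub> b')"
      if "{a, b, a', b', a'', b''} \<subseteq> carrier M" "Q a a'" "Q b b'" for a b a' b' a'' b''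
      using that xz(1,2) unfolding Q by (auto intro: M.join_le M.le_joinI1 M.le_joinI2)
    show "Q (a \<sqinter>\<^bsub>M\<^esub> b) (a' \<sqinter>\<^bsub>M\<^esub> b')"
      if "{a, b, a', b', a'', b''} \<subseteq> carrier M" "Q a a'" "Q b b'" for a b a' b' a'' b''
      using that xz(1,2) unfolding Q by (auto intro: M.meet_le M.meet_leI1 M.meet_leI2)
  qed (use that pairs in auto)
  have "\<not> (z \<sqsubseteq>\<^bsub>M\<^esub> u \<and> u \<sqsubseteq>\<^bsub>M\<^esub> x)" if "u \<in> carrier M" for u
    using xz that M.le_trans by blast
  moreover have "assignment_hom P a \<in> carrier M" if "a \<in> carrier F" for a
    using bounded_lattice_homD(1)[OF assignment_hom(1)[OF P(1)] that] .
  ultimately show "assignment_hom P' a = assignment_hom P' b"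
    if "a \<in> carrier F" "b \<in> carrier F" "\<And>Q. Q \<in> {P} \<Longrightarrow> assignment_hom Q a = assignment_hom Q b" for a b
    using rel[OF that(1)] rel[OF that(2)] that(3)[of P] that(1,2) unfolding Q by auto
qed (use assms in auto)

text \<open>
  A representing multiset involves finitely many elements of \<open>F\<close>, these involve finitely many
  generators, and each generator belongs to at most one index.
\<close>

lemma annihilates_finite_support:
  assumes \<alpha>: "\<alpha> \<in> carrier (dimension_monoid F)"
  shows "\<exists>S. finite S \<and> (\<forall>P P'. admissible P \<longrightarrow> admissible P' \<longrightarrow> (\<forall>l\<in>S. P l = P' l) \<longrightarrow>
    annihilates (assignment_hom P) \<alpha> \<longrightarrow> annihilates (assignment_hom P') \<alpha>)"
proof -
  obtain m where m: "set_mset m \<subseteq> dim_generators F" "\<alpha> = dim_class F m"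
    using \<alpha> by (rule dimension_monoid_carrierE)
  let ?A = "fst ` set_mset m \<union> snd ` set_mset m"
  have "?A \<subseteq> lattice_span F (\<iota> ` X)"
    using m(1) unfolding spanned[symmetric] dim_generators_def by force
  then obtain Y where Y: "Y \<subseteq> X" "finite Y" "?A \<subseteq> lattice_span F (\<iota> ` Y)"
    using lattice_span_finite_support_set[of ?A F \<iota> X] by auto
  \<comment> \<open>The indices of the generators in \<open>Y\<close>; for generators outside the range of \<open>e\<close> the inverse is
    arbitrary and only enlarges this set.\<close>
  define S where "S = (\<lambda>u. fst (inv_into (X \<times> UNIV) e u)) ` Y"
  have YF: "\<iota> ` Y \<subseteq> carrier F"
    using Y(1) \<iota>_closed by blast
  show ?thesis
  proof (intro exI[of _ S] conjI allI impI)
    show "finite S"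
      using Y(2) by (simp add: S_def)
    fix P P' assume P: "admissible P" and P': "admissible P'" and eq: "\<forall>l\<in>S. P l = P' l"
      and ann: "annihilates (assignment_hom P) \<alpha>"
    have gen: "assignment_hom P (\<iota> u) = assignment_hom P' (\<iota> u)" if u: "u \<in> Y" for u
    proof -
      have uX: "u \<in> X" using u Y(1) by blast
      then show ?thesis
      proof (cases u rule: generator_value_cases)
        case (1 l b)
        then have "l \<in> S"
          using u inv_into_f_f[OF e_inj, of "(l, b)"] by (force simp: S_def)
        with eq 1 uX show ?thesis
          by (simp add: assignment_hom(2)[OF P] assignment_hom(2)[OF P'] generator_value_pair)
      next
        case 2
        with uX show ?thesis
          by (simp add: assignment_hom(2)[OF P] assignment_hom(2)[OF P'])
      qed
    qed
    have "assignment_hom P a = assignment_hom P' a" if "a \<in> lattice_span F (\<iota> ` Y)" for a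
      by (rule bounded_lattice_hom_eq_on_span[OF F YF assignment_hom(1)[OF P] assignment_hom(1)[OF P'] _ that])
        (use gen in blast)
    moreover have "a \<in> lattice_span F (\<iota> ` Y)" "b \<in> lattice_span F (\<iota> ` Y)" if "(a, b) \<in> set_mset m" for a b
      using that Y(3) image_eqI[of a fst "(a, b)"] image_eqI[of b snd "(a, b)"] by auto
    ultimately have "assignment_hom P a = assignment_hom P' a" "assignment_hom P b = assignment_hom P' b"
      if "(a, b) \<in> set_mset m" for a b
      using that by blast+
    then have "collapses (assignment_hom P) m \<longleftrightarrow> collapses (assignment_hom P') m"
      by (auto simp: collapses_def)
    then show "annihilates (assignment_hom P') \<alpha>"
      using ann assignment_annihilates_class[OF P m(1)] assignment_annihilates_class[OF P' m(1)] m(2) by simp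
  qed
qed

text \<open>
  By the free set theorem there are indices \<open>i\<close>, \<open>j\<close>, \<open>k\<close> such that each of \<open>c i j\<close>, \<open>c j k\<close>, \<open>c i k\<close> does
  not see the values at the third index.  Assign \<open>(\<bottom>, x)\<close> to \<open>i\<close>, \<open>(y, \<top>)\<close> to \<open>j\<close> and
  \<open>(\<bottom>, z)\<close> to \<open>k\<close>.  Any two of these pairs generate a distributive sublattice, where the matrix
  entries are determined by the conditions imposed on them: \<open>c i j\<close> and \<open>c j k\<close> are annihilated, but
  \<open>c i k\<close> is not, because \<open>z\<close> is not below \<open>x\<close>.  This contradicts the triangle inequality.
\<close>

theorem not_weak_uniform_refinement:
  assumes card: "cardSuc (cardSuc natLeq) \<le>o |X|"
    and x: "x \<in> carrier M" and y: "y \<in> carrier M" and z: "z \<in> carrier M"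
    and xy: "x \<squnion>\<^bsub>M\<^esub> y = \<top>\<^bsub>M\<^esub>" "x \<sqinter>\<^bsub>M\<^esub> y = \<bottom>\<^bsub>M\<^esub>"
    and zy: "z \<squnion>\<^bsub>M\<^esub> y = \<top>\<^bsub>M\<^esub>" "z \<sqinter>\<^bsub>M\<^esub> y = \<bottom>\<^bsub>M\<^esub>"
    and zx: "\<not> z \<sqsubseteq>\<^bsub>M\<^esub> x"
  shows "\<not> weak_uniform_refinement (dimension_monoid F) X"
proof
  let ?D = "dimension_monoid F" and ?bot = "\<bottom>\<^bsub>M\<^esub>" and ?top = "\<top>\<^bsub>M\<^esub>"
  interpret D: comm_monoid ?D by (rule dimension_monoid_comm_monoid)
  assume W: "weak_uniform_refinement ?D X"
  have "\<forall>l\<in>X. outer l \<in> carrier ?D \<and> inner l \<in> carrier ?D \<and> order_unit ?D (outer l \<otimes>\<^bsub>?D\<^esub> inner l)"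
    using outer_inner by blast
  from W[unfolded weak_uniform_refinement_def, THEN spec, THEN spec, THEN mp, OF this]
  obtain c where "refinement_matrix ?D X outer inner c" ..
  note c = refinement_matrixD[OF this]
  have "\<forall>i\<in>X. \<forall>j\<in>X. \<exists>S. finite S \<and> (\<forall>P P'. admissible P \<longrightarrow> admissible P' \<longrightarrow> (\<forall>l\<in>S. P l = P' l) \<longrightarrow>
      annihilates (assignment_hom P) (c i j) \<longrightarrow> annihilates (assignment_hom P') (c i j))"
    using annihilates_finite_support[OF c(1)] by blast
  then obtain S where S: "\<And>i j. \<lbrakk>i \<in> X; j \<in> X\<rbrakk> \<Longrightarrow> finite (S i j)"
    "\<And>i j P P'. \<lbrakk>i \<in> X; j \<in> X; admissible P; admissible P'; \<And>l. l \<in> S i j \<Longrightarrow> P l = P' l;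
      annihilates (assignment_hom P) (c i j)\<rbrakk> \<Longrightarrow> annihilates (assignment_hom P') (c i j)"
    by metis
  have "\<exists>i\<in>X. \<exists>j\<in>X. \<exists>k\<in>X. i \<noteq> j \<and> j \<noteq> k \<and> i \<noteq> k \<and> k \<notin> S i j \<and> i \<notin> S j k \<and> j \<notin> S i k"
    by (rule free_triple[OF card]) (rule S(1))
  then obtain i j k where ijk: "i \<in> X" "j \<in> X" "k \<in> X" "i \<noteq> j" "j \<noteq> k" "i \<noteq> k"
    and free: "k \<notin> S i j" "i \<notin> S j k" "j \<notin> S i k"
    by blast
  \<comment> \<open>In a one-element lattice \<open>z\<close> would be below \<open>x\<close>.\<close>
  have nontriv: "?bot \<noteq> ?top"
    using zx x z M.bottom_lower[of x] M.top_higher[of z] M.le_antisym M.le_trans[of z ?top x]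
    by (metis M.bottom_closed M.top_closed)
  define assign where "assign p q r = (\<lambda>_. (?bot, ?bot))(i := p, j := q, k := r)" for p q r
  define pairs where "pairs = {(?bot, ?bot), (?bot, x), (?bot, z), (y, ?top), (?bot, ?top), (?top, ?top)}"
  have pairs: "fst p \<in> carrier M \<and> snd p \<in> carrier M \<and> fst p \<sqinter>\<^bsub>M\<^esub> snd p = fst p" if "p \<in> pairs" for p
    using that x y z unfolding pairs_def by (elim insertE emptyE) simp_all
  have adm: "admissible (assign p q r)" if "{p, q, r} \<subseteq> pairs" for p q r
  proof -
    have "assign p q r l \<in> pairs" for l
      using that by (simp add: assign_def) (simp add: pairs_def)
    then show ?thesis
      using pairs unfolding admissible_def by blast
  qed
  note adm = adm[unfolded pairs_def]
  \<comment> \<open>Coordinates in the square \<open>{\<bottom>, x, y, \<top>}\<close>: one makes \<open>outer i\<close> vanish, the other \<open>inner j\<close>, and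
    \<open>c i j\<close> is below both.\<close>
  have c_ij: "annihilates (assignment_hom (assign (?bot, x) (y, ?top) (?bot, ?bot))) (c i j)"
  proof (rule annihilates_complementary[OF x y xy nontriv _ _ _ refl _ c(1)[OF ijk(1,2)]])
    let ?P' = "assign (?bot, ?top) (?bot, ?top) (?bot, ?bot)"
      and ?P'' = "assign (?bot, ?bot) (?top, ?top) (?bot, ?bot)"
    show "admissible ?P'" "admissible ?P''" by (rule adm, simp)+
    have "annihilates (assignment_hom ?P') (outer i)"
      using ijk by (subst annihilates_outer_inner) (simp_all add: adm, simp_all add: assign_def)
    then show "annihilates (assignment_hom ?P') (c i j)"
      using assignment_annihilates_below[OF adm c(1) _ c(2)] outer_inner(1) ijk by simp
    have "annihilates (assignment_hom ?P'') (inner j)"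
      using ijk by (subst annihilates_outer_inner) (simp_all add: adm, simp_all add: assign_def)
    then show "annihilates (assignment_hom ?P'') (c i j)"
      using assignment_annihilates_below[OF adm c(1) _ c(3)] outer_inner(2) ijk by simp
  qed (simp_all add: adm, simp_all add: assign_def)
  \<comment> \<open>Likewise in the square \<open>{\<bottom>, z, y, \<top>}\<close>, with \<open>outer j\<close> and \<open>inner k\<close>.\<close>
  have c_jk: "annihilates (assignment_hom (assign (?bot, ?bot) (y, ?top) (?bot, z))) (c j k)"
  proof (rule annihilates_complementary[OF z y zy nontriv _ _ _ refl _ c(1)[OF ijk(2,3)]])
    let ?P' = "assign (?bot, ?bot) (?bot, ?top) (?bot, ?top)" and ?P'' = "assign (?bot, ?bot) (?top, ?top) (?bot, ?bot)"
    show "admissible ?P'" "admissible ?P''" by (rule adm, simp)+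
    have "annihilates (assignment_hom ?P') (outer j)"
      using ijk by (subst annihilates_outer_inner) (simp_all add: adm, simp_all add: assign_def)
    then show "annihilates (assignment_hom ?P') (c j k)"
      using assignment_annihilates_below[OF adm c(1) _ c(2)] outer_inner(1) ijk by simp
    have "annihilates (assignment_hom ?P'') (inner k)"
      using ijk by (subst annihilates_outer_inner) (simp_all add: adm, simp_all add: assign_def)
    then show "annihilates (assignment_hom ?P'') (c j k)"
      using assignment_annihilates_below[OF adm c(1) _ c(3)] outer_inner(2) ijk by simp
  qed (simp_all add: adm, simp_all add: assign_def)
  \<comment> \<open>Neither entry sees the value at the third index, so the two partial assignments combine.\<close>
  let ?P = "assign (?bot, x) (y, ?top) (?bot, z)"
  have P: "admissible ?P" by (rule adm) simp
  have "annihilates (assignment_hom ?P) (c i j)"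
    by (rule S(2)[OF ijk(1,2) adm P _ c_ij]) (simp, use free ijk in \<open>auto simp: assign_def\<close>)
  moreover have "annihilates (assignment_hom ?P) (c j k)"
    by (rule S(2)[OF ijk(2,3) adm P _ c_jk]) (simp, use free ijk in \<open>auto simp: assign_def\<close>)
  ultimately have "annihilates (assignment_hom ?P) (c i j \<otimes>\<^bsub>?D\<^esub> c j k)"
    using ijk by (simp add: assignment_annihilates_mult[OF P] c(1))
  then have P_ik: "annihilates (assignment_hom ?P) (c i k)"
    using assignment_annihilates_below[OF P c(1) _ c(5)] c(1) ijk by simp
  \<comment> \<open>Since \<open>c i k\<close> does not see the value at \<open>j\<close>, this value may be reset, which leaves the
    distributive sublattice generated by \<open>x\<close> and \<open>z\<close>.\<close>
  have c_ik: "annihilates (assignment_hom (assign (?bot, x) (?bot, ?bot) (?bot, z))) (c i k)"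
    by (rule S(2)[OF ijk(1,3) P adm _ P_ik]) (simp, use free ijk in \<open>auto simp: assign_def\<close>)
  \<comment> \<open>The images of \<open>(\<bottom>, x)\<close> and \<open>(\<bottom>, z)\<close> under the homomorphism with \<open>x \<mapsto> \<bottom>\<close>, \<open>z \<mapsto> \<top>\<close>.
    This assignment also annihilates \<open>outer k\<close> and \<open>inner i\<close>, hence an order unit.\<close>
  let ?Q = "assign (?bot, ?bot) (?bot, ?bot) (?bot, ?top)"
  have Q: "admissible ?Q" by (rule adm) simp
  have "annihilates (assignment_hom ?Q) (c i k)"
    by (rule annihilates_separating[OF x z zx _ Q refl _ c(1)[OF ijk(1,3)] c_ik])
      (simp add: adm, use x z in \<open>simp add: assign_def\<close>)
  moreover have "annihilates (assignment_hom ?Q) (outer k)" "annihilates (assignment_hom ?Q) (inner i)"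
    using ijk by (simp_all add: annihilates_outer_inner[OF Q], simp_all add: assign_def)
  ultimately have "annihilates (assignment_hom ?Q) (c i k \<otimes>\<^bsub>?D\<^esub> (outer k \<otimes>\<^bsub>?D\<^esub> inner i))"
    using ijk by (simp add: assignment_annihilates_mult[OF Q] c(1) outer_inner)
  then have "?bot = ?top"
    using assignment_annihilates_order_unit[OF Q c(4)] ijk by blast
  with nontriv show False ..
qed

end

section \<open>The dimension monoid of a free lattice and regular rings\<close>

theorem corollary10p30:
  fixes E :: "lattice_identity set"
    and L :: "'l gorder"
    and X :: "'x set"
    and F :: "'f gorder"
    and \<iota> :: "'x \<Rightarrow> 'f"
  assumes "L \<in> lattice_variety E" and "\<not> distributive_lattice L"
    and "cardSuc (cardSuc natLeq) \<le>o |X|"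
    and "free_bounded_lattice E X F \<iota>"
  shows "\<nexists>R::'r ring. regular_ring R \<and> V_monoid R \<cong> dimension_monoid F"
proof
  assume "\<exists>R::'r ring. regular_ring R \<and> V_monoid R \<cong> dimension_monoid F"
  then obtain R :: "'r ring" where R: "regular_ring R" "V_monoid R \<cong> dimension_monoid F"
    by blast
  have "ring R"
    using R(1) by (simp add: regular_ring_def)
  interpret V: comm_monoid "V_monoid R" by (rule V_monoid_comm_monoid) fact
  interpret D: comm_monoid "dimension_monoid F" by (rule dimension_monoid_comm_monoid)
  have W: "weak_uniform_refinement (dimension_monoid F) X"
    by (rule weak_uniform_refinement_iso[OF V.monoid_axioms D.monoid_axioms R(2)
          V_monoid_weak_uniform_refinement[OF R(1)]])
  obtain M :: "'l gorder" and x y z where M: "M \<in> lattice_variety E" "bounded_lattice M"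
    and xyz: "x \<in> carrier M" "y \<in> carrier M" "z \<in> carrier M"
      "x \<squnion>\<^bsub>M\<^esub> y = \<top>\<^bsub>M\<^esub>" "z \<squnion>\<^bsub>M\<^esub> y = \<top>\<^bsub>M\<^esub>" "x \<sqinter>\<^bsub>M\<^esub> y = \<bottom>\<^bsub>M\<^esub>" "z \<sqinter>\<^bsub>M\<^esub> y = \<bottom>\<^bsub>M\<^esub>"
      "\<not> z \<sqsubseteq>\<^bsub>M\<^esub> x"
    using nondistributive_interval[OF assms(1,2)] by metis
  have "natLeq \<le>o cardSuc natLeq" "cardSuc natLeq \<le>o cardSuc (cardSuc natLeq)"
    using cardSuc_ordLeq natLeq_Card_order cardSuc_Card_order by blast+
  then have "natLeq \<le>o |X|"
    using assms(3) by (rule ordLeq_transitive[OF ordLeq_transitive])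
  then have "infinite X"
    using infinite_iff_natLeq_ordLeq[of X] by simp
  then obtain e :: "'x \<times> bool \<Rightarrow> 'x" where e: "inj_on e (X \<times> UNIV)" "e ` (X \<times> UNIV) \<subseteq> X"
    by (rule injection_from_pairs)
  have free: "free_bounded_lattice_wrt TYPE('l) E X F \<iota>"
    by (rule free_bounded_lattice_any[OF assms(4)])
  interpret paired_generators F M \<iota> X e
  proof (rule paired_generators.intro)
    show "bounded_lattice F" "\<iota> \<in> X \<rightarrow> carrier F"
      using free by (auto simp: free_bounded_lattice_wrt_def)
    show "carrier F = lattice_span F (\<iota> ` X)"
      by (rule free_bounded_lattice_spanned[OF assms(4)])
    show "\<exists>h. h \<in> bounded_lattice_hom F M \<and> (\<forall>x\<in>X. h (\<iota> x) = f x)" if "f \<in> X \<rightarrow> carrier M" for f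
      using free_bounded_lattice_wrtD(1)[OF free M(2,1) that] by blast
  qed (fact M e)+
  show False
    using not_weak_uniform_refinement[OF assms(3) xyz(1-3,4,6,5,7,8)] W by blast
qed

end
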